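(* Let $S$ be a finite nonempty set of positive integers with $i=\max(S)$. Then both sequences $(\alpha_S(\Pi_n))_{n\ge i+2}$ and $(\beta_S(\Pi_n))_{n\ge i+2}$ stabilize beyond $n=4i$.
   Context: $\Pi_n$ is the lattice of set partitions of $\{1,\dots,n\}$ ordered by refinement, with $\mathrm{rank}(\pi)=n-(\text{number of blocks})$. For $T\subseteq\{1,\dots,n-2\}$, $\alpha_T(\Pi_n)$ is the character of the permutation action of $S_n$ on maximal chains of the rank-selected subposet $\{\pi:\mathrm{rank}(\pi)\in T\}$ ($\alpha_\emptyset$ is trivial), and $\beta_S(\Pi_n)=\sum_{T\subseteq S}(-1)^{|S\setminus T|}\alpha_T(\Pi_n)$. For a partition $\lambda$, $\lambda+(m)=(\lambda_1+m,\lambda_2,\dots)$; for $\chi=\sum c_\lambda\chi^\lambda$, $\chi^{(+m)}=\sum c_\lambda\chi^{\lambda+(m)}$. A sequence $(\chi_n)$ stabilizes beyond $n_0$ if $\chi_n=\chi_{n_0}^{(+(n-n_0))}$ for all $n\ge n_0$. *)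

theory Defs
  imports Complex_Main "HOL-Combinatorics.Permutations" "HOL-Library.FuncSet" "HOL-Library.Disjoint_Sets"
begin

definition setpart :: "nat \<Rightarrow> nat set set \<Rightarrow> bool" where
  "setpart n P \<longleftrightarrow> partition_on {1..n} P"

definition refines :: "nat set set \<Rightarrow> nat set set \<Rightarrow> bool" where
  "refines P Q \<longleftrightarrow> (\<forall>b\<in>P. \<exists>c\<in>Q. b \<subseteq> c)"

definition prank :: "nat \<Rightarrow> nat set set \<Rightarrow> nat" where
  "prank n P = n - card P"

definition rank_sel :: "nat \<Rightarrow> nat set \<Rightarrow> nat set set set" where
  "rank_sel n T = {P. setpart n P \<and> prank n P \<in> T}"

definition is_chain :: "nat \<Rightarrow> nat set \<Rightarrow> nat set set set \<Rightarrow> bool" where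
  "is_chain n T C \<longleftrightarrow> C \<subseteq> rank_sel n T \<and> (\<forall>P\<in>C. \<forall>Q\<in>C. refines P Q \<or> refines Q P)"

definition is_maxchain :: "nat \<Rightarrow> nat set \<Rightarrow> nat set set set \<Rightarrow> bool" where
  "is_maxchain n T C \<longleftrightarrow> is_chain n T C \<and> (\<forall>D. is_chain n T D \<and> C \<subseteq> D \<longrightarrow> D = C)"

definition act_part :: "(nat \<Rightarrow> nat) \<Rightarrow> nat set set \<Rightarrow> nat set set" where
  "act_part \<sigma> P = (\<lambda>b. \<sigma> ` b) ` P"

definition act_chain :: "(nat \<Rightarrow> nat) \<Rightarrow> nat set set set \<Rightarrow> nat set set set" where
  "act_chain \<sigma> C = act_part \<sigma> ` C"

definition alpha :: "nat \<Rightarrow> nat set \<Rightarrow> (nat \<Rightarrow> nat) \<Rightarrow> int" where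
  "alpha n T \<sigma> = int (card {C. is_maxchain n T C \<and> act_chain \<sigma> C = C})"

definition beta :: "nat \<Rightarrow> nat set \<Rightarrow> (nat \<Rightarrow> nat) \<Rightarrow> int" where
  "beta n S \<sigma> = (\<Sum>T\<in>Pow S. (-1) ^ card (S - T) * alpha n T \<sigma>)"

definition int_partitions :: "nat \<Rightarrow> nat list set" where
  "int_partitions n = {la. sorted (rev la) \<and> 0 \<notin> set la \<and> sum_list la = n}"

definition part_nth :: "nat list \<Rightarrow> nat \<Rightarrow> nat" where
  "part_nth la i = (if i < length la then la ! i else 0)"

definition part_plus :: "nat list \<Rightarrow> nat \<Rightarrow> nat list" where
  "part_plus la m = (case la of [] \<Rightarrow> [m] | x # xs \<Rightarrow> (x + m) # xs)"

(* Irreducible character chi^lambda of S_n at sigma (a permutation of {1..n}),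
   via the Frobenius formula  chi^lambda(sigma) = [x^(lambda+delta)] a_delta * p_{cycle type(sigma)}
   in n variables x_0..x_{n-1}, delta = (n-1,...,0).  The power sum p_rho is expanded as the
   sum over colourings g of {1..n} by variables that are constant on sigma-orbits. *)
definition irr_char :: "nat \<Rightarrow> nat list \<Rightarrow> (nat \<Rightarrow> nat) \<Rightarrow> int" where
  "irr_char n la \<sigma> =
     (\<Sum>w\<in>{w. w permutes {0..<n}}. sign w *
        int (card {g \<in> {1..n} \<rightarrow>\<^sub>E {0..<n}.
                (\<forall>x\<in>{1..n}. g (\<sigma> x) = g x) \<and>
                (\<forall>j<n. int (card {x\<in>{1..n}. g x = j}) = int (part_nth la j) + int (w j) - int j)}))"

definition char_coeff :: "nat \<Rightarrow> ((nat \<Rightarrow> nat) \<Rightarrow> int) \<Rightarrow> nat list \<Rightarrow> rat" where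
  "char_coeff n \<chi> la =
     (\<Sum>\<sigma>\<in>{\<sigma>. \<sigma> permutes {1..n}}. of_int (\<chi> \<sigma> * irr_char n la \<sigma>)) / of_nat (fact n)"

definition char_plus :: "nat \<Rightarrow> nat \<Rightarrow> ((nat \<Rightarrow> nat) \<Rightarrow> int) \<Rightarrow> (nat \<Rightarrow> nat) \<Rightarrow> rat" where
  "char_plus n0 m \<chi> \<sigma> =
     (\<Sum>la\<in>int_partitions n0. char_coeff n0 \<chi> la * of_int (irr_char (n0 + m) (part_plus la m) \<sigma>))"

definition stabilizes_beyond :: "(nat \<Rightarrow> (nat \<Rightarrow> nat) \<Rightarrow> int) \<Rightarrow> nat \<Rightarrow> bool" where
  "stabilizes_beyond \<chi> n0 \<longleftrightarrow>
     (\<forall>n\<ge>n0. \<forall>\<sigma>. \<sigma> permutes {1..n} \<longrightarrow> of_int (\<chi> n \<sigma>) = char_plus n0 (n - n0) (\<chi> n0) \<sigma>)"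

end

theory Submission
  imports Defs "HOL-Combinatorics.Orbits"
begin

text \<open>
  By the Frobenius formula, \<open>\<chi>\<^sup>\<lambda>\<close> is the Jacobi--Trudi determinant \<open>det (h\<^bsub>\<lambda>\<^sub>j + k - j\<^esub>)\<close> in the permutation
  characters of Young subgroups. Pieri's rule gives \<open>\<langle>\<chi>\<^sup>\<lambda>, h\<^sub>b\<rangle> = 0\<close> unless \<open>\<lambda>\<close> dominates \<open>b\<close>, from which
  orthonormality follows, and then completeness among the class functions of \<open>S\<^sub>n\<close>.
  A chain of partitions of rank at most \<open>i\<close> leaves all but at most \<open>2 i\<close> points as singletons, so
  \<open>\<alpha>\<^sub>T(\<Pi>\<^sub>n)\<close> is a sum over \<open>m \<le> 2 i\<close> of characters \<open>\<psi>\<^sub>m \<circ> 1\<close> induced from \<open>S\<^sub>m \<times> S\<^bsub>n-m\<^esub>\<close>, where \<open>\<psi>\<^sub>m\<close> does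
  not depend on \<open>n\<close>. Expanding the determinant of \<open>\<chi>\<^bsup>(n-m, \<nu>)\<^esup>\<close> along its first row shows by induction
  on \<open>m\<close> that such a character is a combination of the \<open>\<chi>\<^bsup>(n-k, \<nu>)\<^esup>\<close>, \<open>\<nu> \<turnstile> k \<le> m\<close>, with coefficients independent
  of \<open>n\<close>; once \<open>n \<ge> 2 m\<close> all the shapes \<open>(n-k, \<nu>)\<close> are partitions.
\<close>

text \<open>As \<open>irr_char\<close> is given only by the Frobenius formula, everything usually
  quoted from representation theory has to come from counting. Orthonormality is needed because
  \<open>char_coeff\<close> is an inner product and has to return the coefficients of a given
  expansion. Completeness is needed because the \<psi>_m are known only to be invariant under
  relabelling; no explicit decomposition of them is available. The constant 4i is 2 * (2i). On the
  support of a chain the coarsest member has only blocks with at least two points, so a rank of at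
  most i forces at most 2i points. A shape (n-m, \<nu>) with \<nu> of size m is a partition as soon
  as n - m is at least m, because no part of \<nu> exceeds m. Both bounds use only that the ranks
  are at most i; they hold for every T contained in S, and the signed combination \<beta>_S
  therefore has the same threshold.\<close>

definition colset :: "nat set \<Rightarrow> nat \<Rightarrow> (nat \<Rightarrow> int) \<Rightarrow> (nat \<Rightarrow> nat) set" where
  "colset A L b = {g \<in> A \<rightarrow>\<^sub>E {0..<L}. \<forall>j<L. int (card {x\<in>A. g x = j}) = b j}"

definition invcol :: "nat set \<Rightarrow> nat \<Rightarrow> (nat \<Rightarrow> int) \<Rightarrow> (nat \<Rightarrow> nat) \<Rightarrow> (nat \<Rightarrow> nat) set" where
  "invcol A L b \<sigma> = {g \<in> colset A L b. \<forall>x\<in>A. g (\<sigma> x) = g x}"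

text \<open>In symmetric-function terms this is the product of the complete functions h with indices
  \<open>b j\<close>, evaluated at the cycle type of \<open>\<sigma>\<close>. Contents are integers
  because entries of a Jacobi-Trudi determinant may have negative index; no colouring has such a
  content, which is the convention that h vanishes there.\<close>

definition hc :: "nat set \<Rightarrow> nat \<Rightarrow> (nat \<Rightarrow> int) \<Rightarrow> (nat \<Rightarrow> nat) \<Rightarrow> int" where
  "hc A L b \<sigma> = int (card (invcol A L b \<sigma>))"

text \<open>The Jacobi--Trudi determinant in the permutation characters \<^const>\<open>hc\<close> of Young subgroups;
  the index vector \<open>u\<close> need not be a partition.\<close>
definition chi :: "nat set \<Rightarrow> nat \<Rightarrow> (nat \<Rightarrow> int) \<Rightarrow> (nat \<Rightarrow> nat) \<Rightarrow> int" where
  "chi A L u \<sigma> = (\<Sum>w\<in>{w. w permutes {0..<L}}. sign w * hc A L (\<lambda>j. u j + int (w j) - int j) \<sigma>)"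

lemma irr_char_eq_chi: "irr_char n la \<sigma> = chi {1..n} n (\<lambda>j. int (part_nth la j)) \<sigma>"
  unfolding irr_char_def chi_def hc_def invcol_def colset_def
  by (intro sum.cong refl arg_cong2[where f="(*)"] arg_cong[where f=int] arg_cong[where f=card]) auto

lemma finite_colset: "finite A \<Longrightarrow> finite (colset A L b)"
  unfolding colset_def by (rule finite_subset[of _ "A \<rightarrow>\<^sub>E {0..<L}"]) (auto intro: finite_PiE)

lemma finite_invcol: "finite A \<Longrightarrow> finite (invcol A L b \<sigma>)"
  unfolding invcol_def by (simp add: finite_colset)

lemma hc_cong:
  assumes "\<And>j. j < L \<Longrightarrow> b j = b' j" and "\<And>x. x \<in> A \<Longrightarrow> \<sigma> x = \<sigma>' x"
  shows "hc A L b \<sigma> = hc A L b' \<sigma>'"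
  unfolding hc_def invcol_def colset_def using assms
  by (intro arg_cong[where f=int] arg_cong[where f=card]) auto

lemma hc_neg: assumes "j < L" "b j < 0" shows "hc A L b \<sigma> = 0"
proof -
  have "invcol A L b \<sigma> = {}" unfolding invcol_def colset_def
    using assms by force
  then show ?thesis unfolding hc_def by simp
qed

lemma sum_card_colors:
  assumes "finite A" "\<And>x. x \<in> A \<Longrightarrow> g x < (L::nat)"
  shows "(\<Sum>j<L. card {x\<in>A. g x = j}) = card A"
proof -
  have "card A = (\<Sum>x\<in>A. 1)" by simp
  also have "\<dots> = (\<Sum>j<L. \<Sum>x\<in>{x\<in>A. g x = j}. 1)"
    by (rule sum.group[symmetric]) (use assms in auto)
  finally show ?thesis by simp
qed

lemma colset_sum:
  assumes "finite A" "g \<in> colset A L b" shows "(\<Sum>j<L. b j) = int (card A)"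
proof -
  have "(\<Sum>j<L. b j) = (\<Sum>j<L. int (card {x\<in>A. g x = j}))"
    using assms(2) by (intro sum.cong) (auto simp: colset_def)
  also have "\<dots> = int (card A)"
    using sum_card_colors[of A g L] assms unfolding of_nat_sum[symmetric]
    by (simp add: colset_def PiE_iff)
  finally show ?thesis .
qed

lemma hc_wrong_sum:
  assumes "finite A" "(\<Sum>j<L. b j) \<noteq> int (card A)" shows "hc A L b \<sigma> = 0"
proof -
  have "invcol A L b \<sigma> = {}" using colset_sum[OF assms(1)] assms(2) by (auto simp: invcol_def)
  then show ?thesis by (simp add: hc_def)
qed

section \<open>Counting fixed colourings\<close>

text \<open>Equal fibre sizes say that both functions have the same image multiset on
  \<open>A\<close>; such functions differ by a rearrangement of the arguments.\<close>

lemma same_content_permutes: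
  assumes "finite A" and "\<And>c. card {x\<in>A. f x = c} = card {x\<in>A. f' x = c}"
  obtains p where "p permutes A" "\<And>x. x \<in> A \<Longrightarrow> f x = f' (p x)"
proof -
  have "image_mset f (mset_set A) = image_mset f' (mset_set A)"
  proof (rule multiset_eqI)
    fix c
    have "count (image_mset h (mset_set A)) c = card {x\<in>A. h x = c}" for h :: "'a \<Rightarrow> 'b"
      by (simp add: assms(1) count_image_mset' eq_commute[of c])
    then show "count (image_mset f (mset_set A)) c = count (image_mset f' (mset_set A)) c"
      using assms(2) by simp
  qed
  from image_mset_eq_implies_permutes[OF assms(1) this] that show ?thesis by metis
qed

text \<open>Every colouring of the given content is \<open>G0 \<circ> \<tau>\<close> for some \<open>\<tau>\<close>, and the \<open>\<tau>\<close> that give the same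
  colouring form a coset of its stabilizer.\<close>
lemma sum_stabilizers:
  fixes G0 :: "'a \<Rightarrow> 'c"
  assumes fin: "finite A" and G0: "G0 \<in> extensional A"
  shows "(\<Sum>G\<in>{G \<in> extensional A. \<forall>c. card {x\<in>A. G x = c} = card {x\<in>A. G0 x = c}}.
            card {\<sigma>. \<sigma> permutes A \<and> (\<forall>x\<in>A. G (\<sigma> x) = G x)}) = fact (card A)"
proof -
  let ?X = "{G \<in> extensional A. \<forall>c. card {x\<in>A. G x = c} = card {x\<in>A. G0 x = c}}"
  let ?S = "{\<tau>. \<tau> permutes A}"
  let ?m = "\<lambda>\<tau>. restrict (G0 \<circ> \<tau>) A"
  have finS: "finite ?S" using fin by (rule finite_permutations)
  have m_in: "?m \<tau> \<in> ?X" if "\<tau> permutes A" for \<tau>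
  proof -
    have "card {x\<in>A. ?m \<tau> x = c} = card {x\<in>A. G0 x = c}" for c
    proof -
      have "bij_betw \<tau> {x\<in>A. ?m \<tau> x = c} {x\<in>A. G0 x = c}"
        unfolding bij_betw_def
      proof
        show "inj_on \<tau> {x \<in> A. ?m \<tau> x = c}" using that permutes_inj inj_on_subset by blast
        show "\<tau> ` {x \<in> A. ?m \<tau> x = c} = {x \<in> A. G0 x = c}"
        proof
          show "\<tau> ` {x \<in> A. ?m \<tau> x = c} \<subseteq> {x \<in> A. G0 x = c}"
            using that by (auto simp: permutes_in_image)
          show "{x \<in> A. G0 x = c} \<subseteq> \<tau> ` {x \<in> A. ?m \<tau> x = c}"
          proof
            fix y assume y: "y \<in> {x \<in> A. G0 x = c}"
            obtain x where "x \<in> A" "y = \<tau> x" using permutes_image[OF \<open>\<tau> permutes A\<close>] y by blast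
            then show "y \<in> \<tau> ` {x \<in> A. ?m \<tau> x = c}" using y by auto
          qed
        qed
      qed
      then show ?thesis by (rule bij_betw_same_card)
    qed
    then show ?thesis by simp
  qed
  have fib: "card {\<sigma>. \<sigma> permutes A \<and> (\<forall>x\<in>A. G (\<sigma> x) = G x)} = card {\<tau> \<in> ?S. ?m \<tau> = G}"
    if G: "G \<in> ?X" for G
  proof -
    obtain p where p: "p permutes A" "\<And>x. x \<in> A \<Longrightarrow> G x = G0 (p x)"
      using same_content_permutes[OF fin, of G G0] G by auto
    have "bij_betw (\<lambda>\<sigma>. p \<circ> \<sigma>) {\<sigma>. \<sigma> permutes A \<and> (\<forall>x\<in>A. G (\<sigma> x) = G x)} {\<tau> \<in> ?S. ?m \<tau> = G}"
    proof (rule bij_betw_byWitness[where f'="\<lambda>\<tau>. inv p \<circ> \<tau>"])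
      show "\<forall>a\<in>{\<sigma>. \<sigma> permutes A \<and> (\<forall>x\<in>A. G (\<sigma> x) = G x)}. inv p \<circ> (p \<circ> a) = a"
        using p(1) by (auto simp: o_assoc permutes_inv_o)
      show "\<forall>a'\<in>{\<tau> \<in> ?S. ?m \<tau> = G}. p \<circ> (inv p \<circ> a') = a'"
        using p(1) by (auto simp: o_assoc permutes_inv_o)
      show "(\<circ>) p ` {\<sigma>. \<sigma> permutes A \<and> (\<forall>x\<in>A. G (\<sigma> x) = G x)} \<subseteq> {\<tau> \<in> ?S. ?m \<tau> = G}"
      proof clarsimp
        fix \<sigma> assume s: "\<sigma> permutes A" "\<forall>x\<in>A. G (\<sigma> x) = G x"
        have "?m (p \<circ> \<sigma>) = G"
        proof
          fix x show "?m (p \<circ> \<sigma>) x = G x"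
            using s p G by (cases "x \<in> A") (auto simp: permutes_in_image extensional_def restrict_def)
        qed
        then show "p \<circ> \<sigma> permutes A \<and> restrict (G0 \<circ> (p \<circ> \<sigma>)) A = G"
          using s p by (auto intro: permutes_compose)
      qed
      show "(\<circ>) (inv p) ` {\<tau> \<in> ?S. ?m \<tau> = G} \<subseteq> {\<sigma>. \<sigma> permutes A \<and> (\<forall>x\<in>A. G (\<sigma> x) = G x)}"
      proof (rule image_subsetI)
        fix \<tau> assume "\<tau> \<in> {\<tau> \<in> ?S. ?m \<tau> = G}"
        then have t: "\<tau> permutes A" "G = ?m \<tau>" by auto
        have "G (inv p (\<tau> x)) = G x" if "x \<in> A" for x
        proof -
          have "inv p (\<tau> x) \<in> A" using that t p by (simp add: permutes_in_image permutes_inv)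
          then have "G (inv p (\<tau> x)) = G0 (\<tau> x)" using p by (simp add: permutes_inverses)
          then show ?thesis using t that by simp
        qed
        then show "inv p \<circ> \<tau> \<in> {\<sigma>. \<sigma> permutes A \<and> (\<forall>x\<in>A. G (\<sigma> x) = G x)}"
          using t(1) p by (auto intro: permutes_compose permutes_inv)
      qed
    qed
    then show ?thesis by (rule bij_betw_same_card)
  qed
  have img: "?X = ?m ` ?S"
  proof
    show "?X \<subseteq> ?m ` ?S"
    proof
      fix G assume G: "G \<in> ?X"
      obtain p where p: "p permutes A" "\<And>x. x \<in> A \<Longrightarrow> G x = G0 (p x)"
        using same_content_permutes[OF fin, of G G0] G by auto
      then have "G = ?m p" using G by (auto simp: extensional_def)
      then show "G \<in> ?m ` ?S" using p by blast
    qed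
  qed (use m_in in blast)
  have "(\<Sum>G\<in>?X. card {\<sigma>. \<sigma> permutes A \<and> (\<forall>x\<in>A. G (\<sigma> x) = G x)}) = (\<Sum>G\<in>?X. \<Sum>\<tau>\<in>{\<tau> \<in> ?S. ?m \<tau> = G}. 1)"
    using fib by simp
  also have "\<dots> = (\<Sum>\<tau>\<in>?S. 1)"
    by (rule sum.group) (use finS img in auto)
  also have "\<dots> = fact (card A)" using fin by (simp add: card_permutations)
  finally show ?thesis .
qed

section \<open>Contingency tables and inner products of Young permutation characters\<close>

definition rows :: "nat \<Rightarrow> int \<Rightarrow> (nat \<Rightarrow> nat) set" where
  "rows L r = {d. (\<forall>j\<ge>L. d j = 0) \<and> int (\<Sum>j<L. d j) = r}"

text \<open>Contingency tables with prescribed margins, which index the double cosets of two Young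
  subgroups. Forcing zeros outside the box makes each table a single function, so that the set can
  be counted.\<close>

definition mats :: "nat \<Rightarrow> nat \<Rightarrow> (nat \<Rightarrow> int) \<Rightarrow> (nat \<Rightarrow> int) \<Rightarrow> (nat \<Rightarrow> nat \<Rightarrow> nat) set" where
  "mats k L b c = {M. (\<forall>i j. \<not> (i < k \<and> j < L) \<longrightarrow> M i j = 0) \<and>
     (\<forall>i<k. int (\<Sum>j<L. M i j) = b i) \<and> (\<forall>j<L. int (\<Sum>i<k. M i j) = c j)}"

definition content :: "nat set \<Rightarrow> (nat \<Rightarrow> nat \<times> nat) \<Rightarrow> nat \<Rightarrow> nat \<Rightarrow> nat" where
  "content A G i j = card {x\<in>A. G x = (i, j)}"

lemma content_row:
  assumes "finite A" "\<And>x. x \<in> A \<Longrightarrow> snd (G x) < L"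
  shows "(\<Sum>j<L. content A G i j) = card {x\<in>A. fst (G x) = i}"
proof -
  have "(\<Sum>j<L. card {x\<in>{x\<in>A. fst (G x) = i}. snd (G x) = j}) = card {x\<in>A. fst (G x) = i}"
    by (rule sum_card_colors) (use assms in auto)
  moreover have "{x\<in>{x\<in>A. fst (G x) = i}. snd (G x) = j} = {x\<in>A. G x = (i, j)}" for j
    by (auto simp: prod_eq_iff)
  ultimately show ?thesis by (simp add: content_def)
qed

lemma content_col:
  assumes "finite A" "\<And>x. x \<in> A \<Longrightarrow> fst (G x) < k"
  shows "(\<Sum>i<k. content A G i j) = card {x\<in>A. snd (G x) = j}"
proof -
  have "(\<Sum>i<k. card {x\<in>{x\<in>A. snd (G x) = j}. fst (G x) = i}) = card {x\<in>A. snd (G x) = j}"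
    by (rule sum_card_colors) (use assms in auto)
  moreover have "{x\<in>{x\<in>A. snd (G x) = j}. fst (G x) = i} = {x\<in>A. G x = (i, j)}" for i
    by (auto simp: prod_eq_iff)
  ultimately show ?thesis by (simp add: content_def)
qed

lemma ex_content:
  assumes "finite A" and "\<And>i j. \<not> (i < k \<and> j < L) \<Longrightarrow> M i j = 0"
    and "(\<Sum>i<k. \<Sum>j<L. M i j) = card A"
  shows "\<exists>G\<in>A \<rightarrow>\<^sub>E {0..<k} \<times> {0..<L}. content A G = M"
proof -
  \<comment> \<open>\<open>U\<close> has \<open>M i j\<close> tagged points over each cell
    \<open>(i, j)\<close>, hence \<open>card A\<close> points altogether. Any bijection from
    \<open>A\<close> onto it, followed by forgetting the tag, is the desired colouring.\<close>
  define U where "U = (SIGMA p:{..<k}\<times>{..<L}. {..<M (fst p) (snd p)})"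
  have "card U = (\<Sum>p\<in>{..<k}\<times>{..<L}. M (fst p) (snd p))"
    unfolding U_def by (subst card_SigmaI) auto
  also have "\<dots> = card A" using assms(3) by (simp add: sum.cartesian_product case_prod_beta)
  finally have "card A = card U" by simp
  moreover have "finite U" unfolding U_def by auto
  ultimately obtain f where f: "bij_betw f A U"
    using assms(1) finite_same_card_bij by blast
  define G where "G = restrict (fst \<circ> f) A"
  have fU: "f x \<in> U" if "x \<in> A" for x using f that by (auto simp: bij_betw_def)
  have "content A G i j = M i j" for i j
  proof -
    have "bij_betw f {x\<in>A. G x = (i,j)} {u\<in>U. fst u = (i,j)}"
      unfolding bij_betw_def
    proof
      show "inj_on f {x\<in>A. G x = (i,j)}" using f by (auto simp: bij_betw_def inj_on_def)
      show "f ` {x\<in>A. G x = (i,j)} = {u\<in>U. fst u = (i,j)}"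
      proof -
        have "f ` A = U" using f by (simp add: bij_betw_def)
        then show ?thesis by (auto simp: G_def)
      qed
    qed
    then have "content A G i j = card {u\<in>U. fst u = (i,j)}"
      unfolding content_def by (rule bij_betw_same_card)
    also have "\<dots> = M i j"
    proof (cases "i < k \<and> j < L")
      case True
      then have "{u\<in>U. fst u = (i,j)} = {(i,j)} \<times> {..<M i j}" unfolding U_def by auto
      then show ?thesis by (simp add: card_cartesian_product)
    next
      case False
      then have "{u\<in>U. fst u = (i,j)} = {}" unfolding U_def by auto
      then show ?thesis using assms(2)[of i j] False by (metis card.empty)
    qed
    finally show ?thesis .
  qed
  then have "content A G = M" by (simp add: fun_eq_iff)
  moreover have "G \<in> A \<rightarrow>\<^sub>E {0..<k} \<times> {0..<L}"
    using fU unfolding G_def U_def by (fastforce simp: PiE_iff)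
  ultimately show ?thesis by blast
qed

lemma finite_bounded_funs: "finite {d :: nat \<Rightarrow> nat. \<forall>j. (j \<in> {..<L} \<longrightarrow> d j \<in> {..B}) \<and> (j \<notin> {..<L} \<longrightarrow> d j = 0)}"
  by (rule finite_set_of_finite_funs) auto

lemma finite_mats: "finite (mats k L b c)"
proof -
  define B where "B = nat (\<Sum>i<k. \<bar>b i\<bar>)"
  let ?R = "{d :: nat \<Rightarrow> nat. \<forall>j. (j \<in> {..<L} \<longrightarrow> d j \<in> {..B}) \<and> (j \<notin> {..<L} \<longrightarrow> d j = 0)}"
  have fin: "finite {M. \<forall>i. (i \<in> {..<k} \<longrightarrow> M i \<in> ?R) \<and> (i \<notin> {..<k} \<longrightarrow> M i = (\<lambda>_. 0))}"
    by (rule finite_set_of_finite_funs) (use finite_bounded_funs in auto)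
  have "M \<in> {M. \<forall>i. (i \<in> {..<k} \<longrightarrow> M i \<in> ?R) \<and> (i \<notin> {..<k} \<longrightarrow> M i = (\<lambda>_. 0))}"
    if M: "M \<in> mats k L b c" for M
  proof -
    have M1: "\<And>i j. \<not> (i < k \<and> j < L) \<Longrightarrow> M i j = 0" and M2: "\<And>i. i < k \<Longrightarrow> int (\<Sum>j<L. M i j) = b i"
      using M unfolding mats_def by blast+
    have "M i j \<le> B" if "i < k" "j < L" for i j
    proof -
      have "M i j \<le> (\<Sum>j<L. M i j)" using that by (intro member_le_sum) auto
      then have "int (M i j) \<le> b i" using M2[OF that(1)] by linarith
      also have "b i \<le> \<bar>b i\<bar>" by simp
      also have "\<dots> \<le> (\<Sum>i<k. \<bar>b i\<bar>)" using that by (intro member_le_sum) auto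
      finally show ?thesis unfolding B_def by linarith
    qed
    then show ?thesis using M1 by (simp add: fun_eq_iff)
  qed
  then show ?thesis using fin by (meson finite_subset subsetI)
qed

text \<open>A pair of fixed colourings is one fixed colouring by pairs of colours. Sorting these by
  their content table and exchanging the sums leaves, for each table, the total size of the
  stabilizers of its colourings, which \<open>sum_stabilizers\<close> evaluates to
  \<open>fact (card A)\<close>.\<close>

lemma inner_hc:
  assumes fin: "finite A" and sb: "(\<Sum>i<k. b i) = int (card A)"
  shows "(\<Sum>\<sigma> | \<sigma> permutes A. hc A k b \<sigma> * hc A L c \<sigma>) = fact (card A) * int (card (mats k L b c))"
proof -
  define X where "X = {G \<in> A \<rightarrow>\<^sub>E {0..<k} \<times> {0..<L}. content A G \<in> mats k L b c}"
  have finX: "finite X" unfolding X_def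
    by (rule finite_subset[of _ "A \<rightarrow>\<^sub>E {0..<k} \<times> {0..<L}"]) (auto intro: finite_PiE fin)
  have X_iff: "G \<in> X \<longleftrightarrow> G \<in> A \<rightarrow>\<^sub>E {0..<k} \<times> {0..<L} \<and> (\<forall>i<k. int (card {x\<in>A. fst (G x) = i}) = b i)
      \<and> (\<forall>j<L. int (card {x\<in>A. snd (G x) = j}) = c j)" for G
  proof (cases "G \<in> A \<rightarrow>\<^sub>E {0..<k} \<times> {0..<L}")
    case True
    then have lt: "fst (G x) < k" "snd (G x) < L" if "x \<in> A" for x
      using that by (auto simp: PiE_iff mem_Times_iff)
    have "content A G i j = 0" if "\<not> (i < k \<and> j < L)" for i j
    proof -
      have "{x\<in>A. G x = (i,j)} = {}" using that lt by fastforce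
      then show ?thesis unfolding content_def by (metis card.empty)
    qed
    then show ?thesis using True content_row[of A G L] content_col[of A G k] lt fin
      unfolding X_def mats_def by (auto simp del: of_nat_sum)
  qed (simp add: X_def)
  have prod: "hc A k b \<sigma> * hc A L c \<sigma> = int (card {G \<in> X. \<forall>x\<in>A. G (\<sigma> x) = G x})" if s: "\<sigma> permutes A" for \<sigma>
  proof -
    have "bij_betw (\<lambda>G. (restrict (fst \<circ> G) A, restrict (snd \<circ> G) A)) {G \<in> X. \<forall>x\<in>A. G (\<sigma> x) = G x}
        (invcol A k b \<sigma> \<times> invcol A L c \<sigma>)"
    proof (rule bij_betw_byWitness[where f'="\<lambda>(g,g'). restrict (\<lambda>x. (g x, g' x)) A"])
      show "\<forall>G\<in>{G \<in> X. \<forall>x\<in>A. G (\<sigma> x) = G x}.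
        (case (restrict (fst \<circ> G) A, restrict (snd \<circ> G) A) of (g, g') \<Rightarrow> \<lambda>x\<in>A. (g x, g' x)) = G"
        by (auto simp: X_iff fun_eq_iff PiE_iff extensional_def)
      show "\<forall>a'\<in>invcol A k b \<sigma> \<times> invcol A L c \<sigma>.
        (restrict (fst \<circ> (case a' of (g, g') \<Rightarrow> \<lambda>x\<in>A. (g x, g' x))) A,
         restrict (snd \<circ> (case a' of (g, g') \<Rightarrow> \<lambda>x\<in>A. (g x, g' x))) A) = a'"
        by (auto simp: invcol_def colset_def fun_eq_iff PiE_iff extensional_def)
      show "(\<lambda>G. (restrict (fst \<circ> G) A, restrict (snd \<circ> G) A)) ` {G \<in> X. \<forall>x\<in>A. G (\<sigma> x) = G x}
        \<subseteq> invcol A k b \<sigma> \<times> invcol A L c \<sigma>"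
        using s by (auto simp: invcol_def colset_def X_iff PiE_iff permutes_in_image mem_Times_iff cong: conj_cong)
      show "(\<lambda>(g,g'). restrict (\<lambda>x. (g x, g' x)) A) ` (invcol A k b \<sigma> \<times> invcol A L c \<sigma>)
        \<subseteq> {G \<in> X. \<forall>x\<in>A. G (\<sigma> x) = G x}"
      proof clarify
        fix g g' assume g: "g \<in> invcol A k b \<sigma>" "g' \<in> invcol A L c \<sigma>"
        have "card {x\<in>A. fst (restrict (\<lambda>x. (g x, g' x)) A x) = i} = card {x\<in>A. g x = i}"
          "card {x\<in>A. snd (restrict (\<lambda>x. (g x, g' x)) A x) = i} = card {x\<in>A. g' x = i}" for i
          by (rule arg_cong[where f=card]; auto)+
        then show "restrict (\<lambda>x. (g x, g' x)) A \<in> X \<and>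
           (\<forall>x\<in>A. restrict (\<lambda>x. (g x, g' x)) A (\<sigma> x) = restrict (\<lambda>x. (g x, g' x)) A x)"
          using g s by (auto simp: invcol_def colset_def X_iff PiE_iff permutes_in_image)
      qed
    qed
    from bij_betw_same_card[OF this] show ?thesis
      by (simp add: hc_def card_cartesian_product)
  qed
  have fib: "(\<Sum>G\<in>{G\<in>X. content A G = M}. card {\<sigma>. \<sigma> permutes A \<and> (\<forall>x\<in>A. G (\<sigma> x) = G x)}) = fact (card A)"
    if M: "M \<in> mats k L b c" for M
  proof -
    \<comment> \<open>The row sums alone determine the total of the entries, so by \<open>sb\<close>
      every table is the content of some colouring of \<open>A\<close>.\<close>
    have "int (\<Sum>i<k. \<Sum>j<L. M i j) = (\<Sum>i<k. int (\<Sum>j<L. M i j))" by simp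
    also have "\<dots> = (\<Sum>i<k. b i)" using M unfolding mats_def by (intro sum.cong) auto
    finally have "(\<Sum>i<k. \<Sum>j<L. M i j) = card A" using sb by (simp only: of_nat_eq_iff)
    then obtain G0 where G0: "G0 \<in> A \<rightarrow>\<^sub>E {0..<k} \<times> {0..<L}" "content A G0 = M"
      using ex_content[of A k L M] M fin unfolding mats_def by blast
    have "{G\<in>X. content A G = M} = {G \<in> extensional A. \<forall>c. card {x\<in>A. G x = c} = card {x\<in>A. G0 x = c}}"
      (is "?l = ?r")
    proof
      show "?l \<subseteq> ?r" using G0 by (auto simp: X_def content_def fun_eq_iff PiE_iff)
      show "?r \<subseteq> ?l"
      proof
        fix G assume G: "G \<in> ?r"
        have "content A G = M" using G G0(2) by (auto simp: content_def fun_eq_iff)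
        moreover have "G x \<in> {0..<k} \<times> {0..<L}" if "x \<in> A" for x
        proof -
          have "card {y\<in>A. G y = G x} \<noteq> 0" using that fin by auto
          moreover have "card {y\<in>A. G y = G x} = card {y\<in>A. G0 y = G x}" using G by blast
          ultimately have "card {y\<in>A. G0 y = G x} \<noteq> 0" by simp
          then have "{y\<in>A. G0 y = G x} \<noteq> {}" by (metis card.empty)
          then obtain y where "y \<in> A" "G0 y = G x" by auto
          then show ?thesis using PiE_mem[OF G0(1)] by metis
        qed
        ultimately show "G \<in> ?l" using G M by (auto simp: X_def PiE_iff)
      qed
    qed
    then show ?thesis using sum_stabilizers[OF fin, of G0] G0 by (simp add: PiE_iff)
  qed
  have "(\<Sum>\<sigma> | \<sigma> permutes A. hc A k b \<sigma> * hc A L c \<sigma>)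
      = int (\<Sum>\<sigma> | \<sigma> permutes A. \<Sum>G | G \<in> X \<and> (\<forall>x\<in>A. G (\<sigma> x) = G x). 1)"
    using prod by simp
  also have "(\<Sum>\<sigma> | \<sigma> permutes A. \<Sum>G | G \<in> X \<and> (\<forall>x\<in>A. G (\<sigma> x) = G x). 1) =
     (\<Sum>G\<in>X. \<Sum>\<sigma> | \<sigma> \<in> {\<sigma>. \<sigma> permutes A} \<and> (\<forall>x\<in>A. G (\<sigma> x) = G x). (1::nat))"
    by (rule sum.swap_restrict) (auto simp: finX fin finite_permutations)
  also have "\<dots> = (\<Sum>G\<in>X. card {\<sigma>. \<sigma> permutes A \<and> (\<forall>x\<in>A. G (\<sigma> x) = G x)})" by simp
  also have "\<dots> = (\<Sum>M\<in>mats k L b c. \<Sum>G\<in>{G\<in>X. content A G = M}. card {\<sigma>. \<sigma> permutes A \<and> (\<forall>x\<in>A. G (\<sigma> x) = G x)})"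
    by (rule sum.group[symmetric]) (use finX finite_mats in \<open>auto simp: X_def\<close>)
  also have "\<dots> = fact (card A) * card (mats k L b c)" using fib by simp
  finally show ?thesis by simp
qed

section \<open>Pieri's rule and orthonormality\<close>

definition dif :: "(nat \<Rightarrow> int) \<Rightarrow> (nat \<Rightarrow> nat) \<Rightarrow> nat \<Rightarrow> int" where
  "dif c d = (\<lambda>j. c j - int (d j))"

lemma finite_rows: "finite (rows L r)"
proof -
  have "d \<in> {d. \<forall>j. (j \<in> {..<L} \<longrightarrow> d j \<in> {..nat r}) \<and> (j \<notin> {..<L} \<longrightarrow> d j = 0)}"
    if d: "d \<in> rows L r" for d
  proof -
    have "d j \<le> nat r" if "j < L" for j
    proof -
      have "d j \<le> (\<Sum>j<L. d j)" using that by (intro member_le_sum) auto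
      then show ?thesis using d unfolding rows_def by (auto simp del: of_nat_sum)
    qed
    then show ?thesis using d unfolding rows_def by auto
  qed
  then show ?thesis using finite_bounded_funs by (meson finite_subset subsetI)
qed

lemma mats_cong:
  assumes "\<And>i. i < k \<Longrightarrow> b i = b' i" "\<And>j. j < L \<Longrightarrow> c j = c' j"
  shows "mats k L b c = mats k L b' c'"
  unfolding mats_def using assms by auto

lemma card_mats_0: "card (mats 0 L b c) = (if \<forall>j<L. c j = 0 then 1 else 0)"
proof -
  have "mats 0 L b c = (if \<forall>j<L. c j = 0 then {\<lambda>_ _. 0} else {})"
    unfolding mats_def by (auto simp: fun_eq_iff)
  then show ?thesis by simp
qed

text \<open>Splitting off the last row \<open>d\<close> leaves a table with one row less and column
  sums \<open>dif c d\<close>. This recursion is what turns Pieri's rule into an induction on the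
  number of rows.\<close>

lemma card_mats_Suc: "card (mats (Suc k) L b c) = (\<Sum>d\<in>rows L (b k). card (mats k L b (dif c d)))"
proof -
  have "bij_betw (\<lambda>M. (M k, M(k := (\<lambda>_. 0)))) (mats (Suc k) L b c) (SIGMA d:rows L (b k). mats k L b (dif c d))"
  proof (rule bij_betw_byWitness[where f'="\<lambda>(d, M). M(k := d)"])
    show "\<forall>M\<in>mats (Suc k) L b c. (case (M k, M(k := \<lambda>_. 0)) of (d, M) \<Rightarrow> M(k := d)) = M" by simp
    show "\<forall>a'\<in>SIGMA d:rows L (b k). mats k L b (dif c d).
       ((case a' of (d, M) \<Rightarrow> M(k := d)) k, (case a' of (d, M) \<Rightarrow> M(k := d))(k := \<lambda>_. 0)) = a'"
      by (auto simp: mats_def fun_eq_iff)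
    show "(\<lambda>M. (M k, M(k := \<lambda>_. 0))) ` mats (Suc k) L b c \<subseteq> (SIGMA d:rows L (b k). mats k L b (dif c d))"
    proof (rule image_subsetI)
      fix M assume M: "M \<in> mats (Suc k) L b c"
      have "int (\<Sum>i<k. M i j) = dif c (M k) j" if "j < L" for j
        using M that unfolding mats_def dif_def by (auto simp: lessThan_Suc)
      moreover have "(\<Sum>i<k. (M(k := \<lambda>_. 0)) i j) = (\<Sum>i<k. M i j)" for j
        by (rule sum.cong) auto
      ultimately show "(M k, M(k := \<lambda>_. 0)) \<in> (SIGMA d:rows L (b k). mats k L b (dif c d))"
        using M unfolding mats_def rows_def by auto
    qed
    show "(\<lambda>(d, M). M(k := d)) ` (SIGMA d:rows L (b k). mats k L b (dif c d)) \<subseteq> mats (Suc k) L b c"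
    proof (rule image_subsetI)
      fix p assume "p \<in> (SIGMA d:rows L (b k). mats k L b (dif c d))"
      then obtain d M where p: "p = (d, M)" "d \<in> rows L (b k)" "M \<in> mats k L b (dif c d)" by auto
      have "(\<Sum>i<k. (M(k := d)) i j) = (\<Sum>i<k. M i j)" for j
        by (rule sum.cong) auto
      then have "int (\<Sum>i<Suc k. (M(k := d)) i j) = c j" if "j < L" for j
        using that p unfolding mats_def dif_def by (auto simp: lessThan_Suc)
      then show "(case p of (d, M) \<Rightarrow> M(k := d)) \<in> mats (Suc k) L b c"
        using p unfolding mats_def rows_def by (auto simp: less_Suc_eq simp del: sum.lessThan_Suc)
    qed
  qed
  from bij_betw_same_card[OF this] show ?thesis
    by (simp add: card_SigmaI finite_rows finite_mats)
qed

text \<open>With \<open>c j = u j - int j\<close> this is, up to the factor \<open>fact n\<close>,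
  the inner product of the permutation character with content \<open>b\<close> and the determinant
  with index \<open>u\<close>; for a partition \<open>u\<close> it is a Kostka number. The shift by
  \<open>j\<close> is absorbed into \<open>c\<close> because the expression is then antisymmetric in
  the entries of \<open>c\<close>.\<close>

definition sk :: "nat \<Rightarrow> nat \<Rightarrow> (nat \<Rightarrow> int) \<Rightarrow> (nat \<Rightarrow> int) \<Rightarrow> int" where
  "sk k L b c = (\<Sum>w | w permutes {0..<L}. sign w * int (card (mats k L b (\<lambda>j. c j + int (w j)))))"

lemma sk_cong:
  assumes "\<And>i. i < k \<Longrightarrow> b i = b' i" "\<And>j. j < L \<Longrightarrow> c j = c' j"
  shows "sk k L b c = sk k L b' c'"
  unfolding sk_def using assms by (intro sum.cong refl arg_cong2[where f="(*)"] arg_cong[where f=int]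
    arg_cong[where f=card] mats_cong) auto

lemma sk_Suc: "sk (Suc k) L b c = (\<Sum>d\<in>rows L (b k). sk k L b (dif c d))"
proof -
  have "sk (Suc k) L b c = (\<Sum>w | w permutes {0..<L}. \<Sum>d\<in>rows L (b k).
      sign w * int (card (mats k L b (\<lambda>j. dif c d j + int (w j)))))"
    unfolding sk_def card_mats_Suc of_nat_sum sum_distrib_left
    by (simp add: dif_def algebra_simps)
  then show ?thesis unfolding sk_def by (subst (asm) sum.swap)
qed

lemma sk_0: "sk 0 L b c = (\<Sum>w | w permutes {0..<L}. sign w * (if \<forall>j<L. c j + int (w j) = 0 then 1 else 0))"
  unfolding sk_def card_mats_0 by (intro sum.cong) auto

text \<open>Some term must have an actual table. Its column sums \<open>c j + int (w j)\<close> are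
  nonnegative while \<open>w j < L\<close>; and its entries have the same total by rows as by
  columns, which does not depend on \<open>w\<close>.\<close>

lemma sk_nonzero:
  assumes "sk k L b c \<noteq> 0"
  shows "j < L \<Longrightarrow> c j \<ge> - int L + 1" "(\<Sum>j<L. c j + int j) = (\<Sum>i<k. b i)"
proof -
  obtain w where w: "w permutes {0..<L}" "card (mats k L b (\<lambda>j. c j + int (w j))) \<noteq> 0"
    using assms unfolding sk_def by (metis (mono_tags, lifting) mem_Collect_eq mult_zero_right of_nat_0 sum.neutral)
  then obtain M where M: "M \<in> mats k L b (\<lambda>j. c j + int (w j))"
    by (metis card.empty ex_in_conv)
  show "c j \<ge> - int L + 1" if "j < L"
  proof -
    have "c j + int (w j) \<ge> 0" using M that unfolding mats_def by (smt (verit) mem_Collect_eq of_nat_0_le_iff)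
    moreover have "w j < L" using w that permutes_in_image[OF w(1), of j] by simp
    ultimately show ?thesis by linarith
  qed
  have "(\<Sum>j<L. c j + int (w j)) = (\<Sum>j<L. int (\<Sum>i<k. M i j))"
    using M unfolding mats_def by (intro sum.cong) auto
  also have "\<dots> = int (\<Sum>i<k. \<Sum>j<L. M i j)" by (simp only: of_nat_sum) (rule sum.swap)
  also have "\<dots> = (\<Sum>i<k. b i)" unfolding of_nat_sum[of _ "{..<k}"]
    using M unfolding mats_def by (intro sum.cong) auto
  finally have "(\<Sum>j<L. c j + int (w j)) = (\<Sum>i<k. b i)" .
  moreover have "(\<Sum>j<L. int (w j)) = (\<Sum>j<L. int j)"
    using sum.permute[OF w(1), of int] by (simp add: o_def atLeast0LessThan)
  ultimately show "(\<Sum>j<L. c j + int j) = (\<Sum>i<k. b i)" by (simp add: sum.distrib)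
qed

lemma sum_transpose:
  assumes "Suc j < L" shows "(\<Sum>i<L. f (transpose j (Suc j) i)) = (\<Sum>i<L. f i)"
proof -
  have "transpose j (Suc j) permutes {..<L}" using assms by (intro permutes_swap_id) auto
  from sum.permute[OF this, of f] show ?thesis by (simp add: o_def)
qed

lemma rows_transpose:
  assumes "Suc j < L" "d \<in> rows L r" shows "d \<circ> transpose j (Suc j) \<in> rows L r"
proof -
  have "transpose j (Suc j) i = i" if "L \<le> i" for i
    using assms(1) that by (auto simp: transpose_def)
  then show ?thesis using assms(2) sum_transpose[OF assms(1), of d]
    by (auto simp: rows_def o_def simp del: of_nat_sum)
qed

text \<open>For \<open>k = 0\<close> composing \<open>w\<close> with the transposition exchanges the
  two entries and flips the sign. The inductive step then only needs that \<open>rows\<close> is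
  closed under permuting entries, so columns of tables never have to be permuted.\<close>

lemma sk_transpose:
  assumes j: "Suc j < L"
  shows "sk k L b (c \<circ> transpose j (Suc j)) = - sk k L b c"
proof (induction k arbitrary: c)
  case 0
  let ?t = "transpose j (Suc j)"
  have t: "?t permutes {0..<L}" using j by (intro permutes_swap_id) auto
  have "sk 0 L b (c \<circ> ?t) = (\<Sum>w | w permutes {0..<L}. sign (w \<circ> ?t) * (if \<forall>i<L. (c \<circ> ?t) i + int ((w \<circ> ?t) i) = 0 then 1 else 0))"
    unfolding sk_0
    by (rule sum.reindex_bij_witness[where i="\<lambda>w. w \<circ> ?t" and j="\<lambda>w. w \<circ> ?t"])
      (auto simp: comp_assoc intro: permutes_compose[OF t])
  also have "\<dots> = (\<Sum>w | w permutes {0..<L}. - (sign w * (if \<forall>i<L. c i + int (w i) = 0 then 1 else 0)))"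
  proof (rule sum.cong[OF refl])
    fix w assume "w \<in> {w. w permutes {0..<L}}"
    then have "sign (w \<circ> ?t) = - sign w"
      using t by (subst sign_compose) (auto simp: sign_swap_id intro: permutes_imp_permutation[of "{0..<L}"])
    moreover have "(\<forall>i<L. (c \<circ> ?t) i + int ((w \<circ> ?t) i) = 0) \<longleftrightarrow> (\<forall>i<L. c i + int (w i) = 0)"
    proof
      assume a: "\<forall>i<L. (c \<circ> ?t) i + int ((w \<circ> ?t) i) = 0"
      show "\<forall>i<L. c i + int (w i) = 0"
      proof (intro allI impI)
        fix i assume "i < L"
        then have "?t i < L" using permutes_in_image[OF t, of i] by simp
        then show "c i + int (w i) = 0" using a by fastforce
      qed
    next
      assume a: "\<forall>i<L. c i + int (w i) = 0"
      show "\<forall>i<L. (c \<circ> ?t) i + int ((w \<circ> ?t) i) = 0"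
      proof (intro allI impI)
        fix i assume "i < L"
        then have "?t i < L" using permutes_in_image[OF t, of i] by simp
        then show "(c \<circ> ?t) i + int ((w \<circ> ?t) i) = 0" using a by simp
      qed
    qed
    ultimately show "sign (w \<circ> ?t) * (if \<forall>i<L. (c \<circ> ?t) i + int ((w \<circ> ?t) i) = 0 then 1 else 0) =
       - (sign w * (if \<forall>i<L. c i + int (w i) = 0 then 1 else 0))" by simp
  qed
  finally show ?case by (simp add: sk_0 sum_negf)
next
  case (Suc k)
  let ?t = "transpose j (Suc j)"
  have "sk (Suc k) L b (c \<circ> ?t) = (\<Sum>d\<in>rows L (b k). sk k L b (dif c d \<circ> ?t))"
    unfolding sk_Suc
    by (rule sum.reindex_bij_witness[where i="\<lambda>d. d \<circ> ?t" and j="\<lambda>d. d \<circ> ?t"])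
      (auto simp: comp_assoc rows_transpose[OF j] intro!: arg_cong[where f="sk k L b"] simp: dif_def fun_eq_iff)
  then show ?case by (simp only: Suc.IH) (simp add: sk_Suc sum_negf)
qed

text \<open>The terms violating the interlacing condition cancel in pairs: at the first violation \<open>j\<close>,
  exchange the entries \<open>j\<close> and \<open>j + 1\<close> of \<open>c - d\<close>.\<close>
lemma sk_pieri:
  assumes c: "\<And>j. Suc j < L \<Longrightarrow> c (Suc j) < c j"
  shows "sk (Suc k) L b c =
    (\<Sum>d | d \<in> rows L (b k) \<and> (\<forall>j. Suc j < L \<longrightarrow> c (Suc j) < c j - int (d j)). sk k L b (dif c d))"
proof -
  define bad where "bad d j \<longleftrightarrow> Suc j < L \<and> c j - int (d j) \<le> c (Suc j)" for d j
  define B where "B = {d \<in> rows L (b k). \<exists>j. bad d j}"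
  define m where "m d = (LEAST j. bad d j)" for d
  \<comment> \<open>The new entries are solved from the requirement that \<open>dif c\<close> have
    its entries \<open>m d\<close> and \<open>Suc (m d)\<close> exchanged. Both arguments of
    \<open>nat\<close> are nonnegative: the first since \<open>c\<close> decreases, the second
    precisely because \<open>d\<close> is bad at \<open>m d\<close>.\<close>
  define \<iota> where "\<iota> d = d(m d := nat (c (m d) - c (Suc (m d))) + d (Suc (m d)),
     Suc (m d) := nat (int (d (m d)) - (c (m d) - c (Suc (m d)))))" for d
  have mbad: "bad d (m d)" if "d \<in> B" for d
    using that unfolding B_def m_def by (auto intro: LeastI)
  have mL: "Suc (m d) < L" if "d \<in> B" for d using mbad[OF that] by (simp add: bad_def)
  have dif_\<iota>: "dif c (\<iota> d) = dif c d \<circ> transpose (m d) (Suc (m d))" if d: "d \<in> B" for d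
  proof
    fix i show "dif c (\<iota> d) i = (dif c d \<circ> transpose (m d) (Suc (m d))) i"
      using mbad[OF d] c[OF mL[OF d]] unfolding dif_def \<iota>_def bad_def
      by (auto simp: transpose_def)
  qed
  \<comment> \<open>Badness at \<open>i\<close> is stated with \<open>c (Suc i)\<close> and so
    depends on \<open>d\<close> only through \<open>d i\<close>. Entries before \<open>m d\<close>
    are untouched, and at \<open>m d\<close> the new difference is
    \<open>c (Suc (m d)) - int (d (Suc (m d)))\<close>, which is still bad. The first violation thus
    stays in place and \<open>\<iota>\<close> is an involution.\<close>
  have \<iota>_bad: "bad (\<iota> d) i \<longleftrightarrow> bad d i" if d: "d \<in> B" "i \<le> m d" for d i
    using mbad[OF d(1)] c[OF mL[OF d(1)]] d(2) unfolding \<iota>_def bad_def by (cases "i = m d") auto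
  have m_\<iota>: "m (\<iota> d) = m d" if d: "d \<in> B" for d
    unfolding m_def[of "\<iota> d"]
  proof (rule Least_equality)
    show "bad (\<iota> d) (m d)" using \<iota>_bad[OF d] mbad[OF d] by simp
    fix y assume "bad (\<iota> d) y"
    show "m d \<le> y"
    proof (rule ccontr)
      assume "\<not> m d \<le> y"
      then have "bad d y" using \<iota>_bad[OF d, of y] \<open>bad (\<iota> d) y\<close> by simp
      then show False using \<open>\<not> m d \<le> y\<close> unfolding m_def by (simp add: Least_le)
    qed
  qed
  have \<iota>_B: "\<iota> d \<in> B" if d: "d \<in> B" for d
  proof -
    have "(\<Sum>i<L. dif c (\<iota> d) i) = (\<Sum>i<L. dif c d i)"
      unfolding dif_\<iota>[OF d] o_def by (rule sum_transpose[OF mL[OF d]])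
    then have "int (\<Sum>i<L. \<iota> d i) = int (\<Sum>i<L. d i)" by (simp add: dif_def sum_subtractf)
    moreover have "\<forall>j\<ge>L. \<iota> d j = 0" using d mL[OF d] unfolding \<iota>_def B_def rows_def by auto
    moreover have "bad (\<iota> d) (m d)" using \<iota>_bad[OF d] mbad[OF d] by simp
    ultimately show ?thesis using d unfolding B_def rows_def by auto
  qed
  have \<iota>_\<iota>: "\<iota> (\<iota> d) = d" if d: "d \<in> B" for d
  proof -
    have "dif c (\<iota> (\<iota> d)) = dif c d"
      using dif_\<iota>[OF \<iota>_B[OF d]] dif_\<iota>[OF d] m_\<iota>[OF d] by (simp add: comp_assoc)
    then show ?thesis by (simp add: dif_def fun_eq_iff)
  qed
  have "(\<Sum>d\<in>B. sk k L b (dif c d)) = (\<Sum>d\<in>B. - sk k L b (dif c d))"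
  proof (rule sum.reindex_bij_witness[where i=\<iota> and j=\<iota>])
    fix d assume d: "d \<in> B"
    show "- sk k L b (dif c (\<iota> d)) = sk k L b (dif c d)"
      unfolding dif_\<iota>[OF d] sk_transpose[OF mL[OF d]] by simp
  qed (use \<iota>_\<iota> \<iota>_B in auto)
  then have z: "(\<Sum>d\<in>B. sk k L b (dif c d)) = 0" by (simp add: sum_negf)
  let ?G = "{d. d \<in> rows L (b k) \<and> (\<forall>j. Suc j < L \<longrightarrow> c (Suc j) < c j - int (d j))}"
  have "rows L (b k) = ?G \<union> B" unfolding B_def bad_def by (auto simp: not_less)
  moreover have "?G \<inter> B = {}" unfolding B_def bad_def by (auto simp: not_le[symmetric])
  moreover have "finite ?G" "finite B" using finite_rows[of L "b k"] unfolding B_def by auto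
  ultimately have "(\<Sum>d\<in>rows L (b k). sk k L b (dif c d)) =
      (\<Sum>d\<in>?G. sk k L b (dif c d)) + (\<Sum>d\<in>B. sk k L b (dif c d))"
    by (metis (no_types, lifting) sum.union_disjoint)
  then show ?thesis unfolding sk_Suc using z by simp
qed

text \<open>Strict decrease of integers gains at least one for each step back from the last index,
  where the bound is \<open>- int (L - 1)\<close>.\<close>

lemma decreasing_lower_bound:
  fixes c :: "nat \<Rightarrow> int"
  assumes "\<And>j. Suc j < L \<Longrightarrow> c (Suc j) < c j" "\<And>j. j < L \<Longrightarrow> c j \<ge> - int L + 1" "j < L"
  shows "c j \<ge> - int j"
proof -
  have "i < L \<Longrightarrow> c (L - 1 - i) \<ge> - int (L - 1 - i)" for i
  proof (induction i)
    case 0 then show ?case using assms(2)[of "L - 1"] by (simp add: of_nat_diff)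
  next
    case (Suc i)
    have "Suc (L - 1 - Suc i) = L - 1 - i" using Suc.prems by simp
    then have "c (L - 1 - i) < c (L - 1 - Suc i)" using assms(1)[of "L - 1 - Suc i"] Suc.prems by simp
    then show ?case using Suc by simp
  qed
  from this[of "L - 1 - j"] show ?thesis using assms(3) by simp
qed

text \<open>Here \<open>c j + int j\<close> is a weakly decreasing shape. By Pieri it is emptied by
  removing horizontal strips of sizes \<open>b (k - 1)\<close>, ..., \<open>b 0\<close>, and each
  removal shortens it by at most one row. So the first \<open>l\<close> strips lie within the first
  \<open>l\<close> rows, which is the dominance inequality; \<open>b\<close> itself need not be
  sorted.\<close>

lemma sk_dominance:
  assumes "k \<le> L" "\<And>j. Suc j < L \<Longrightarrow> c (Suc j) < c j" "sk k L b c \<noteq> 0"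
  shows "(\<forall>j. k \<le> j \<and> j < L \<longrightarrow> c j = - int j) \<and> (\<forall>l\<le>k. (\<Sum>j<l. b j) \<le> (\<Sum>j<l. c j + int j))"
  using assms
proof (induction k arbitrary: c)
  case 0
  have ge: "c j \<ge> - int j" if "j < L" for j
    using decreasing_lower_bound[of L c j] 0 sk_nonzero(1)[OF 0(3)] that by blast
  have "(\<Sum>j<L. c j + int j) = 0" using sk_nonzero(2)[OF 0(3)] by simp
  then have "\<forall>j\<in>{..<L}. c j + int j = 0"
    by (subst (asm) sum_nonneg_eq_0_iff) (use ge in force)+
  then show ?case by force
next
  case (Suc k)
  have ge: "c j \<ge> - int j" if "j < L" for j
    using decreasing_lower_bound[of L c j] Suc.prems(2) sk_nonzero(1)[OF Suc.prems(3)] that by blast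
  obtain d where d: "d \<in> rows L (b k)" "\<And>j. Suc j < L \<Longrightarrow> c (Suc j) < c j - int (d j)" "sk k L b (dif c d) \<noteq> 0"
  proof -
    have "(\<Sum>d | d \<in> rows L (b k) \<and> (\<forall>j. Suc j < L \<longrightarrow> c (Suc j) < c j - int (d j)). sk k L b (dif c d)) \<noteq> 0"
      using Suc.prems(3) sk_pieri[of L c k b] Suc.prems(2) by simp
    from sum.not_neutral_contains_not_neutral[OF this] show ?thesis using that by blast
  qed
  have IH: "(\<forall>j. k \<le> j \<and> j < L \<longrightarrow> dif c d j = - int j) \<and> (\<forall>l\<le>k. (\<Sum>j<l. b j) \<le> (\<Sum>j<l. dif c d j + int j))"
  proof (rule Suc.IH)
    fix j assume "Suc j < L"
    from d(2)[OF this] show "dif c d (Suc j) < dif c d j" by (simp add: dif_def)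
  qed (use Suc.prems d in auto)
  \<comment> \<open>Interlacing squeezes the entry: it is strictly below the preceding entry of
    \<open>dif c d\<close>, which is \<open>- int i\<close> by induction, and it is at least
    \<open>- int j\<close> by \<open>ge\<close>.\<close>
  have z: "c j = - int j" if j: "Suc k \<le> j" "j < L" for j
  proof -
    obtain i where i: "j = Suc i" using j by (cases j) auto
    have "c (Suc i) < c i - int (d i)" using d(2) i j by simp
    moreover have "c i - int (d i) = - int i" using IH i j by (auto simp: dif_def)
    ultimately show ?thesis using ge[OF j(2)] i by simp
  qed
  have "(\<Sum>j<l. b j) \<le> (\<Sum>j<l. c j + int j)" if l: "l \<le> Suc k" for l
  proof (cases "l \<le> k")
    case True
    have "(\<Sum>j<l. b j) \<le> (\<Sum>j<l. dif c d j + int j)" using IH True by blast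
    also have "\<dots> \<le> (\<Sum>j<l. c j + int j)" by (rule sum_mono) (simp add: dif_def)
    finally show ?thesis .
  next
    case False
    then have l: "l = Suc k" using l by simp
    \<comment> \<open>All entries beyond row \<open>k\<close> are zero, so the longest prefix is the
      whole shape and its size equals the total of \<open>b\<close>.\<close>
    have "(\<Sum>j<L. c j + int j) = (\<Sum>j<Suc k. c j + int j)"
      by (rule sum.mono_neutral_right) (use Suc.prems(1) z in auto)
    then show ?thesis using sk_nonzero(2)[OF Suc.prems(3)] l by simp
  qed
  then show ?case using z by blast
qed

text \<open>The Kostka number of a shape with its own content, built up one row at a time. Dominance
  for the remaining shape forbids removing anything above row \<open>k\<close> and forces row
  \<open>k\<close> to disappear, so only one strip survives in Pieri's rule.\<close>

lemma sk_diag: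
  assumes u: "\<And>j. Suc j < L \<Longrightarrow> u (Suc j) \<le> u j" "\<And>j. j < L \<Longrightarrow> 0 \<le> u j" and "k \<le> L"
  shows "sk k L u (\<lambda>j. (if j < k then u j else 0) - int j) = 1"
  using \<open>k \<le> L\<close>
proof (induction k)
  case 0
  have "sk 0 L u (\<lambda>j. - int j) = (\<Sum>w | w permutes {0..<L}. if w = id then 1 else 0)"
    unfolding sk_0
  proof (rule sum.cong[OF refl])
    fix w assume "w \<in> {w. w permutes {0..<L}}"
    then have "(\<forall>j<L. - int j + int (w j) = 0) \<longleftrightarrow> w = id"
      by (auto simp: fun_eq_iff permutes_def)
    then show "sign w * (if \<forall>j<L. - int j + int (w j) = 0 then 1 else 0) = (if w = id then 1 else 0)" by auto
  qed
  also have "\<dots> = 1" by (simp add: finite_permutations permutes_id)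
  finally show ?case by simp
next
  case (Suc k)
  let ?c = "\<lambda>j. (if j < Suc k then u j else 0) - int j"
  let ?d = "\<lambda>j. if j = k then nat (u k) else 0"
  have dec: "?c (Suc j) < ?c j" if "Suc j < L" for j using u(1)[OF that] u(2)[of j] that by auto
  have kL: "k < L" using Suc.prems by simp
  have only: "d = ?d" if d: "d \<in> rows L (u k)" "\<And>j. Suc j < L \<Longrightarrow> ?c (Suc j) < ?c j - int (d j)" "sk k L u (dif ?c d) \<noteq> 0" for d
  proof
    fix j
    have D: "(\<forall>j. k \<le> j \<and> j < L \<longrightarrow> dif ?c d j = - int j) \<and> (\<forall>l\<le>k. (\<Sum>j<l. u j) \<le> (\<Sum>j<l. dif ?c d j + int j))"
    proof (rule sk_dominance)
      fix j assume "Suc j < L"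
      from d(2)[OF this] show "dif ?c d (Suc j) < dif ?c d j" by (simp only: dif_def)
    qed (use kL d in auto)
    consider "j < k" | "j = k" | "k < j" "j < L" | "L \<le> j" by linarith
    then show "d j = ?d j"
    proof cases
      case 1
      have "(\<Sum>j<k. u j) \<le> (\<Sum>j<k. dif ?c d j + int j)" using D by blast
      also have "\<dots> = (\<Sum>j<k. u j - int (d j))" by (rule sum.cong) (auto simp: dif_def)
      finally have "(\<Sum>j<k. d j) = 0" by (simp add: sum_subtractf flip: of_nat_sum)
      then show ?thesis using 1 by simp
    next
      case 2
      then have "dif ?c d k = - int k" using D kL by blast
      then show ?thesis using 2 by (simp add: dif_def)
    next
      case 3
      then have "dif ?c d j = - int j" using D by simp
      then show ?thesis using 3 by (simp add: dif_def)
    next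
      case 4
      then show ?thesis using d(1) kL by (simp add: rows_def)
    qed
  qed
  have "(\<Sum>j<L. ?d j) = nat (u k)" using kL by simp
  then have dr: "?d \<in> rows L (u k)" using kL u(2)[of k] unfolding rows_def by (auto simp del: of_nat_sum)
  have dg: "?c (Suc j) < ?c j - int (?d j)" if "Suc j < L" for j
    using dec[OF that] u(2)[of k] kL by (cases "j = k") auto
  have "sk (Suc k) L u ?c =
    (\<Sum>d | d \<in> rows L (u k) \<and> (\<forall>j. Suc j < L \<longrightarrow> ?c (Suc j) < ?c j - int (d j)). sk k L u (dif ?c d))"
    by (rule sk_pieri) (rule dec)
  also have "\<dots> = (\<Sum>d\<in>{?d}. sk k L u (dif ?c d))"
    by (rule sum.mono_neutral_right) (use finite_rows[of L "u k"] dr dg only in auto)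
  also have "\<dots> = sk k L u (\<lambda>j. (if j < k then u j else 0) - int j)"
    using u(2)[of k] kL by (auto intro!: arg_cong[where f="sk k L u"] simp: dif_def fun_eq_iff less_Suc_eq)
  also have "\<dots> = 1" using Suc by simp
  finally show ?case .
qed

lemma sum_nat_ge: "finite (A :: nat set) \<Longrightarrow> \<Sum>{..<card A} \<le> \<Sum>A"
proof (induction "card A" arbitrary: A)
  case (Suc m)
  have ne: "A \<noteq> {}" using Suc by auto
  have "A \<subseteq> {..Max A}" using Suc by auto
  then have "card A \<le> Suc (Max A)" by (metis card_atMost card_mono finite_atMost)
  then have "m \<le> Max A" using Suc by simp
  moreover have "\<Sum>{..<m} \<le> \<Sum>(A - {Max A})" using Suc ne by (metis Max_in card_Diff_singleton diff_Suc_1 finite_Diff)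
  moreover have "\<Sum>A = Max A + \<Sum>(A - {Max A})" using Suc ne by (intro sum.remove) auto
  ultimately show ?case using Suc(2) by (simp flip: Suc(2))
qed simp

lemma permutes_prefix_sum:
  fixes w :: "nat \<Rightarrow> nat"
  assumes "w permutes {0..<L}" shows "(\<Sum>j<l. j) \<le> (\<Sum>j<l. w j)"
proof -
  have inj: "inj_on w {..<l}" using assms permutes_inj inj_on_subset by blast
  have "\<Sum>{..<card (w ` {..<l})} \<le> \<Sum>(w ` {..<l})" by (rule sum_nat_ge) simp
  then show ?thesis using inj by (simp add: card_image sum.reindex)
qed

lemma prefix_sums_eq:
  fixes f g :: "nat \<Rightarrow> int"
  assumes "\<And>l. l \<le> L \<Longrightarrow> (\<Sum>j<l. f j) = (\<Sum>j<l. g j)" "j < L"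
  shows "f j = g j"
  using assms(1)[of j] assms(1)[of "Suc j"] assms(2) by simp

section \<open>Orthonormality of the determinants indexed by partitions\<close>

definition dominant :: "nat \<Rightarrow> (nat \<Rightarrow> int) \<Rightarrow> bool" where
  "dominant n u \<longleftrightarrow> (\<forall>j. Suc j < n \<longrightarrow> u (Suc j) \<le> u j) \<and> (\<forall>j<n. 0 \<le> u j) \<and> (\<Sum>j<n. u j) = int n"

lemma inner_hc_chi:
  assumes "(\<Sum>j<n. b j) = int n"
  shows "(\<Sum>\<sigma> | \<sigma> permutes {1..n}. hc {1..n} n b \<sigma> * chi {1..n} n u \<sigma>) = fact n * sk n n b (\<lambda>j. u j - int j)"
proof -
  have "(\<Sum>\<sigma> | \<sigma> permutes {1..n}. hc {1..n} n b \<sigma> * chi {1..n} n u \<sigma>) =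
    (\<Sum>\<sigma> | \<sigma> permutes {1..n}. \<Sum>w | w permutes {0..<n}. sign w * (hc {1..n} n b \<sigma> * hc {1..n} n (\<lambda>j. u j + int (w j) - int j) \<sigma>))"
    unfolding chi_def sum_distrib_left by (simp add: mult_ac)
  also have "\<dots> = (\<Sum>w | w permutes {0..<n}. sign w * (\<Sum>\<sigma> | \<sigma> permutes {1..n}. hc {1..n} n b \<sigma> * hc {1..n} n (\<lambda>j. u j + int (w j) - int j) \<sigma>))"
    unfolding sum_distrib_left by (rule sum.swap)
  also have "\<dots> = (\<Sum>w | w permutes {0..<n}. sign w * (fact n * int (card (mats n n b (\<lambda>j. u j + int (w j) - int j)))))"
    using assms by (simp add: inner_hc)
  also have "\<dots> = fact n * sk n n b (\<lambda>j. u j - int j)"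
    unfolding sk_def sum_distrib_left
    by (intro sum.cong refl) (simp add: mult_ac algebra_simps)
  finally show ?thesis .
qed

lemma sum_permuted_shift:
  assumes "w permutes {0..<n}"
  shows "(\<Sum>j<n. u j + int (w j) - int j) = (\<Sum>j<n. u j)"
proof -
  have "(\<Sum>j<n. int (w j)) = (\<Sum>j<n. int j)"
    using sum.permute[OF assms, of int] by (simp add: o_def atLeast0LessThan)
  then show ?thesis by (simp add: sum.distrib sum_subtractf)
qed

lemma inner_chi_chi:
  assumes "(\<Sum>j<n. v j) = int n"
  shows "(\<Sum>\<sigma> | \<sigma> permutes {1..n}. chi {1..n} n u \<sigma> * chi {1..n} n v \<sigma>) =
    fact n * (\<Sum>w | w permutes {0..<n}. sign w * sk n n (\<lambda>j. v j + int (w j) - int j) (\<lambda>j. u j - int j))"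
proof -
  have "(\<Sum>\<sigma> | \<sigma> permutes {1..n}. chi {1..n} n u \<sigma> * chi {1..n} n v \<sigma>) =
    (\<Sum>\<sigma> | \<sigma> permutes {1..n}. \<Sum>w | w permutes {0..<n}. sign w * (hc {1..n} n (\<lambda>j. v j + int (w j) - int j) \<sigma> * chi {1..n} n u \<sigma>))"
    unfolding chi_def[of _ _ v] sum_distrib_left by (simp add: mult_ac)
  also have "\<dots> = (\<Sum>w | w permutes {0..<n}. sign w * (\<Sum>\<sigma> | \<sigma> permutes {1..n}. hc {1..n} n (\<lambda>j. v j + int (w j) - int j) \<sigma> * chi {1..n} n u \<sigma>))"
    unfolding sum_distrib_left by (rule sum.swap)
  also have "\<dots> = (\<Sum>w | w permutes {0..<n}. sign w * (fact n * sk n n (\<lambda>j. v j + int (w j) - int j) (\<lambda>j. u j - int j)))"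
    by (intro sum.cong refl arg_cong2[where f="(*)"], subst inner_hc_chi) (use sum_permuted_shift assms in auto)
  finally show ?thesis by (simp add: sum_distrib_left mult_ac)
qed

lemma sk_shift_dominance:
  assumes "dominant n u" "w permutes {0..<n}" "l \<le> n"
    "sk n n (\<lambda>j. v j + int (w j) - int j) (\<lambda>j. u j - int j) \<noteq> 0"
  shows "(\<Sum>j<l. v j + int (w j) - int j) \<le> (\<Sum>j<l. u j)"
proof -
  have "\<forall>l\<le>n. (\<Sum>j<l. v j + int (w j) - int j) \<le> (\<Sum>j<l. u j - int j + int j)"
    by (rule conjunct2[OF sk_dominance]) (use assms in \<open>force simp: dominant_def\<close>)+
  then show ?thesis using assms(3) by simp
qed

text \<open>Expanding the determinant of \<open>v\<close>, some content
  \<open>v j + int (w j) - int j\<close> is dominated by \<open>u\<close>. A permutation has prefix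
  sums at least those of the identity, so this content in turn dominates \<open>v\<close>.\<close>

lemma inner_chi_nonzero_dominance:
  assumes "dominant n u" "dominant n v" "l \<le> n"
    "(\<Sum>\<sigma> | \<sigma> permutes {1..n}. chi {1..n} n u \<sigma> * chi {1..n} n v \<sigma>) \<noteq> 0"
  shows "(\<Sum>j<l. v j) \<le> (\<Sum>j<l. u j)"
proof -
  have "(\<Sum>w | w permutes {0..<n}. sign w * sk n n (\<lambda>j. v j + int (w j) - int j) (\<lambda>j. u j - int j)) \<noteq> 0"
    using assms by (subst (asm) inner_chi_chi) (auto simp: dominant_def)
  from sum.not_neutral_contains_not_neutral[OF this]
  obtain w where w: "w permutes {0..<n}" "sk n n (\<lambda>j. v j + int (w j) - int j) (\<lambda>j. u j - int j) \<noteq> 0" by auto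
  have "int (\<Sum>j<l. j) \<le> int (\<Sum>j<l. w j)" using permutes_prefix_sum[OF w(1)] by (simp only: of_nat_le_iff)
  then have "(\<Sum>j<l. v j) \<le> (\<Sum>j<l. v j + int (w j) - int j)" by (simp add: sum.distrib sum_subtractf)
  also have "\<dots> \<le> (\<Sum>j<l. u j)" by (rule sk_shift_dominance) (use assms w in auto)
  finally show ?thesis .
qed

lemma chi_cong:
  assumes "\<And>j. j < L \<Longrightarrow> u j = v j" shows "chi A L u \<sigma> = chi A L v \<sigma>"
  unfolding chi_def using assms by (intro sum.cong refl arg_cong2[where f="(*)"] hc_cong) auto

text \<open>A surviving \<open>w\<close> has prefix sums at most those of the identity by dominance
  and at least those since its values are distinct; hence \<open>w = id\<close>, and
  \<open>sk_diag\<close> gives 1.\<close>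

lemma inner_chi_self:
  assumes u: "dominant n u"
  shows "(\<Sum>\<sigma> | \<sigma> permutes {1..n}. chi {1..n} n u \<sigma> * chi {1..n} n u \<sigma>) = fact n"
proof -
  have "(\<Sum>w | w permutes {0..<n}. sign w * sk n n (\<lambda>j. u j + int (w j) - int j) (\<lambda>j. u j - int j))
     = (\<Sum>w\<in>{id}. sign w * sk n n (\<lambda>j. u j + int (w j) - int j) (\<lambda>j. u j - int j))"
  proof (rule sum.mono_neutral_right)
    show "\<forall>w\<in>{w. w permutes {0..<n}} - {id}. sign w * sk n n (\<lambda>j. u j + int (w j) - int j) (\<lambda>j. u j - int j) = 0"
    proof (rule ballI, rule ccontr)
      fix w assume w: "w \<in> {w. w permutes {0..<n}} - {id}"
        and nz: "sign w * sk n n (\<lambda>j. u j + int (w j) - int j) (\<lambda>j. u j - int j) \<noteq> 0"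
      have "int (w j) = int j" if "j < n" for j
      proof (rule prefix_sums_eq[OF _ that])
        fix l assume l: "l \<le> n"
        have "(\<Sum>j<l. u j + int (w j) - int j) \<le> (\<Sum>j<l. u j)"
          by (rule sk_shift_dominance) (use u w l nz in auto)
        then have "(\<Sum>j<l. int (w j)) \<le> (\<Sum>j<l. int j)" by (simp add: sum.distrib sum_subtractf)
        moreover have "int (\<Sum>j<l. j) \<le> int (\<Sum>j<l. w j)"
          using permutes_prefix_sum[of w n l] w by (simp only: of_nat_le_iff) simp
        ultimately show "(\<Sum>j<l. int (w j)) = (\<Sum>j<l. int j)" by simp
      qed
      then have "w j = id j" for j using w by (cases "j < n") (auto simp: permutes_def)
      then show False using w by auto
    qed
  qed (auto simp: finite_permutations permutes_id)
  also have "\<dots> = sk n n u (\<lambda>j. u j - int j)" by simp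
  also have "\<dots> = sk n n u (\<lambda>j. (if j < n then u j else 0) - int j)" by (rule sk_cong) auto
  also have "\<dots> = 1" by (rule sk_diag) (use u in \<open>auto simp: dominant_def\<close>)
  finally show ?thesis using u by (subst inner_chi_chi) (auto simp: dominant_def)
qed

text \<open>The inner product is symmetric, so if it were nonzero each shape would dominate the
  other and all prefix sums would agree.\<close>

lemma inner_chi_ne:
  assumes "dominant n u" "dominant n v" "\<exists>j<n. u j \<noteq> v j"
  shows "(\<Sum>\<sigma> | \<sigma> permutes {1..n}. chi {1..n} n u \<sigma> * chi {1..n} n v \<sigma>) = 0"
proof (rule ccontr)
  assume nz: "\<not> ?thesis"
  have "(\<Sum>j<l. u j) = (\<Sum>j<l. v j)" if "l \<le> n" for l
  proof (rule antisym)
    show "(\<Sum>j<l. v j) \<le> (\<Sum>j<l. u j)" by (rule inner_chi_nonzero_dominance) (use assms that nz in auto)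
    show "(\<Sum>j<l. u j) \<le> (\<Sum>j<l. v j)" by (rule inner_chi_nonzero_dominance) (use assms that nz in \<open>auto simp: mult.commute\<close>)
  qed
  from prefix_sums_eq[of n u v, OF this] assms(3) show False by blast
qed

section \<open>Partitions as lists and as padded vectors\<close>

lemma length_le_sum_list: "0 \<notin> set la \<Longrightarrow> length la \<le> sum_list (la :: nat list)"
  by (induction la) auto

lemma sum_part_nth:
  assumes "length la \<le> n" shows "(\<Sum>j<n. part_nth la j) = sum_list la"
proof -
  have "(\<Sum>j<n. part_nth la j) = (\<Sum>j<length la. part_nth la j)"
    by (rule sum.mono_neutral_right) (use assms in \<open>auto simp: part_nth_def\<close>)
  also have "\<dots> = sum_list la" by (simp add: part_nth_def sum_list_sum_nth atLeast0LessThan)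
  finally show ?thesis .
qed

lemma int_partitions_length: "la \<in> int_partitions n \<Longrightarrow> length la \<le> n"
  using length_le_sum_list by (auto simp: int_partitions_def)

lemma dominant_part_nth:
  assumes la: "la \<in> int_partitions n" shows "dominant n (\<lambda>j. int (part_nth la j))"
proof -
  have "part_nth la (Suc j) \<le> part_nth la j" for j
    using la sorted_rev_nth_mono[of la j "Suc j"] by (auto simp: int_partitions_def part_nth_def)
  moreover have "(\<Sum>j<n. part_nth la j) = n"
    using sum_part_nth[OF int_partitions_length[OF la]] la by (simp add: int_partitions_def)
  then have "(\<Sum>j<n. int (part_nth la j)) = int n" by (simp flip: of_nat_sum)
  ultimately show ?thesis by (simp add: dominant_def)
qed

lemma part_nth_inj:
  assumes "la \<in> int_partitions n" "mu \<in> int_partitions n" "\<And>j. j < n \<Longrightarrow> part_nth la j = part_nth mu j"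
  shows "la = mu"
proof -
  have *: "length la \<le> length mu" if "la \<in> int_partitions n" "mu \<in> int_partitions n" "\<And>j. j < n \<Longrightarrow> part_nth la j = part_nth mu j" for la mu
  proof (rule ccontr)
    assume "\<not> length la \<le> length mu"
    then have l: "length mu < length la" by simp
    then have "part_nth la (length mu) = part_nth mu (length mu)"
      using that int_partitions_length[OF that(1)] by simp
    then have "la ! length mu = 0" using l by (simp add: part_nth_def)
    moreover have "la ! length mu \<in> set la" using l by simp
    ultimately show False using that(1) by (simp add: int_partitions_def)
  qed
  have len: "length la = length mu" using *[of la mu] *[of mu la] assms by force
  show ?thesis
  proof (rule nth_equalityI[OF len])
    fix i assume "i < length la"
    then show "la ! i = mu ! i" using assms(3)[of i] int_partitions_length[OF assms(1)] len by (simp add: part_nth_def)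
  qed
qed

lemma irr_char_orthonormal:
  assumes "la \<in> int_partitions n" "mu \<in> int_partitions n"
  shows "(\<Sum>\<sigma> | \<sigma> permutes {1..n}. irr_char n la \<sigma> * irr_char n mu \<sigma>) = (if la = mu then fact n else 0)"
proof (cases "la = mu")
  case True
  then show ?thesis using inner_chi_self[OF dominant_part_nth[OF assms(1)]] by (simp add: irr_char_eq_chi)
next
  case False
  then have "\<exists>j<n. int (part_nth la j) \<noteq> int (part_nth mu j)" using part_nth_inj[OF assms] by auto
  from inner_chi_ne[OF dominant_part_nth[OF assms(1)] dominant_part_nth[OF assms(2)] this]
  show ?thesis using False by (simp add: irr_char_eq_chi)
qed

lemma finite_int_partitions: "finite (int_partitions n)"
proof (rule finite_subset)
  show "int_partitions n \<subseteq> {xs. set xs \<subseteq> {..n} \<and> length xs \<le> n}"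
    using int_partitions_length by (auto simp: int_partitions_def intro: member_le_sum_list)
qed (simp add: finite_lists_length_le)

section \<open>Completeness\<close>

text \<open>Conjugacy is written as an intertwining relation, without inverses, so that it is the
  special case \<open>A = B\<close> of the relabelling in \<open>hc_natural\<close>.\<close>

definition class_fun :: "nat \<Rightarrow> ((nat \<Rightarrow> nat) \<Rightarrow> rat) \<Rightarrow> bool" where
  "class_fun n g \<longleftrightarrow> (\<forall>\<sigma> \<tau> p. \<sigma> permutes {1..n} \<and> \<tau> permutes {1..n} \<and> p permutes {1..n} \<and>
      p \<circ> \<sigma> = \<tau> \<circ> p \<longrightarrow> g \<sigma> = g \<tau>)"

text \<open>Colourings are pulled back along \<open>\<phi>\<close>. Allowing different sets
  \<open>A\<close> and \<open>B\<close> serves two purposes: conjugation inside one symmetric group,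
  and comparison of the various subsets from which characters are induced.\<close>

lemma hc_natural:
  assumes fin: "finite A" and \<phi>: "bij_betw \<phi> A B" and s: "\<And>x. x \<in> A \<Longrightarrow> \<sigma> x \<in> A"
    and eq: "\<And>x. x \<in> A \<Longrightarrow> \<phi> (\<sigma> x) = \<tau> (\<phi> x)"
  shows "hc A L b \<sigma> = hc B L b \<tau>"
proof -
  have \<phi>A: "\<phi> x \<in> B" if "x \<in> A" for x using \<phi> that by (auto simp: bij_betw_def)
  have \<psi>A: "inv_into A \<phi> y \<in> A" "\<phi> (inv_into A \<phi> y) = y" if "y \<in> B" for y
    using \<phi> that bij_betw_inv_into_right[OF \<phi> that] by (auto simp: bij_betw_def inv_into_into)
  have \<psi>\<phi>: "inv_into A \<phi> (\<phi> x) = x" if "x \<in> A" for x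
    using bij_betw_inv_into_left[OF \<phi> that] .
  have \<tau>B: "\<tau> y \<in> B" if "y \<in> B" for y
    using eq[OF \<psi>A(1)[OF that]] \<psi>A(2)[OF that] \<phi>A[OF s[OF \<psi>A(1)[OF that]]] by simp
  have card1: "card {x\<in>A. g (\<phi> x) = j} = card {y\<in>B. g y = j}" for g :: "nat \<Rightarrow> nat" and j
  proof -
    have "bij_betw \<phi> {x\<in>A. g (\<phi> x) = j} {y\<in>B. g y = j}"
      by (rule bij_betw_byWitness[where f'="inv_into A \<phi>"]) (use \<psi>A \<psi>\<phi> \<phi>A in auto)
    then show ?thesis by (rule bij_betw_same_card)
  qed
  have card2: "card {y\<in>B. g (inv_into A \<phi> y) = j} = card {x\<in>A. g x = j}" for g :: "nat \<Rightarrow> nat" and j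
  proof -
    have "{x\<in>A. g (inv_into A \<phi> (\<phi> x)) = j} = {x\<in>A. g x = j}" using \<psi>\<phi> by auto
    then show ?thesis using card1[of "\<lambda>y. g (inv_into A \<phi> y)" j] by simp
  qed
  have \<psi>\<tau>: "inv_into A \<phi> (\<tau> y) = \<sigma> (inv_into A \<phi> y)" if "y \<in> B" for y
    using eq[OF \<psi>A(1)[OF that]] \<psi>A(2)[OF that] \<psi>\<phi>[OF s[OF \<psi>A(1)[OF that]]] by simp
  have "bij_betw (\<lambda>g. \<lambda>y\<in>B. g (inv_into A \<phi> y)) (invcol A L b \<sigma>) (invcol B L b \<tau>)"
  proof (rule bij_betw_byWitness[where f'="\<lambda>g. \<lambda>x\<in>A. g (\<phi> x)"])
    show "\<forall>g\<in>invcol A L b \<sigma>. (\<lambda>x\<in>A. (\<lambda>y\<in>B. g (inv_into A \<phi> y)) (\<phi> x)) = g"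
      using \<psi>\<phi> \<phi>A by (auto simp: invcol_def colset_def PiE_iff extensional_def fun_eq_iff)
    show "\<forall>g\<in>invcol B L b \<tau>. (\<lambda>y\<in>B. (\<lambda>x\<in>A. g (\<phi> x)) (inv_into A \<phi> y)) = g"
      using \<psi>A by (auto simp: invcol_def colset_def PiE_iff extensional_def fun_eq_iff)
    show "(\<lambda>g. \<lambda>y\<in>B. g (inv_into A \<phi> y)) ` invcol A L b \<sigma> \<subseteq> invcol B L b \<tau>"
      using \<psi>A \<psi>\<tau> \<tau>B by (auto simp: invcol_def colset_def PiE_iff card2 cong: conj_cong)
    show "(\<lambda>g. \<lambda>x\<in>A. g (\<phi> x)) ` invcol B L b \<tau> \<subseteq> invcol A L b \<sigma>"
      using \<phi>A s eq by (auto simp: invcol_def colset_def PiE_iff card1 cong: conj_cong)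
  qed
  then show ?thesis unfolding hc_def by (simp add: bij_betw_same_card)
qed

lemma chi_natural:
  assumes "finite A" "bij_betw \<phi> A B" "\<And>x. x \<in> A \<Longrightarrow> \<sigma> x \<in> A" "\<And>x. x \<in> A \<Longrightarrow> \<phi> (\<sigma> x) = \<tau> (\<phi> x)"
  shows "chi A L u \<sigma> = chi B L u \<tau>"
proof -
  have "hc A L b \<sigma> = hc B L b \<tau>" for b by (rule hc_natural) (use assms in auto)
  then show ?thesis unfolding chi_def by simp
qed

lemma class_fun_irr_char: "class_fun n (\<lambda>\<sigma>. of_int (irr_char n la \<sigma>))"
  unfolding class_fun_def irr_char_eq_chi
proof (intro allI impI arg_cong[where f=of_int], elim conjE)
  fix \<sigma> \<tau> p assume a: "\<sigma> permutes {1..n}" "\<tau> permutes {1..n}" "p permutes {1..n}" "p \<circ> \<sigma> = \<tau> \<circ> p"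
  show "chi {1..n} n (\<lambda>j. int (part_nth la j)) \<sigma> = chi {1..n} n (\<lambda>j. int (part_nth la j)) \<tau>"
  proof (rule chi_natural)
    show "bij_betw p {1..n} {1..n}" using a(3) by (rule permutes_imp_bij)
    show "\<sigma> x \<in> {1..n}" if "x \<in> {1..n}" for x using that permutes_in_image[OF a(1)] by blast
    show "p (\<sigma> x) = \<tau> (p x)" for x using a(4) by (metis o_apply)
  qed simp
qed

lemma hc_transpose:
  assumes i: "i < L" "j < L" and s: "\<And>x. x \<in> A \<Longrightarrow> \<sigma> x \<in> A"
  shows "hc A L (b \<circ> transpose i j) \<sigma> = hc A L b \<sigma>"
proof -
  let ?t = "transpose i j"
  have tL: "?t k < L" if "k < L" for k using i that by (auto simp: transpose_def)
  have *: "(\<lambda>x\<in>A. ?t (g x)) \<in> invcol A L (b \<circ> ?t) \<sigma>" if g: "g \<in> invcol A L b \<sigma>" for g b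
  proof -
    have "card {x\<in>A. ?t (g x) = k} = card {x\<in>A. g x = ?t k}" for k
      by (intro arg_cong[where f=card] Collect_cong) (metis transpose_involutory)
    then show ?thesis using g tL s by (auto simp: invcol_def colset_def PiE_iff cong: conj_cong)
  qed
  have "bij_betw (\<lambda>g. \<lambda>x\<in>A. ?t (g x)) (invcol A L b \<sigma>) (invcol A L (b \<circ> ?t) \<sigma>)"
  proof (rule bij_betw_byWitness[where f'="\<lambda>g. \<lambda>x\<in>A. ?t (g x)"])
    show "(\<lambda>g. \<lambda>x\<in>A. ?t (g x)) ` invcol A L (b \<circ> ?t) \<sigma> \<subseteq> invcol A L b \<sigma>"
    proof (rule image_subsetI)
      fix g assume "g \<in> invcol A L (b \<circ> ?t) \<sigma>"
      from *[OF this] show "(\<lambda>x\<in>A. ?t (g x)) \<in> invcol A L b \<sigma>" by (simp add: comp_assoc)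
    qed
    show "(\<lambda>g. \<lambda>x\<in>A. ?t (g x)) ` invcol A L b \<sigma> \<subseteq> invcol A L (b \<circ> ?t) \<sigma>" using * by blast
  qed (auto simp: invcol_def colset_def PiE_iff extensional_def fun_eq_iff)
  then show ?thesis unfolding hc_def by (simp add: bij_betw_same_card)
qed

lemma sum_swap_adjacent:
  assumes "Suc j < n"
  shows "(\<Sum>i<n. int i * (b \<circ> transpose j (Suc j)) i) = (\<Sum>i<n. int i * b i) + b j - b (Suc j)"
proof -
  have "(\<Sum>i<n. int i * (b \<circ> transpose j (Suc j)) i) = (\<Sum>i<n. (\<lambda>i. int (transpose j (Suc j) i) * b i) (transpose j (Suc j) i))"
    by simp
  also have "\<dots> = (\<Sum>i<n. int (transpose j (Suc j) i) * b i)" by (rule sum_transpose[OF assms])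
  also have "\<dots> = (\<Sum>i<n. int i * b i + (if i = j then b j else 0) - (if i = Suc j then b (Suc j) else 0))"
    by (rule sum.cong) (auto simp: transpose_def algebra_simps)
  also have "\<dots> = (\<Sum>i<n. int i * b i) + b j - b (Suc j)"
    using assms by (simp add: sum.distrib sum_subtractf)
  finally show ?thesis .
qed

text \<open>A rearrangement inequality. Since \<open>w\<close> permutes the indices, the positive
  sum of the squares \<open>(w j - j)^2\<close> is twice the difference between the sum of
  \<open>j^2\<close> and the sum of \<open>j * w j\<close>.\<close>

lemma sum_shift_less:
  fixes b :: "nat \<Rightarrow> int"
  assumes w: "w permutes {0..<n}" "w \<noteq> id"
  shows "(\<Sum>j<n. int j * (b j + int (w j) - int j)) < (\<Sum>j<n. int j * b j)"
proof -
  obtain i where i: "w i \<noteq> i" using w(2) by (auto simp: fun_eq_iff)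
  then have iL: "i < n" using w(1) by (auto simp: permutes_def)
  have "(\<Sum>j<n. (int (w j) - int j)^2) > 0"
    by (rule sum_pos2[of _ i]) (use iL i in auto)
  moreover have "(\<Sum>j<n. (int (w j))^2) = (\<Sum>j<n. (int j)^2)"
    using sum.permute[OF w(1), of "\<lambda>j. (int j)^2"] by (simp add: o_def atLeast0LessThan)
  moreover have "(\<Sum>j<n. (int (w j) - int j)^2) = (\<Sum>j<n. (int (w j))^2) + (\<Sum>j<n. (int j)^2) - 2 * (\<Sum>j<n. int j * int (w j))"
    by (simp add: power2_diff sum.distrib sum_subtractf sum_distrib_left mult_ac)
  ultimately have "(\<Sum>j<n. int j * int (w j)) < (\<Sum>j<n. (int j)^2)" by linarith
  then show ?thesis by (simp add: algebra_simps sum.distrib sum_subtractf power2_eq_square)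
qed

lemma dominant_part_exists:
  assumes "dominant n b"
  obtains la where "la \<in> int_partitions n" "\<And>j. j < n \<Longrightarrow> int (part_nth la j) = b j"
proof -
  \<comment> \<open>The number of nonzero parts; the alternative \<open>m = n\<close> guarantees
    that the least element exists when no part vanishes.\<close>
  define m where "m = (LEAST m. m = n \<or> b m = 0)"
  have m: "m = n \<or> b m = 0" unfolding m_def by (rule LeastI[of _ n]) simp
  have mn: "m \<le> n" unfolding m_def by (rule Least_le) simp
  have pos: "b j > 0" if "j < m" for j
  proof -
    have "b j \<noteq> 0" using that not_less_Least[of j "\<lambda>m. m = n \<or> b m = 0"] unfolding m_def by blast
    then show ?thesis using assms that mn unfolding dominant_def by (metis less_le order.strict_trans2)
  qed
  have mono: "b k \<le> b j" if "j \<le> k" "k < n" for j k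
    using that
  proof (induction k)
    case (Suc k)
    then show ?case using assms unfolding dominant_def by (metis Suc_lessD le_SucE order.trans order_refl)
  qed simp
  have zero: "b j = 0" if "m \<le> j" "j < n" for j
    using mono[OF that] m that assms by (fastforce simp: dominant_def)
  let ?la = "map (\<lambda>j. nat (b j)) [0..<m]"
  have pn: "int (part_nth ?la j) = b j" if "j < n" for j
    using pos[of j] zero[of j] that by (auto simp: part_nth_def)
  have "sorted_wrt (\<ge>) ?la"
    unfolding sorted_wrt_iff_nth_less using mono mn by (auto intro!: nat_mono)
  then have "sorted (rev ?la)" by (simp add: sorted_wrt_rev)
  moreover have "0 \<notin> set ?la" using pos by fastforce
  moreover have "sum_list ?la = n"
  proof -
    have "int (sum_list ?la) = int (\<Sum>j<n. part_nth ?la j)" using sum_part_nth[of ?la n] mn by simp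
    also have "\<dots> = (\<Sum>j<n. b j)" unfolding of_nat_sum by (rule sum.cong) (use pn in auto)
    also have "\<dots> = int n" using assms by (simp add: dominant_def)
    finally show ?thesis by (simp only: of_nat_eq_iff)
  qed
  ultimately have "?la \<in> int_partitions n" by (simp add: int_partitions_def)
  then show ?thesis using pn that by blast
qed

text \<open>A counterexample \<open>b\<close> minimizing \<open>\<Sum>j. j * b j\<close> is weakly decreasing, and all Jacobi--Trudi terms
  other than the diagonal one have a smaller value of this functional.\<close>
lemma orth_irr_imp_orth_hc:
  fixes g :: "(nat \<Rightarrow> nat) \<Rightarrow> rat"
  assumes orth: "\<And>la. la \<in> int_partitions n \<Longrightarrow> (\<Sum>\<sigma> | \<sigma> permutes {1..n}. g \<sigma> * of_int (irr_char n la \<sigma>)) = 0"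
  shows "(\<Sum>\<sigma> | \<sigma> permutes {1..n}. g \<sigma> * of_int (hc {1..n} n b \<sigma>)) = 0"
proof (rule ccontr)
  define I where "I b = (\<Sum>\<sigma> | \<sigma> permutes {1..n}. g \<sigma> * of_int (hc {1..n} n b \<sigma>))" for b
  define \<mu> where "\<mu> b = (\<Sum>j<n. int j * b j)" for b
  assume "\<not> ?thesis"
  then have "I b \<noteq> 0" by (simp add: I_def)
  \<comment> \<open>The minimum is taken over naturals. Applying \<open>nat\<close> loses nothing:
    \<open>I b \<noteq> 0\<close> forces all entries of \<open>b\<close> to be nonnegative, and then
    so is \<open>\<mu> b\<close>.\<close>
  then obtain b where b: "I b \<noteq> 0" "\<And>b'. I b' \<noteq> 0 \<Longrightarrow> nat (\<mu> b) \<le> nat (\<mu> b')"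
    using ex_has_least_nat[of "\<lambda>b. I b \<noteq> 0" b "\<lambda>b. nat (\<mu> b)"] by blast
  have nonneg: "b j \<ge> 0" if "I b \<noteq> 0" "j < n" for b j
    using that hc_neg[of j n b] unfolding I_def by force
  have \<mu>_nonneg: "\<mu> b \<ge> 0" if "I b \<noteq> 0" for b
    unfolding \<mu>_def using nonneg[OF that] by (intro sum_nonneg) auto
  have min: "\<mu> b \<le> \<mu> b'" if "I b' \<noteq> 0" for b'
    using b(2)[OF that] \<mu>_nonneg[OF that] by simp
  have sum_b: "(\<Sum>j<n. b j) = int n"
    using b(1) hc_wrong_sum[of "{1..n}" b n] unfolding I_def by force
  have "b (Suc j) \<le> b j" if j: "Suc j < n" for j
  proof (rule ccontr)
    assume "\<not> b (Suc j) \<le> b j"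
    then have "\<mu> (b \<circ> transpose j (Suc j)) < \<mu> b"
      unfolding \<mu>_def sum_swap_adjacent[OF j] by simp
    moreover have "I (b \<circ> transpose j (Suc j)) = I b"
      unfolding I_def
    proof (intro sum.cong refl arg_cong2[where f="(*)"] arg_cong[where f=of_int])
      fix \<sigma> assume "\<sigma> \<in> {\<sigma>. \<sigma> permutes {1..n}}"
      then have s: "\<sigma> permutes {1..n}" by simp
      show "hc {1..n} n (b \<circ> transpose j (Suc j)) \<sigma> = hc {1..n} n b \<sigma>"
        by (rule hc_transpose) (use j permutes_in_image[OF s] in auto)
    qed
    ultimately show False using min[of "b \<circ> transpose j (Suc j)"] b(1) by linarith
  qed
  then have "dominant n b" using nonneg[OF b(1)] sum_b by (simp add: dominant_def)
  from dominant_part_exists[OF this] obtain la where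
    la: "la \<in> int_partitions n" "\<And>j. j < n \<Longrightarrow> int (part_nth la j) = b j" by blast
  have "0 = (\<Sum>\<sigma> | \<sigma> permutes {1..n}. g \<sigma> * of_int (chi {1..n} n b \<sigma>))"
    using orth[OF la(1)] chi_cong[of n "\<lambda>j. int (part_nth la j)" b, OF la(2)] by (simp add: irr_char_eq_chi)
  also have "\<dots> = (\<Sum>\<sigma> | \<sigma> permutes {1..n}. \<Sum>w | w permutes {0..<n}.
      of_int (sign w) * (g \<sigma> * of_int (hc {1..n} n (\<lambda>j. b j + int (w j) - int j) \<sigma>)))"
    unfolding chi_def of_int_sum sum_distrib_left by (simp add: mult_ac)
  also have "\<dots> = (\<Sum>w | w permutes {0..<n}. of_int (sign w) * I (\<lambda>j. b j + int (w j) - int j))"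
    unfolding I_def sum_distrib_left by (rule sum.swap)
  also have "\<dots> = (\<Sum>w\<in>{id}. of_int (sign w) * I (\<lambda>j. b j + int (w j) - int j))"
  proof (rule sum.mono_neutral_right)
    show "\<forall>w\<in>{w. w permutes {0..<n}} - {id}. of_int (sign w) * I (\<lambda>j. b j + int (w j) - int j) = 0"
    proof
      fix w assume w: "w \<in> {w. w permutes {0..<n}} - {id}"
      then have "\<mu> (\<lambda>j. b j + int (w j) - int j) < \<mu> b"
        unfolding \<mu>_def by (intro sum_shift_less) auto
      then have "I (\<lambda>j. b j + int (w j) - int j) = 0" using min by fastforce
      then show "of_int (sign w) * I (\<lambda>j. b j + int (w j) - int j) = 0" by simp
    qed
  qed (auto simp: finite_permutations permutes_id)
  also have "\<dots> = I b" by simp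
  finally show False using b(1) by simp
qed

section \<open>Orbits, conjugacy and the vanishing of orthogonal class functions\<close>

lemma funpow_eq_iff_mod_orbit:
  assumes "x \<in> orbit f x"
  shows "(f ^^ k) x = (f ^^ l) x \<longleftrightarrow> k mod card (orbit f x) = l mod card (orbit f x)"
proof -
  let ?N = "funpow_dist1 f x x"
  have inj: "inj_on (\<lambda>n. (f ^^ n) x) {0..<?N}" using inj_on_funpow_dist1[OF assms] .
  have N: "card (orbit f x) = ?N"
    unfolding orbit_conv_funpow_dist1[OF assms] using inj by (simp add: card_image)
  have "(f ^^ ?N) x = x" by (rule funpow_dist1_prop[OF assms])
  then have m: "(f ^^ (m mod ?N)) x = (f ^^ m) x" for m by (rule funpow_mod_eq)
  show ?thesis
  proof
    assume "(f ^^ k) x = (f ^^ l) x"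
    then have "(f ^^ (k mod ?N)) x = (f ^^ (l mod ?N)) x" by (simp only: m)
    then show "k mod card (orbit f x) = l mod card (orbit f x)"
      unfolding N using inj by (auto dest!: inj_onD)
  next
    assume "k mod card (orbit f x) = l mod card (orbit f x)"
    then have "k mod ?N = l mod ?N" using N by metis
    then show "(f ^^ k) x = (f ^^ l) x" by (metis m)
  qed
qed

lemma orbit_eq_iff:
  assumes "permutation f" shows "orbit f x = orbit f y \<longleftrightarrow> x \<in> orbit f y"
proof
  assume "orbit f x = orbit f y"
  then show "x \<in> orbit f y" using permutation_self_in_orbit[OF assms] by blast
next
  assume x: "x \<in> orbit f y"
  have "y \<in> orbit f x" by (rule orbit_swap[OF permutation_self_in_orbit[OF assms] x])
  then show "orbit f x = orbit f y" using x by (auto intro: orbit_trans)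
qed

text \<open>The colourings \<open>\<gamma>\<close> and \<open>\<gamma>'\<close> name the orbits of
  \<open>\<sigma>\<close> and \<open>\<tau>\<close> so that equally named orbits have equal size.
  With base points \<open>a j\<close> and \<open>b j\<close> in the orbits named \<open>j\<close>,
  the conjugating map sends the \<open>m\<close>-th iterate of \<open>a j\<close> to the
  \<open>m\<close>-th iterate of \<open>b j\<close>.\<close>

lemma same_orbit_sizes_conjugate:
  fixes \<gamma> \<gamma>' :: "nat \<Rightarrow> nat"
  assumes fin: "finite A" and \<sigma>: "\<sigma> permutes A" and \<tau>: "\<tau> permutes A"
    and sizes: "\<And>j. card {x\<in>A. \<gamma> x = j} = card {x\<in>A. \<gamma>' x = j}"
    and orb: "\<And>x y. x \<in> A \<Longrightarrow> y \<in> A \<Longrightarrow> \<gamma> x = \<gamma> y \<longleftrightarrow> x \<in> orbit \<sigma> y"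
    and orb': "\<And>x y. x \<in> A \<Longrightarrow> y \<in> A \<Longrightarrow> \<gamma>' x = \<gamma>' y \<longleftrightarrow> x \<in> orbit \<tau> y"
  obtains p where "p permutes A" "p \<circ> \<sigma> = \<tau> \<circ> p"
proof -
  have perm: "permutation \<sigma>" "permutation \<tau>" using fin \<sigma> \<tau> by (auto simp: permutation_permutes)
  have nonempty: "(\<exists>x\<in>A. \<gamma> x = j) \<longleftrightarrow> (\<exists>x\<in>A. \<gamma>' x = j)" for j
  proof -
    have "(\<exists>x\<in>A. h x = j) \<longleftrightarrow> card {x\<in>A. h x = j} \<noteq> 0" for h :: "nat \<Rightarrow> nat" using fin by auto
    then show ?thesis using sizes by simp
  qed
  define a where "a j = (SOME x. x \<in> A \<and> \<gamma> x = j)" for j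
  define b where "b j = (SOME x. x \<in> A \<and> \<gamma>' x = j)" for j
  have a: "a (\<gamma> x) \<in> A" "\<gamma> (a (\<gamma> x)) = \<gamma> x" if "x \<in> A" for x
    using someI[of "\<lambda>y. y \<in> A \<and> \<gamma> y = \<gamma> x" x] that unfolding a_def by auto
  have b: "b j \<in> A" "\<gamma>' (b j) = j" if ex: "\<exists>x\<in>A. \<gamma>' x = j" for j
    using someI_ex[of "\<lambda>y. y \<in> A \<and> \<gamma>' y = j"] ex unfolding b_def by auto
  have b\<gamma>: "b (\<gamma> x) \<in> A" "\<gamma>' (b (\<gamma> x)) = \<gamma> x" if "x \<in> A" for x
    using b[of "\<gamma> x"] nonempty[of "\<gamma> x"] that by auto
  have orbA: "orbit f y \<subseteq> A" if "f permutes A" "y \<in> A" for f and y :: nat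
    using permutes_orbit_subset[OF that] .
  have ex_k: "\<exists>k. (f ^^ k) y = x" if "x \<in> orbit f y" for f :: "nat \<Rightarrow> nat" and x y
    using that unfolding orbit_altdef by auto
  have pow_in: "(f ^^ k) y \<in> orbit f y" if "permutation f" for f :: "nat \<Rightarrow> nat" and y k
    using permutation_self_in_orbit[OF that, of y] by (rule funpow_in_orbit)
  define k where "k x = (SOME k. (\<sigma> ^^ k) (a (\<gamma> x)) = x)" for x
  have k: "(\<sigma> ^^ k x) (a (\<gamma> x)) = x" if "x \<in> A" for x
    unfolding k_def by (rule someI_ex, rule ex_k) (use orb[of x "a (\<gamma> x)"] a that in auto)
  have sz: "card (orbit \<sigma> (a (\<gamma> x))) = card (orbit \<tau> (b (\<gamma> x)))" if "x \<in> A" for x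
  proof -
    have "orbit \<sigma> (a (\<gamma> x)) = {y\<in>A. \<gamma> y = \<gamma> x}"
      using orb[OF _ a(1)[OF that]] a[OF that] orbA[OF \<sigma> a(1)[OF that]] by auto
    moreover have "orbit \<tau> (b (\<gamma> x)) = {y\<in>A. \<gamma>' y = \<gamma> x}"
      using orb'[OF _ b\<gamma>(1)[OF that]] b\<gamma>[OF that] orbA[OF \<tau> b\<gamma>(1)[OF that]] by auto
    ultimately show ?thesis using sizes by simp
  qed
  define q where "q x = (\<tau> ^^ k x) (b (\<gamma> x))" for x
  have q: "q ((\<sigma> ^^ m) (a (\<gamma> x))) = (\<tau> ^^ m) (b (\<gamma> x))" if x: "x \<in> A" for x m
  proof -
    let ?z = "(\<sigma> ^^ m) (a (\<gamma> x))"
    have zo: "?z \<in> orbit \<sigma> (a (\<gamma> x))" by (rule pow_in[OF perm(1)])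
    then have zA: "?z \<in> A" using orbA[OF \<sigma> a(1)[OF x]] by blast
    have z\<gamma>: "\<gamma> ?z = \<gamma> x" using orb[OF zA a(1)[OF x]] zo a(2)[OF x] by simp
    have "(\<sigma> ^^ k ?z) (a (\<gamma> x)) = (\<sigma> ^^ m) (a (\<gamma> x))" using k[OF zA] z\<gamma> by simp
    \<comment> \<open>The exponent picked by \<open>k\<close> is arbitrary, but it is determined
      modulo the length of the orbit, and by \<open>sz\<close> the orbit of \<open>\<tau>\<close>
      has the same length. This makes \<open>q\<close> independent of the choice.\<close>
    then have "k ?z mod card (orbit \<tau> (b (\<gamma> x))) = m mod card (orbit \<tau> (b (\<gamma> x)))"
      using funpow_eq_iff_mod_orbit[OF permutation_self_in_orbit[OF perm(1)]] sz[OF x] by metis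
    then have "(\<tau> ^^ k ?z) (b (\<gamma> x)) = (\<tau> ^^ m) (b (\<gamma> x))"
      using funpow_eq_iff_mod_orbit[OF permutation_self_in_orbit[OF perm(2)]] by metis
    then show ?thesis unfolding q_def z\<gamma> .
  qed
  have q\<sigma>: "q (\<sigma> x) = \<tau> (q x)" if x: "x \<in> A" for x
    using q[OF x, of "Suc (k x)"] q[OF x, of "k x"] k[OF x] by simp
  have qA: "q ` A = A"
  proof
    show "q ` A \<subseteq> A"
    proof (rule image_subsetI)
      fix x assume x: "x \<in> A"
      show "q x \<in> A" unfolding q_def using pow_in[OF perm(2)] orbA[OF \<tau> b\<gamma>(1)[OF x]] by blast
    qed
    show "A \<subseteq> q ` A"
    proof
      fix y assume y: "y \<in> A"
      obtain x where x: "x \<in> A" "\<gamma> x = \<gamma>' y" using nonempty[of "\<gamma>' y"] y by blast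
      have "y \<in> orbit \<tau> (b (\<gamma> x))" using orb'[OF y b\<gamma>(1)[OF x(1)]] b\<gamma>(2)[OF x(1)] x by simp
      then obtain m where "(\<tau> ^^ m) (b (\<gamma> x)) = y" using ex_k by blast
      then have "q ((\<sigma> ^^ m) (a (\<gamma> x))) = y" using q[OF x(1)] by simp
      moreover have "(\<sigma> ^^ m) (a (\<gamma> x)) \<in> A" using pow_in[OF perm(1)] orbA[OF \<sigma> a(1)[OF x(1)]] by blast
      ultimately show "y \<in> q ` A" by blast
    qed
  qed
  define p where "p x = (if x \<in> A then q x else x)" for x
  have "inj_on q A" using fin qA by (simp add: eq_card_imp_inj_on)
  then have "bij_betw p A A" using qA by (auto simp: bij_betw_def p_def inj_on_def)
  then have "p permutes A" by (rule bij_imp_permutes) (simp add: p_def)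
  moreover have "p \<circ> \<sigma> = \<tau> \<circ> p"
    using q\<sigma> permutes_in_image[OF \<sigma>] permutes_not_in[OF \<sigma>] permutes_not_in[OF \<tau>]
    by (auto simp: fun_eq_iff p_def)
  ultimately show ?thesis using that by blast
qed

lemma inv_coloring_orbit:
  assumes "\<tau> permutes A" "y \<in> A" "x \<in> orbit \<tau> y" "\<And>x. x \<in> A \<Longrightarrow> g (\<tau> x) = g x"
  shows "g x = g y"
proof -
  have "x \<in> A \<and> g x = g y" using assms(3)
    by induction (use assms permutes_in_image[OF assms(1)] in auto)
  then show ?thesis ..
qed

text \<open>Take \<open>\<sigma>\<close> with \<open>g \<sigma> \<noteq> 0\<close> having the most orbits and colour by its orbits. Any \<open>\<tau>\<close> with \<open>g \<tau> \<noteq> 0\<close>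
  fixing a colouring of that content has exactly the colour classes as orbits, so it is conjugate to \<open>\<sigma>\<close>.\<close>
lemma orth_hc_imp_zero:
  assumes cf: "class_fun n g"
    and orth: "\<And>b. (\<Sum>\<sigma> | \<sigma> permutes {1..n}. g \<sigma> * of_int (hc {1..n} n b \<sigma>)) = 0"
    and "\<sigma> permutes {1..n}"
  shows "g \<sigma> = 0"
proof (rule ccontr)
  let ?A = "{1..n}"
  define r where "r \<sigma> = card (orbit \<sigma> ` ?A)" for \<sigma>
  assume "g \<sigma> \<noteq> 0"
  then have ne: "{\<sigma>. \<sigma> permutes ?A \<and> g \<sigma> \<noteq> 0} \<noteq> {}" using assms(3) by auto
  have fin: "finite {\<sigma>. \<sigma> permutes ?A \<and> g \<sigma> \<noteq> 0}" by (simp add: finite_permutations)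
  define R where "R = Max (r ` {\<sigma>. \<sigma> permutes ?A \<and> g \<sigma> \<noteq> 0})"
  obtain \<sigma> where s: "\<sigma> permutes ?A" "g \<sigma> \<noteq> 0" "r \<sigma> = R"
  proof -
    have "R \<in> r ` {\<sigma>. \<sigma> permutes ?A \<and> g \<sigma> \<noteq> 0}" unfolding R_def by (rule Max_in) (use fin ne in auto)
    then show ?thesis using that by blast
  qed
  have rR: "r \<tau> \<le> R" if "\<tau> permutes ?A" "g \<tau> \<noteq> 0" for \<tau>
    unfolding R_def by (rule Max_ge) (use that fin in auto)
  have Rn: "R \<le> n" using card_image_le[of ?A "orbit \<sigma>"] s(3) by (simp add: r_def)
  obtain e where e: "bij_betw e (orbit \<sigma> ` ?A) {0..<R}"
    using ex_bij_betw_finite_nat[of "orbit \<sigma> ` ?A"] s(3) by (auto simp: r_def)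
  define \<gamma> where "\<gamma> = (\<lambda>x\<in>?A. e (orbit \<sigma> x))"
  define b where "b j = int (card {x\<in>?A. \<gamma> x = j})" for j
  have perm: "permutation f" if "f permutes ?A" for f using that by (auto simp: permutation_permutes)
  have \<gamma>_img: "\<gamma> ` ?A = {0..<R}" using e unfolding \<gamma>_def bij_betw_def by auto
  have \<gamma>_orb: "\<gamma> x = \<gamma> y \<longleftrightarrow> x \<in> orbit \<sigma> y" if "x \<in> ?A" "y \<in> ?A" for x y
    using that inj_on_eq_iff[OF bij_betw_imp_inj_on[OF e], of "orbit \<sigma> x" "orbit \<sigma> y"]
      orbit_eq_iff[OF perm[OF s(1)], of x y] by (simp add: \<gamma>_def)
  have \<gamma>_inv: "\<gamma> \<in> invcol ?A n b \<sigma>"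
  proof -
    have "\<gamma> x < n" if "x \<in> ?A" for x using \<gamma>_img Rn that by (metis atLeastLessThan_iff imageI order.strict_trans2)
    moreover have "\<gamma> \<in> extensional ?A" by (simp add: \<gamma>_def)
    ultimately have "\<gamma> \<in> ?A \<rightarrow>\<^sub>E {0..<n}" by (simp add: PiE_iff)
    moreover have "\<gamma> (\<sigma> x) = \<gamma> x" if "x \<in> ?A" for x
    proof -
      have "\<sigma> x \<in> ?A" using that permutes_in_image[OF s(1)] by blast
      then show ?thesis using \<gamma>_orb[OF _ that] by (simp add: orbit.base)
    qed
    ultimately show ?thesis by (auto simp: invcol_def colset_def b_def)
  qed
  have key: "g \<tau> = g \<sigma>" if t: "\<tau> permutes ?A" "g \<tau> \<noteq> 0" "hc ?A n b \<tau> \<noteq> 0" for \<tau>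
  proof -
    obtain \<gamma>' where g': "\<gamma>' \<in> invcol ?A n b \<tau>"
      using t(3) unfolding hc_def by (metis card.empty ex_in_conv of_nat_0)
    have inv: "\<gamma>' (\<tau> x) = \<gamma>' x" if "x \<in> ?A" for x using g' that by (simp add: invcol_def)
    have sizes: "card {x\<in>?A. \<gamma> x = j} = card {x\<in>?A. \<gamma>' x = j}" for j
    proof (cases "j < n")
      case True
      then show ?thesis using g' by (simp add: invcol_def colset_def b_def)
    next
      case False
      have "\<gamma>' x < n" "\<gamma> x < n" if "x \<in> ?A" for x
        using g' \<gamma>_inv that by (auto simp: invcol_def colset_def PiE_iff)
      then have "{x\<in>?A. \<gamma> x = j} = {}" "{x\<in>?A. \<gamma>' x = j} = {}" using False by auto
      then show ?thesis by (metis)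
    qed
    have \<gamma>'_img: "\<gamma>' ` ?A = {0..<R}"
    proof -
      have "j \<in> h ` ?A \<longleftrightarrow> card {x\<in>?A. h x = j} \<noteq> 0" for h :: "nat \<Rightarrow> nat" and j by auto
      then show ?thesis using sizes \<gamma>_img by (metis subsetI subset_antisym)
    qed
    \<comment> \<open>The colour of an orbit of \<open>\<tau>\<close>, read off at an arbitrary
      point of it; it is well defined since \<open>\<gamma>'\<close> is constant along
      orbits.\<close>
    define h where "h Q = \<gamma>' (SOME x. x \<in> ?A \<and> orbit \<tau> x = Q)" for Q
    have h: "h (orbit \<tau> x) = \<gamma>' x" if "x \<in> ?A" for x
    proof -
      define y where "y = (SOME y. y \<in> ?A \<and> orbit \<tau> y = orbit \<tau> x)"
      have y: "y \<in> ?A" "orbit \<tau> y = orbit \<tau> x"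
        using someI[of "\<lambda>y. y \<in> ?A \<and> orbit \<tau> y = orbit \<tau> x" x] that unfolding y_def by auto
      then have "y \<in> orbit \<tau> x" using orbit_eq_iff[OF perm[OF t(1)]] by blast
      then have "\<gamma>' y = \<gamma>' x" using inv_coloring_orbit[OF t(1) that] inv by blast
      then show ?thesis by (simp add: h_def y_def)
    qed
    have "h ` orbit \<tau> ` ?A = {0..<R}" using h \<gamma>'_img by (force simp: image_image)
    \<comment> \<open>\<open>h\<close> maps the orbits of \<open>\<tau>\<close> onto
      \<open>R\<close> colours, while maximality of \<open>R\<close> allows at most \<open>R\<close>
      orbits. So different orbits have different colours.\<close>
    then have "R \<le> card (orbit \<tau> ` ?A)" using card_image_le[of "orbit \<tau> ` ?A" h] by simp
    then have "card (h ` orbit \<tau> ` ?A) = card (orbit \<tau> ` ?A)"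
      using rR[OF t(1,2)] \<open>h ` orbit \<tau> ` ?A = {0..<R}\<close> by (simp add: r_def)
    then have inj: "inj_on h (orbit \<tau> ` ?A)" by (intro eq_card_imp_inj_on) auto
    have orb': "\<gamma>' x = \<gamma>' y \<longleftrightarrow> x \<in> orbit \<tau> y" if "x \<in> ?A" "y \<in> ?A" for x y
      using inj_on_eq_iff[OF inj, of "orbit \<tau> x" "orbit \<tau> y"] h that orbit_eq_iff[OF perm[OF t(1)], of x y]
      by simp
    obtain p where "p permutes ?A" "p \<circ> \<sigma> = \<tau> \<circ> p"
      by (rule same_orbit_sizes_conjugate[OF _ s(1) t(1) sizes \<gamma>_orb orb']) simp
    then show ?thesis using cf s(1) t(1) unfolding class_fun_def by metis
  qed
  have "0 = (\<Sum>\<tau> | \<tau> permutes ?A. g \<tau> * of_int (hc ?A n b \<tau>))" using orth by simp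
  also have "\<dots> = (\<Sum>\<tau> | \<tau> permutes ?A. g \<sigma> * (if g \<tau> \<noteq> 0 then of_int (hc ?A n b \<tau>) else 0))"
    by (rule sum.cong) (use key in force)+
  also have "\<dots> = g \<sigma> * (\<Sum>\<tau> | \<tau> permutes ?A. if g \<tau> \<noteq> 0 then of_int (hc ?A n b \<tau>) else 0)"
    by (simp add: sum_distrib_left)
  \<comment> \<open>After cancelling \<open>g \<sigma>\<close> a sum of nonnegative counts remains,
    which vanishes although the term of \<open>\<sigma>\<close> itself is positive.\<close>
  finally have z: "(\<Sum>\<tau> | \<tau> permutes ?A. if g \<tau> \<noteq> 0 then of_int (hc ?A n b \<tau>) else (0::rat)) = 0"
    using s(2) by simp
  have "hc ?A n b \<sigma> \<noteq> 0" unfolding hc_def using \<gamma>_inv finite_invcol[of ?A n b \<sigma>] by auto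
  moreover have "(if g \<sigma> \<noteq> 0 then of_int (hc ?A n b \<sigma>) else (0::rat)) = 0"
    using z by (subst (asm) sum_nonneg_eq_0_iff) (use s in \<open>auto simp: finite_permutations hc_def\<close>)
  ultimately show False using s(2) by simp
qed

text \<open>Subtracting the orthogonal projection leaves a class function orthogonal to all
  irreducible characters, hence to all Young permutation characters, hence zero.\<close>

lemma class_fun_expansion:
  assumes cf: "class_fun n f"
  obtains c where "\<And>\<sigma>. \<sigma> permutes {1..n} \<Longrightarrow> f \<sigma> = (\<Sum>la\<in>int_partitions n. c la * of_int (irr_char n la \<sigma>))"
proof -
  define c where "c la = (\<Sum>\<sigma> | \<sigma> permutes {1..n}. f \<sigma> * of_int (irr_char n la \<sigma>)) / fact n" for la
  define g where "g \<sigma> = f \<sigma> - (\<Sum>la\<in>int_partitions n. c la * of_int (irr_char n la \<sigma>))" for \<sigma>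
  have cg: "class_fun n g"
    unfolding class_fun_def g_def
  proof (intro allI impI)
    fix \<sigma> \<tau> p assume a: "\<sigma> permutes {1..n} \<and> \<tau> permutes {1..n} \<and> p permutes {1..n} \<and> p \<circ> \<sigma> = \<tau> \<circ> p"
    then have "f \<sigma> = f \<tau>" using cf unfolding class_fun_def by blast
    moreover have "rat_of_int (irr_char n la \<sigma>) = of_int (irr_char n la \<tau>)" for la
      using class_fun_irr_char[of n la] a unfolding class_fun_def by blast
    ultimately show "f \<sigma> - (\<Sum>la\<in>int_partitions n. c la * of_int (irr_char n la \<sigma>)) =
       f \<tau> - (\<Sum>la\<in>int_partitions n. c la * of_int (irr_char n la \<tau>))" by simp
  qed
  have orth: "(\<Sum>\<sigma> | \<sigma> permutes {1..n}. g \<sigma> * of_int (irr_char n mu \<sigma>)) = 0" if mu: "mu \<in> int_partitions n" for mu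
  proof -
    have "(\<Sum>\<sigma> | \<sigma> permutes {1..n}. (\<Sum>la\<in>int_partitions n. c la * of_int (irr_char n la \<sigma>)) * of_int (irr_char n mu \<sigma>))
      = (\<Sum>la\<in>int_partitions n. c la * of_int (\<Sum>\<sigma> | \<sigma> permutes {1..n}. irr_char n la \<sigma> * irr_char n mu \<sigma>))"
      unfolding sum_distrib_right of_int_sum sum_distrib_left
      by (subst sum.swap) (simp add: mult_ac)
    also have "\<dots> = (\<Sum>la\<in>int_partitions n. if la = mu then c mu * fact n else 0)"
      by (intro sum.cong refl) (simp only: irr_char_orthonormal[OF _ mu], simp)
    also have "\<dots> = c mu * fact n" using mu finite_int_partitions by simp
    also have "\<dots> = (\<Sum>\<sigma> | \<sigma> permutes {1..n}. f \<sigma> * of_int (irr_char n mu \<sigma>))" by (simp add: c_def)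
    finally show ?thesis unfolding g_def by (simp add: left_diff_distrib sum_subtractf)
  qed
  have "g \<sigma> = 0" if "\<sigma> permutes {1..n}" for \<sigma>
    by (rule orth_hc_imp_zero[OF cg _ that], rule orth_irr_imp_orth_hc[OF orth])
  then show ?thesis using that[of c] by (simp add: g_def)
qed

section \<open>Stable families\<close>

text \<open>A class function of the symmetric group on \<open>m\<close> points, spread consistently
  over all \<open>m\<close>-element sets; this expresses that it does not depend on the ambient
  \<open>n\<close>. The condition is \<open>bij_betw \<sigma> A A\<close> rather than
  \<open>permutes\<close>, because in use \<open>\<sigma>\<close> permutes \<open>{1..n}\<close> and
  merely maps \<open>A\<close> to itself.\<close>

definition natural :: "nat \<Rightarrow> (nat set \<Rightarrow> (nat \<Rightarrow> nat) \<Rightarrow> rat) \<Rightarrow> bool" where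
  "natural m \<psi> \<longleftrightarrow> (\<forall>A B \<phi> \<sigma> \<tau>. finite A \<and> card A = m \<and> bij_betw \<sigma> A A \<and> bij_betw \<phi> A B \<and>
      (\<forall>x\<in>A. \<phi> (\<sigma> x) = \<tau> (\<phi> x)) \<longrightarrow> \<psi> A \<sigma> = \<psi> B \<tau>)"

lemma naturalD:
  assumes "natural m \<psi>" "finite A" "card A = m" "bij_betw \<sigma> A A" "bij_betw \<phi> A B"
    "\<And>x. x \<in> A \<Longrightarrow> \<phi> (\<sigma> x) = \<tau> (\<phi> x)"
  shows "\<psi> A \<sigma> = \<psi> B \<tau>"
  using assms unfolding natural_def by blast

lemma natural_hc: "natural m (\<lambda>A \<sigma>. of_int (hc A L b \<sigma>))"
  unfolding natural_def
proof (intro allI impI, elim conjE)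
  fix A B :: "nat set" and \<phi> \<sigma> \<tau> :: "nat \<Rightarrow> nat"
  assume "finite A" "bij_betw \<sigma> A A" "bij_betw \<phi> A B" "\<forall>x\<in>A. \<phi> (\<sigma> x) = \<tau> (\<phi> x)"
  then have "hc A L b \<sigma> = hc B L b \<tau>"
    by (intro hc_natural) (auto simp: bij_betw_def)
  then show "rat_of_int (hc A L b \<sigma>) = of_int (hc B L b \<tau>)" by simp
qed

text \<open>The coefficients are computed once on \<open>{1..m}\<close>. An arbitrary
  \<open>A\<close> is carried there by a bijection, under which both sides are invariant, so the
  same \<open>c\<close> works for all \<open>A\<close>.\<close>

lemma natural_expansion:
  assumes nat: "natural m \<psi>"
  obtains c where "\<And>A \<sigma>. finite A \<Longrightarrow> card A = m \<Longrightarrow> bij_betw \<sigma> A A \<Longrightarrow>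
    \<psi> A \<sigma> = (\<Sum>\<nu>\<in>int_partitions m. c \<nu> * of_int (chi A m (\<lambda>j. int (part_nth \<nu> j)) \<sigma>))"
proof -
  have "class_fun m (\<psi> {1..m})"
    unfolding class_fun_def
  proof (intro allI impI, elim conjE)
    fix \<sigma> \<tau> p assume a: "\<sigma> permutes {1..m}" "\<tau> permutes {1..m}" "p permutes {1..m}" "p \<circ> \<sigma> = \<tau> \<circ> p"
    show "\<psi> {1..m} \<sigma> = \<psi> {1..m} \<tau>"
    proof (rule naturalD[OF nat])
      show "p (\<sigma> x) = \<tau> (p x)" for x using a(4) by (metis o_apply)
    qed (use a permutes_imp_bij in auto)
  qed
  from class_fun_expansion[OF this] obtain c where c: "\<And>\<sigma>. \<sigma> permutes {1..m} \<Longrightarrow>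
    \<psi> {1..m} \<sigma> = (\<Sum>la\<in>int_partitions m. c la * of_int (irr_char m la \<sigma>))" by blast
  show ?thesis
  proof (rule that[of c])
    fix A and \<sigma> :: "nat \<Rightarrow> nat" assume A: "finite A" "card A = m" "bij_betw \<sigma> A A"
    obtain \<phi> where \<phi>: "bij_betw \<phi> A {1..m}"
      using finite_same_card_bij[of A "{1..m}"] A by auto
    define \<tau> where "\<tau> = map_permutation A \<phi> \<sigma>"
    have "\<tau> permutes {1..m}"
    proof (rule bij_imp_permutes)
      have \<phi>A: "\<phi> ` A = {1..m}" using \<phi> by (simp add: bij_betw_def)
      have "bij_betw (\<phi> \<circ> (\<sigma> \<circ> inv_into A \<phi>)) {1..m} {1..m}"
        by (rule bij_betw_trans[OF bij_betw_trans[OF bij_betw_inv_into[OF \<phi>] A(3)] \<phi>])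
      then show "bij_betw \<tau> {1..m} {1..m}" unfolding \<tau>_def map_permutation_def \<phi>A
        by (intro bij_betw_restrict_id) (simp_all only: comp_assoc order.refl)
      show "\<tau> x = x" if "x \<notin> {1..m}" for x
        using that \<phi>A unfolding \<tau>_def map_permutation_def by simp
    qed
    have comm: "\<phi> (\<sigma> x) = \<tau> (\<phi> x)" if "x \<in> A" for x
      unfolding \<tau>_def using map_permutation_apply[OF bij_betw_imp_inj_on[OF \<phi>] that] by simp
    have "\<psi> A \<sigma> = \<psi> {1..m} \<tau>" by (rule naturalD[OF nat]) (use A \<phi> comm in auto)
    also have "\<dots> = (\<Sum>\<nu>\<in>int_partitions m. c \<nu> * of_int (chi {1..m} m (\<lambda>j. int (part_nth \<nu> j)) \<tau>))"
      using c[OF \<open>\<tau> permutes {1..m}\<close>] by (simp add: irr_char_eq_chi)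
    also have "\<dots> = (\<Sum>\<nu>\<in>int_partitions m. c \<nu> * of_int (chi A m (\<lambda>j. int (part_nth \<nu> j)) \<sigma>))"
    proof -
      have "chi A m u \<sigma> = chi {1..m} m u \<tau>" for u
        by (rule chi_natural) (use A \<phi> comm in \<open>auto simp: bij_betw_def\<close>)
      then show ?thesis by simp
    qed
    finally show "\<psi> A \<sigma> = (\<Sum>\<nu>\<in>int_partitions m. c \<nu> * of_int (chi A m (\<lambda>j. int (part_nth \<nu> j)) \<sigma>))" .
  qed
qed

text \<open>The formula for an induced character as a sum over fixed cosets, the cosets of the
  subgroup permuting \<open>m\<close> points and the other \<open>n - m\<close> points separately
  being identified with the \<open>m\<close>-subsets.\<close>

definition Ind :: "nat \<Rightarrow> (nat set \<Rightarrow> (nat \<Rightarrow> nat) \<Rightarrow> rat) \<Rightarrow> nat \<Rightarrow> (nat \<Rightarrow> nat) \<Rightarrow> rat" where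
  "Ind m \<psi> n \<sigma> = (\<Sum>A | A \<subseteq> {1..n} \<and> card A = m \<and> \<sigma> ` A = A. \<psi> A \<sigma>)"

lemma Ind_linear: "Ind m (\<lambda>A \<sigma>. \<Sum>i\<in>I. a i * f i A \<sigma>) n \<sigma> = (\<Sum>i\<in>I. a i * Ind m (f i) n \<sigma>)"
  unfolding Ind_def sum_distrib_left by (rule sum.swap)

text \<open>The complement of \<open>A\<close> is painted with a new colour 0 and the old colours
  move up by one. Conversely \<open>A\<close> is recovered as the set of points not coloured
  0.\<close>

lemma Ind_hc:
  assumes mn: "m \<le> n" and s: "\<sigma> permutes {1..n}"
  shows "Ind m (\<lambda>A \<sigma>. of_int (hc A L b \<sigma>)) n \<sigma> =
    of_int (hc {1..n} (Suc L) (case_nat (int (n - m)) b) \<sigma>)"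
proof -
  let ?N = "{1..n}"
  let ?b = "case_nat (int (n - m)) b"
  let ?S = "{A. A \<subseteq> ?N \<and> card A = m \<and> \<sigma> ` A = A}"
  define F where "F = (\<lambda>(A, g). \<lambda>x\<in>?N. if x \<in> A then Suc (g x) else (0::nat))"
  define supp where "supp g = {x\<in>?N. g x \<noteq> 0}" for g :: "nat \<Rightarrow> nat"
  define G where "G g = (supp g, \<lambda>x\<in>supp g. g x - 1)" for g :: "nat \<Rightarrow> nat"
  have fin: "finite ?S" by (rule finite_subset[of _ "Pow ?N"]) (blast, simp)
  have h1: "\<forall>a\<in>SIGMA A:?S. invcol A L b \<sigma>. G (F a) = a"
  proof
    fix a assume "a \<in> (SIGMA A:?S. invcol A L b \<sigma>)"
    then obtain A g where a: "a = (A, g)" "A \<subseteq> ?N" "g \<in> invcol A L b \<sigma>" by blast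
    have "supp (F a) = A" using a by (auto simp: supp_def F_def)
    then show "G (F a) = a"
      using a by (auto simp: G_def F_def invcol_def colset_def PiE_iff extensional_def fun_eq_iff)
  qed
  have h2: "\<forall>g\<in>invcol ?N (Suc L) ?b \<sigma>. F (G g) = g"
    by (auto simp: G_def F_def supp_def invcol_def colset_def PiE_iff extensional_def fun_eq_iff)
  have h3: "F ` (SIGMA A:?S. invcol A L b \<sigma>) \<subseteq> invcol ?N (Suc L) ?b \<sigma>"
  proof (rule image_subsetI)
    fix a assume "a \<in> (SIGMA A:?S. invcol A L b \<sigma>)"
    then obtain A g where a: "a = (A, g)" "A \<subseteq> ?N" "card A = m" "\<sigma> ` A = A" "g \<in> invcol A L b \<sigma>" by blast
    have gL: "g x < L" if "x \<in> A" for x using a(5) that by (auto simp: invcol_def colset_def PiE_iff)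
    have "F a \<in> ?N \<rightarrow>\<^sub>E {0..<Suc L}" using gL by (auto simp: F_def a(1))
    moreover have "int (card {x\<in>?N. F a x = j}) = ?b j" if j: "j < Suc L" for j
    proof (cases j)
      case 0
      have "{x\<in>?N. F a x = 0} = ?N - A" by (auto simp: F_def a(1))
      then have "card {x\<in>?N. F a x = 0} = n - m" using a by (simp add: card_Diff_subset finite_subset)
      then show ?thesis using 0 by simp
    next
      case (Suc i)
      have "{x\<in>?N. F a x = Suc i} = {x\<in>A. g x = i}" using a(2) by (auto simp: F_def a(1))
      then show ?thesis using a(5) Suc j by (simp add: invcol_def colset_def)
    qed
    moreover have "F a (\<sigma> x) = F a x" if "x \<in> ?N" for x
    proof -
      have "\<sigma> x \<in> ?N" using that permutes_in_image[OF s] by blast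
      moreover have "\<sigma> x \<in> A \<longleftrightarrow> x \<in> A" using a(4) permutes_inj[OF s] by (metis inj_image_mem_iff)
      ultimately show ?thesis using that a(5) by (auto simp: F_def a(1) invcol_def)
    qed
    ultimately show "F a \<in> invcol ?N (Suc L) ?b \<sigma>" by (auto simp: invcol_def colset_def)
  qed
  have h4: "G ` invcol ?N (Suc L) ?b \<sigma> \<subseteq> (SIGMA A:?S. invcol A L b \<sigma>)"
  proof (rule image_subsetI)
    fix g assume g: "g \<in> invcol ?N (Suc L) ?b \<sigma>"
    have gL: "g x < Suc L" if "x \<in> ?N" for x using g that by (auto simp: invcol_def colset_def PiE_iff)
    have gs: "g (\<sigma> x) = g x" if "x \<in> ?N" for x using g that by (auto simp: invcol_def)
    have cnt: "int (card {x\<in>?N. g x = j}) = ?b j" if "j < Suc L" for j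
      using g that by (auto simp: invcol_def colset_def)
    have supp_sub: "supp g \<subseteq> ?N" by (auto simp: supp_def)
    have card_supp: "card (supp g) = m"
    proof -
      have "supp g = ?N - {x\<in>?N. g x = 0}" by (auto simp: supp_def)
      moreover have "card (?N - {x\<in>?N. g x = 0}) = card ?N - card {x\<in>?N. g x = 0}"
        by (rule card_Diff_subset) auto
      moreover have "card {x\<in>?N. g x = 0} = n - m" using cnt[of 0] by simp
      ultimately have "card (supp g) = n - (n - m)" by (simp only: card_atLeastAtMost diff_Suc_1)
      then show ?thesis using mn by simp
    qed
    have sub: "\<sigma> ` supp g \<subseteq> supp g"
      
    proof (rule image_subsetI)
      fix x assume "x \<in> supp g"
      then have "x \<in> ?N" "g x \<noteq> 0" by (simp_all add: supp_def)
      moreover have "\<sigma> x \<in> ?N" using \<open>x \<in> ?N\<close> permutes_in_image[OF s] by blast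
      ultimately show "\<sigma> x \<in> supp g" using gs[of x] by (simp add: supp_def)
    qed
    have "\<sigma> ` supp g = supp g"
    proof (rule card_subset_eq[OF _ sub])
      show "card (\<sigma> ` supp g) = card (supp g)"
        by (rule card_image, rule inj_on_subset[OF permutes_inj[OF s]]) simp
    qed (simp add: supp_def)
    moreover have "(\<lambda>x\<in>supp g. g x - 1) \<in> invcol (supp g) L b \<sigma>"
    proof -
      let ?h = "\<lambda>x\<in>supp g. g x - 1"
      have "?h \<in> supp g \<rightarrow>\<^sub>E {0..<L}"
      proof (rule PiE_I)
        fix x assume "x \<in> supp g"
        then show "?h x \<in> {0..<L}" using gL[of x] by (auto simp: supp_def)
      qed simp
      moreover have "\<forall>j<L. int (card {x\<in>supp g. ?h x = j}) = b j"
      proof (intro allI impI)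
        fix j assume j: "j < L"
        have "{x\<in>supp g. ?h x = j} = {x\<in>?N. g x = Suc j}" by (auto simp: supp_def)
        then show "int (card {x\<in>supp g. ?h x = j}) = b j" using cnt[of "Suc j"] j by simp
      qed
      moreover have "\<forall>x\<in>supp g. ?h (\<sigma> x) = ?h x"
      proof
        fix x assume x: "x \<in> supp g"
        have "\<sigma> x \<in> supp g" using sub x by blast
        moreover have "x \<in> ?N" using x by (simp add: supp_def)
        ultimately show "?h (\<sigma> x) = ?h x" using x gs[of x] by simp
      qed
      ultimately show ?thesis unfolding invcol_def colset_def by (intro CollectI conjI)
    qed
    ultimately show "G g \<in> (SIGMA A:?S. invcol A L b \<sigma>)"
      unfolding G_def by (intro SigmaI CollectI conjI supp_sub card_supp)
  qed
  have "bij_betw F (SIGMA A:?S. invcol A L b \<sigma>) (invcol ?N (Suc L) ?b \<sigma>)"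
    by (rule bij_betw_byWitness[OF h1 h2 h3 h4])
  from bij_betw_same_card[OF this]
  have "card (invcol ?N (Suc L) ?b \<sigma>) = (\<Sum>A\<in>?S. card (invcol A L b \<sigma>))"
    using fin by (simp add: card_SigmaI finite_invcol finite_subset[of _ ?N])
  then show ?thesis by (simp add: Ind_def hc_def)
qed

section \<open>Determinants with a long first row\<close>

lemma hc_drop_color:
  assumes "finite A" "b L = 0" shows "hc A (Suc L) b \<sigma> = hc A L b \<sigma>"
proof -
  have "colset A (Suc L) b = colset A L b"
  proof
    show "colset A (Suc L) b \<subseteq> colset A L b"
    proof
      fix g assume g: "g \<in> colset A (Suc L) b"
      have "int (card {x\<in>A. g x = L}) = 0" using g assms(2) by (simp add: colset_def)
      then have "{x\<in>A. g x = L} = {}" using assms(1) by auto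
      then have "g x \<noteq> L" if "x \<in> A" for x using that by blast
      then show "g \<in> colset A L b" using g by (auto simp: colset_def PiE_iff less_Suc_eq)
    qed
    show "colset A L b \<subseteq> colset A (Suc L) b"
    proof
      fix g assume g: "g \<in> colset A L b"
      then have "{x\<in>A. g x = L} = {}" by (auto simp: colset_def PiE_iff)
      then have "card {x\<in>A. g x = L} = 0" by (metis card.empty)
      then show "g \<in> colset A (Suc L) b" using g assms(2) by (auto simp: colset_def PiE_iff less_Suc_eq)
    qed
  qed
  then show ?thesis by (simp add: hc_def invcol_def)
qed

lemma chi_drop_zero:
  assumes "finite A" "u L = 0" shows "chi A (Suc L) u \<sigma> = chi A L u \<sigma>"
proof -
  have "chi A (Suc L) u \<sigma> = (\<Sum>w | w permutes {0..<L}. sign w * hc A (Suc L) (\<lambda>j. u j + int (w j) - int j) \<sigma>)"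
    unfolding chi_def
  proof (rule sum.mono_neutral_right)
    show "{w. w permutes {0..<L}} \<subseteq> {w. w permutes {0..<Suc L}}"
      using permutes_subset[of _ "{0..<L}" "{0..<Suc L}"] by auto
    show "\<forall>w\<in>{w. w permutes {0..<Suc L}} - {w. w permutes {0..<L}}. sign w * hc A (Suc L) (\<lambda>j. u j + int (w j) - int j) \<sigma> = 0"
    proof
      fix w assume w: "w \<in> {w. w permutes {0..<Suc L}} - {w. w permutes {0..<L}}"
      have "w L \<noteq> L"
      proof
        assume "w L = L"
        then have "w permutes {0..<L}" using w by - (rule permutes_superset[of w "{0..<Suc L}"], auto simp: less_Suc_eq)
        then show False using w by simp
      qed
      moreover have "w L < Suc L" using w permutes_in_image[of w "{0..<Suc L}" L] by simp
      ultimately have "u L + int (w L) - int L < 0" using assms(2) by simp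
      then show "sign w * hc A (Suc L) (\<lambda>j. u j + int (w j) - int j) \<sigma> = 0" by (simp add: hc_neg[of L])
    qed
  qed (simp add: finite_permutations)
  also have "\<dots> = chi A L u \<sigma>"
    unfolding chi_def
  proof (intro sum.cong refl arg_cong2[where f="(*)"])
    fix w assume "w \<in> {w. w permutes {0..<L}}"
    then have "w L = L" by (auto intro: permutes_not_in)
    then show "hc A (Suc L) (\<lambda>j. u j + int (w j) - int j) \<sigma> = hc A L (\<lambda>j. u j + int (w j) - int j) \<sigma>"
      using assms by (intro hc_drop_color) auto
  qed
  finally show ?thesis .
qed

lemma chi_drop_zeros:
  assumes "finite A" "L \<le> n" "\<And>j. L \<le> j \<Longrightarrow> j < n \<Longrightarrow> u j = 0"
  shows "chi A n u \<sigma> = chi A L u \<sigma>"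
  using assms(2,3)
proof (induction n)
  case (Suc n)
  show ?case
  proof (cases "L = Suc n")
    case False
    then have "chi A n u \<sigma> = chi A L u \<sigma>" using Suc by simp
    moreover have "chi A (Suc n) u \<sigma> = chi A n u \<sigma>"
      using Suc.prems False assms(1) by (intro chi_drop_zero) auto
    ultimately show ?thesis by simp
  qed simp
qed simp

text \<open>A partition of \<open>m\<close> has at most \<open>m\<close> parts, so the determinant
  shrinks to size \<open>Suc m\<close>, independent of \<open>n\<close>. Colour 0 then has content
  \<open>n - (m - w 0)\<close>, and \<open>Ind_hc\<close> reads the term as induced from subsets of
  size \<open>m - w 0\<close>. Only the large first entry involves \<open>n\<close>.\<close>

lemma irr_char_cons_expand:
  assumes "\<nu> \<in> int_partitions m" "m \<le> n" "0 < n" "m < n" and s: "\<sigma> permutes {1..n}"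
  shows "rat_of_int (irr_char n ((n - m) # \<nu>) \<sigma>) = (\<Sum>w | w permutes {0..<Suc m}. of_int (sign w) *
    Ind (m - w 0) (\<lambda>A \<sigma>. of_int (hc A m (\<lambda>j. int (part_nth \<nu> j) + int (w (Suc j)) - int (Suc j)) \<sigma>)) n \<sigma>)"
proof -
  let ?u = "\<lambda>j. int (part_nth ((n - m) # \<nu>) j)"
  have "irr_char n ((n - m) # \<nu>) \<sigma> = chi {1..n} (Suc m) ?u \<sigma>"
    unfolding irr_char_eq_chi
    by (rule chi_drop_zeros) (use assms int_partitions_length[OF assms(1)] in \<open>auto simp: part_nth_def\<close>)
  then have "rat_of_int (irr_char n ((n - m) # \<nu>) \<sigma>) =
     (\<Sum>w | w permutes {0..<Suc m}. of_int (sign w) * of_int (hc {1..n} (Suc m) (\<lambda>j. ?u j + int (w j) - int j) \<sigma>))"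
    by (simp add: chi_def)
  also have "\<dots> = (\<Sum>w | w permutes {0..<Suc m}. of_int (sign w) *
    Ind (m - w 0) (\<lambda>A \<sigma>. of_int (hc A m (\<lambda>j. int (part_nth \<nu> j) + int (w (Suc j)) - int (Suc j)) \<sigma>)) n \<sigma>)"
  proof (intro sum.cong refl arg_cong2[where f="(*)"])
    fix w assume w: "w \<in> {w. w permutes {0..<Suc m}}"
    have "w 0 < Suc m" using w permutes_in_image[of w "{0..<Suc m}" 0] by simp
    then have eq: "(\<lambda>j. ?u j + int (w j) - int j) = case_nat (int (n - (m - w 0)))
        (\<lambda>j. int (part_nth \<nu> j) + int (w (Suc j)) - int (Suc j))"
      using assms(2) by (auto simp: fun_eq_iff part_nth_def of_nat_diff split: nat.split)
    show "rat_of_int (hc {1..n} (Suc m) (\<lambda>j. ?u j + int (w j) - int j) \<sigma>) =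
      Ind (m - w 0) (\<lambda>A \<sigma>. of_int (hc A m (\<lambda>j. int (part_nth \<nu> j) + int (w (Suc j)) - int (Suc j)) \<sigma>)) n \<sigma>"
      unfolding eq by (rule Ind_hc[symmetric]) (use assms in auto)
  qed
  finally show ?thesis .
qed

lemma permutes_Suc_image:
  "bij_betw (map_permutation {0..<m} Suc) {w. w permutes {0..<m}} {w. w permutes {0..<Suc m} \<and> w 0 = 0}"
proof -
  have bij: "bij_betw Suc {0..<m} {1..<Suc m}"
    by (auto simp: bij_betw_def image_Suc_atLeastLessThan)
  have bij': "bij_betw (\<lambda>x. x - 1) {1..<Suc m} {0..<m}"
    by (rule bij_betw_byWitness[where f'=Suc]) auto
  have eq: "{w. w permutes {0..<Suc m} \<and> w 0 = 0} = {w. w permutes {1..<Suc m}}"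
  proof (intro Collect_cong iffI)
    fix w assume "w permutes {0..<Suc m} \<and> w 0 = 0"
    then show "w permutes {1..<Suc m}" by - (rule permutes_superset[of w "{0..<Suc m}"], auto simp: not_le less_Suc_eq_0_disj)
  next
    fix w assume w: "w permutes {1..<Suc m}"
    then show "w permutes {0..<Suc m} \<and> w 0 = 0"
      using permutes_subset[OF w, of "{0..<Suc m}"] permutes_not_in[OF w, of 0] by auto
  qed
  show ?thesis unfolding eq
  proof (rule bij_betw_byWitness[where f'="map_permutation {1..<Suc m} (\<lambda>x. x - 1)"])
    show "\<forall>a\<in>{w. w permutes {0..<m}}. map_permutation {1..<Suc m} (\<lambda>x. x - 1) (map_permutation {0..<m} Suc a) = a"
      using map_permutation_compose_inv[OF bij] by simp
    show "\<forall>a\<in>{w. w permutes {1..<Suc m}}. map_permutation {0..<m} Suc (map_permutation {1..<Suc m} (\<lambda>x. x - 1) a) = a"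
      using map_permutation_compose_inv[OF bij'] by simp
  qed (use map_permutation_permutes[OF bij] map_permutation_permutes[OF bij'] in auto)
qed

text \<open>Permutations fixing 0 are permutations of the remaining indices shifted by
  \<open>Suc\<close>, with the same sign. Their terms make up the minor of the first diagonal entry,
  which is the determinant of \<open>\<nu>\<close>.\<close>

lemma Ind_chi_eq:
  "Ind m (\<lambda>A \<sigma>. of_int (chi A m (\<lambda>j. int (part_nth \<nu> j)) \<sigma>)) n \<sigma> =
    (\<Sum>w | w permutes {0..<Suc m} \<and> w 0 = 0. of_int (sign w) *
    Ind (m - w 0) (\<lambda>A \<sigma>. of_int (hc A m (\<lambda>j. int (part_nth \<nu> j) + int (w (Suc j)) - int (Suc j)) \<sigma>)) n \<sigma>)"
proof -
  have "(\<Sum>w | w permutes {0..<Suc m} \<and> w 0 = 0. of_int (sign w) *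
      Ind (m - w 0) (\<lambda>A \<sigma>. of_int (hc A m (\<lambda>j. int (part_nth \<nu> j) + int (w (Suc j)) - int (Suc j)) \<sigma>)) n \<sigma>) =
    (\<Sum>w | w permutes {0..<m}. of_int (sign w) *
      Ind m (\<lambda>A \<sigma>. of_int (hc A m (\<lambda>j. int (part_nth \<nu> j) + int (w j) - int j) \<sigma>)) n \<sigma>)"
  proof (subst sum.reindex_bij_betw[OF permutes_Suc_image, symmetric], intro sum.cong refl)
    fix w assume "w \<in> {w. w permutes {0..<m}}"
    then have w: "w permutes {0..<m}" by simp
    let ?w = "map_permutation {0..<m} Suc w"
    have "sign ?w = sign w" by (rule sign_map_permutation) (use w in auto)
    moreover have "?w 0 = 0" unfolding map_permutation_def by (rule restrict_id_simps) auto
    moreover have "hc A m (\<lambda>j. int (part_nth \<nu> j) + int (?w (Suc j)) - int (Suc j)) \<tau> =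
        hc A m (\<lambda>j. int (part_nth \<nu> j) + int (w j) - int j) \<tau>" for A \<tau>
      by (rule hc_cong) (auto simp: map_permutation_apply)
    ultimately show "of_int (sign ?w) *
      Ind (m - ?w 0) (\<lambda>A \<sigma>. of_int (hc A m (\<lambda>j. int (part_nth \<nu> j) + int (?w (Suc j)) - int (Suc j)) \<sigma>)) n \<sigma> =
      of_int (sign w) *
      Ind m (\<lambda>A \<sigma>. of_int (hc A m (\<lambda>j. int (part_nth \<nu> j) + int (w j) - int j) \<sigma>)) n \<sigma>" by simp
  qed
  also have "\<dots> = Ind m (\<lambda>A \<sigma>. \<Sum>w | w permutes {0..<m}. of_int (sign w) *
      of_int (hc A m (\<lambda>j. int (part_nth \<nu> j) + int (w j) - int j) \<sigma>)) n \<sigma>"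
    by (rule Ind_linear[symmetric])
  finally show ?thesis unfolding chi_def by simp
qed

text \<open>The coefficients are only asserted to exist. This makes stability closed under linear
  combinations; that they are the inner products used in \<open>char_plus\<close> follows once at
  the end from orthonormality.\<close>

definition stable :: "nat \<Rightarrow> (nat \<Rightarrow> (nat \<Rightarrow> nat) \<Rightarrow> rat) \<Rightarrow> bool" where
  "stable n0 F \<longleftrightarrow> (\<exists>c. \<forall>n\<ge>n0. \<forall>\<sigma>. \<sigma> permutes {1..n} \<longrightarrow>
     F n \<sigma> = (\<Sum>la\<in>int_partitions n0. c la * of_int (irr_char n (part_plus la (n - n0)) \<sigma>)))"

lemma stable_cong:
  assumes "stable n0 F" "\<And>n \<sigma>. n0 \<le> n \<Longrightarrow> \<sigma> permutes {1..n} \<Longrightarrow> G n \<sigma> = F n \<sigma>"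
  shows "stable n0 G"
  using assms unfolding stable_def by metis

lemma stable_lincomb:
  assumes "\<And>i. i \<in> I \<Longrightarrow> stable n0 (F i)"
  shows "stable n0 (\<lambda>n \<sigma>. \<Sum>i\<in>I. a i * F i n \<sigma>)"
proof -
  from assms have "\<forall>i\<in>I. \<exists>c. \<forall>n\<ge>n0. \<forall>\<sigma>. \<sigma> permutes {1..n} \<longrightarrow>
     F i n \<sigma> = (\<Sum>la\<in>int_partitions n0. c la * of_int (irr_char n (part_plus la (n - n0)) \<sigma>))"
    unfolding stable_def by blast
  from bchoice[OF this] obtain c where c: "\<And>i n \<sigma>. i \<in> I \<Longrightarrow> n0 \<le> n \<Longrightarrow> \<sigma> permutes {1..n} \<Longrightarrow>
     F i n \<sigma> = (\<Sum>la\<in>int_partitions n0. c i la * of_int (irr_char n (part_plus la (n - n0)) \<sigma>))"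
    by blast
  show ?thesis unfolding stable_def
  proof (intro exI[of _ "\<lambda>la. \<Sum>i\<in>I. a i * c i la"] allI impI)
    fix n \<sigma> assume "n0 \<le> n" "\<sigma> permutes {1..n}"
    then have "(\<Sum>i\<in>I. a i * F i n \<sigma>) = (\<Sum>i\<in>I. \<Sum>la\<in>int_partitions n0. a i * c i la * of_int (irr_char n (part_plus la (n - n0)) \<sigma>))"
      by (intro sum.cong refl) (simp add: c sum_distrib_left mult.assoc)
    then show "(\<Sum>i\<in>I. a i * F i n \<sigma>) = (\<Sum>la\<in>int_partitions n0. (\<Sum>i\<in>I. a i * c i la) * of_int (irr_char n (part_plus la (n - n0)) \<sigma>))"
      unfolding sum_distrib_right by (subst (asm) sum.swap)
  qed
qed

lemma stable_diff:
  assumes "stable n0 F" "stable n0 G" shows "stable n0 (\<lambda>n \<sigma>. F n \<sigma> - G n \<sigma>)"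
proof -
  have "stable n0 (\<lambda>n \<sigma>. \<Sum>i\<in>(UNIV::bool set). (if i then 1 else -1) * (if i then F else G) n \<sigma>)"
    by (rule stable_lincomb) (use assms in auto)
  then show ?thesis by (rule stable_cong) (simp add: UNIV_bool)
qed

text \<open>The family consists of the extensions of one shape of size \<open>n0\<close>. From
  \<open>2 * m \<le> n0\<close> its first row is at least every part of \<open>\<nu>\<close>, and
  \<open>0 < n0\<close> makes this row nonempty also when \<open>m = 0\<close>.\<close>

lemma stable_irr_char:
  assumes "\<nu> \<in> int_partitions m" "2 * m \<le> n0" "0 < n0"
  shows "stable n0 (\<lambda>n \<sigma>. of_int (irr_char n ((n - m) # \<nu>) \<sigma>))"
proof -
  let ?la = "(n0 - m) # \<nu>"
  have "x \<le> m" if "x \<in> set \<nu>" for x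
    using that assms(1) member_le_sum_list[of x \<nu>] by (simp add: int_partitions_def)
  then have "\<forall>x\<in>set \<nu>. x \<le> n0 - m" using assms(2) by fastforce
  then have la: "?la \<in> int_partitions n0"
    using assms by (auto simp: int_partitions_def sorted_append)
  show ?thesis unfolding stable_def
  proof (intro exI[of _ "\<lambda>la. if la = ?la then 1 else 0"] allI impI)
    fix n \<sigma> assume n: "n0 \<le> n"
    have "(\<Sum>la\<in>int_partitions n0. (if la = ?la then 1 else 0) * rat_of_int (irr_char n (part_plus la (n - n0)) \<sigma>)) =
       of_int (irr_char n (part_plus ?la (n - n0)) \<sigma>)"
      using la finite_int_partitions by (simp add: if_distrib[of "\<lambda>x. x * _"] sum.delta cong: if_cong)
    moreover have "part_plus ?la (n - n0) = (n - m) # \<nu>" using n assms(2) by (simp add: part_plus_def)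
    ultimately show "rat_of_int (irr_char n ((n - m) # \<nu>) \<sigma>) =
      (\<Sum>la\<in>int_partitions n0. (if la = ?la then 1 else 0) * rat_of_int (irr_char n (part_plus la (n - n0)) \<sigma>))" by simp
  qed
qed

text \<open>Expanding the Jacobi--Trudi determinant of \<open>(n - m, \<nu>)\<close> along its first row, the terms with \<open>w 0 = 0\<close>
  give the induced character of \<open>\<chi>\<^sup>\<nu>\<close>, and the others are induced from smaller subsets.\<close>
lemma stable_Ind:
  assumes "natural m \<psi>" "2 * m \<le> n0" "0 < n0"
  shows "stable n0 (Ind m \<psi>)"
  using assms(1,2)
proof (induction m arbitrary: \<psi> rule: less_induct)
  case (less m)
  obtain c where c: "\<And>A \<sigma>. finite A \<Longrightarrow> card A = m \<Longrightarrow> bij_betw \<sigma> A A \<Longrightarrow>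
    \<psi> A \<sigma> = (\<Sum>\<nu>\<in>int_partitions m. c \<nu> * of_int (chi A m (\<lambda>j. int (part_nth \<nu> j)) \<sigma>))"
    using natural_expansion[OF less.prems(1)] by blast
  have st: "stable n0 (Ind m (\<lambda>A \<sigma>. of_int (chi A m (\<lambda>j. int (part_nth \<nu> j)) \<sigma>)))"
    if nu: "\<nu> \<in> int_partitions m" for \<nu>
  proof -
    define T where "T w n \<sigma> = Ind (m - w 0) (\<lambda>A \<sigma>. of_int (hc A m (\<lambda>j. int (part_nth \<nu> j) + int (w (Suc j)) - int (Suc j)) \<sigma>)) n \<sigma>"
      for w :: "nat \<Rightarrow> nat" and n \<sigma>
    let ?I = "Ind m (\<lambda>A \<sigma>. of_int (chi A m (\<lambda>j. int (part_nth \<nu> j)) \<sigma>))"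
    let ?W = "{w. w permutes {0..<Suc m}}" and ?Z = "{w. w permutes {0..<Suc m} \<and> w 0 = 0}"
    have "stable n0 (\<lambda>n \<sigma>. \<Sum>w\<in>?W - ?Z. of_int (sign w) * T w n \<sigma>)"
    proof (rule stable_lincomb)
      fix w assume "w \<in> ?W - ?Z"
      then have "w 0 \<noteq> 0" "w 0 < Suc m" using permutes_in_image[of w "{0..<Suc m}" 0] by auto
      \<comment> \<open>The contents inside \<open>T w\<close> need not come from any partition; the
        induction hypothesis covers them because it ranges over all natural functions on sets of
        size \<open>m - w 0 < m\<close>.\<close>
      then show "stable n0 (T w)" unfolding T_def
        using less.prems(2) by (intro less.IH natural_hc) auto
    qed
    from stable_diff[OF stable_irr_char[OF nu less.prems(2) assms(3)] this]
    show ?thesis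
    proof (rule stable_cong)
      fix n \<sigma> assume n: "n0 \<le> n" "\<sigma> permutes {1..n}"
      have "rat_of_int (irr_char n ((n - m) # \<nu>) \<sigma>) = (\<Sum>w\<in>?W. of_int (sign w) * T w n \<sigma>)"
        unfolding T_def by (rule irr_char_cons_expand) (use nu less.prems(2) assms(3) n in auto)
      also have "\<dots> = (\<Sum>w\<in>?Z. of_int (sign w) * T w n \<sigma>) + (\<Sum>w\<in>?W - ?Z. of_int (sign w) * T w n \<sigma>)"
        by (subst add.commute, rule sum.subset_diff) (auto simp: finite_permutations)
      finally have "rat_of_int (irr_char n ((n - m) # \<nu>) \<sigma>) =
        (\<Sum>w\<in>?Z. of_int (sign w) * T w n \<sigma>) + (\<Sum>w\<in>?W - ?Z. of_int (sign w) * T w n \<sigma>)" .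
      moreover have "?I n \<sigma> = (\<Sum>w\<in>?Z. of_int (sign w) * T w n \<sigma>)"
        unfolding T_def by (rule Ind_chi_eq)
      ultimately show "?I n \<sigma> = rat_of_int (irr_char n ((n - m) # \<nu>) \<sigma>) - (\<Sum>w\<in>?W - ?Z. of_int (sign w) * T w n \<sigma>)"
        by simp
    qed
  qed
  have "stable n0 (\<lambda>n \<sigma>. \<Sum>\<nu>\<in>int_partitions m. c \<nu> * Ind m (\<lambda>A \<sigma>. of_int (chi A m (\<lambda>j. int (part_nth \<nu> j)) \<sigma>)) n \<sigma>)"
    by (rule stable_lincomb) (rule st)
  then show ?case
  proof (rule stable_cong)
    fix n \<sigma> assume "n0 \<le> n" "\<sigma> permutes {1..n}"
    then have inj: "inj \<sigma>" by (simp add: permutes_inj)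
    have "Ind m \<psi> n \<sigma> = Ind m (\<lambda>A \<sigma>. \<Sum>\<nu>\<in>int_partitions m. c \<nu> * of_int (chi A m (\<lambda>j. int (part_nth \<nu> j)) \<sigma>)) n \<sigma>"
      unfolding Ind_def
    proof (intro sum.cong refl c)
      fix A assume "A \<in> {A. A \<subseteq> {1..n} \<and> card A = m \<and> \<sigma> ` A = A}"
      then show "finite A" "card A = m" "bij_betw \<sigma> A A"
        using inj by (auto intro: finite_subset simp: bij_betw_def inj_on_subset)
    qed
    then show "Ind m \<psi> n \<sigma> = (\<Sum>\<nu>\<in>int_partitions m. c \<nu> * Ind m (\<lambda>A \<sigma>. of_int (chi A m (\<lambda>j. int (part_nth \<nu> j)) \<sigma>)) n \<sigma>)"
      by (simp only: Ind_linear)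
  qed
qed

text \<open>At \<open>n = n0\<close> the expansion runs over the irreducible characters themselves,
  so orthonormality identifies \<open>c\<close> with \<open>char_coeff\<close>; the same
  \<open>c\<close> is valid for all larger \<open>n\<close>.\<close>

lemma stable_imp_stabilizes_beyond:
  assumes st: "stable n0 (\<lambda>n \<sigma>. of_int (\<chi> n \<sigma>))" and n0: "0 < n0"
  shows "stabilizes_beyond \<chi> n0"
proof -
  from st obtain c where c: "\<And>n \<sigma>. n0 \<le> n \<Longrightarrow> \<sigma> permutes {1..n} \<Longrightarrow>
     rat_of_int (\<chi> n \<sigma>) = (\<Sum>la\<in>int_partitions n0. c la * of_int (irr_char n (part_plus la (n - n0)) \<sigma>))"
    unfolding stable_def by blast
  \<comment> \<open>\<open>part_plus\<close> would turn the empty partition into \<open>[0]\<close>;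
    \<open>n0 > 0\<close> excludes that case.\<close>
  have pp: "part_plus la 0 = la" if "la \<in> int_partitions n0" for la
    using that n0 by (cases la) (auto simp: part_plus_def int_partitions_def)
  have coeff: "char_coeff n0 (\<chi> n0) mu = c mu" if mu: "mu \<in> int_partitions n0" for mu
  proof -
    have "(\<Sum>\<sigma> | \<sigma> permutes {1..n0}. rat_of_int (\<chi> n0 \<sigma> * irr_char n0 mu \<sigma>)) =
       (\<Sum>\<sigma> | \<sigma> permutes {1..n0}. \<Sum>la\<in>int_partitions n0. c la * of_int (irr_char n0 la \<sigma> * irr_char n0 mu \<sigma>))"
    proof (rule sum.cong[OF refl])
      fix \<sigma> assume "\<sigma> \<in> {\<sigma>. \<sigma> permutes {1..n0}}"
      then have "rat_of_int (\<chi> n0 \<sigma>) = (\<Sum>la\<in>int_partitions n0. c la * of_int (irr_char n0 la \<sigma>))"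
        using c[of n0 \<sigma>] by (simp add: pp cong: sum.cong)
      then show "rat_of_int (\<chi> n0 \<sigma> * irr_char n0 mu \<sigma>) = (\<Sum>la\<in>int_partitions n0. c la * of_int (irr_char n0 la \<sigma> * irr_char n0 mu \<sigma>))"
        by (simp add: sum_distrib_right mult.assoc)
    qed
    also have "\<dots> = (\<Sum>la\<in>int_partitions n0. c la * of_int (\<Sum>\<sigma> | \<sigma> permutes {1..n0}. irr_char n0 la \<sigma> * irr_char n0 mu \<sigma>))"
      unfolding of_int_sum sum_distrib_left by (rule sum.swap)
    also have "\<dots> = (\<Sum>la\<in>int_partitions n0. if la = mu then c mu * fact n0 else 0)"
      by (intro sum.cong refl) (simp only: irr_char_orthonormal[OF _ mu], simp)
    also have "\<dots> = c mu * fact n0" using mu finite_int_partitions by simp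
    finally show ?thesis by (simp add: char_coeff_def)
  qed
  show ?thesis unfolding stabilizes_beyond_def char_plus_def
  proof (intro allI impI)
    fix n \<sigma> assume n: "n0 \<le> n" "\<sigma> permutes {1..n}"
    have "n0 + (n - n0) = n" using n(1) by simp
    then show "rat_of_int (\<chi> n \<sigma>) = (\<Sum>la\<in>int_partitions n0. char_coeff n0 (\<chi> n0) la * of_int (irr_char (n0 + (n - n0)) (part_plus la (n - n0)) \<sigma>))"
      unfolding c[OF n] by (intro sum.cong refl) (simp only: coeff)
  qed
qed

section \<open>Rank-selected chains of set partitions\<close>

lemma part_unique: "partition_on X P \<Longrightarrow> b \<in> P \<Longrightarrow> c \<in> P \<Longrightarrow> x \<in> b \<Longrightarrow> x \<in> c \<Longrightarrow> b = c"
  unfolding partition_on_def disjoint_def by blast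

lemma part_ex: "partition_on X P \<Longrightarrow> x \<in> X \<Longrightarrow> \<exists>b\<in>P. x \<in> b"
  unfolding partition_on_def by blast

lemma part_subset: "partition_on X P \<Longrightarrow> b \<in> P \<Longrightarrow> b \<subseteq> X"
  unfolding partition_on_def by blast

lemma part_nonempty: "partition_on X P \<Longrightarrow> b \<in> P \<Longrightarrow> b \<noteq> {}"
  unfolding partition_on_def by blast

lemma part_finite: "finite X \<Longrightarrow> partition_on X P \<Longrightarrow> finite P"
  using finite_elements by blast

lemma part_card_le:
  assumes "finite X" "partition_on X P" shows "card P \<le> card X"
proof -
  define f where "f b = (SOME x. x \<in> b)" for b :: "'a set"
  have f: "f b \<in> b" if "b \<in> P" for b
    unfolding f_def using part_nonempty[OF assms(2) that] by (simp add: some_in_eq)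
  have "inj_on f P"
  proof (rule inj_onI)
    fix b c assume "b \<in> P" "c \<in> P" "f b = f c"
    then show "b = c" using f part_unique[OF assms(2)] by metis
  qed
  moreover have "f ` P \<subseteq> X" using f part_subset[OF assms(2)] by blast
  ultimately show ?thesis using assms(1) by (metis card_inj_on_le)
qed

lemma refines_refl: "refines P P"
  unfolding refines_def by blast

lemma refines_trans: "refines P Q \<Longrightarrow> refines Q R \<Longrightarrow> refines P R"
  unfolding refines_def by (meson subset_trans)

text \<open>A point of a block of \<open>Q\<close> lies in some block of \<open>P\<close>, which can
  only be sent to that block of \<open>Q\<close>. The map is therefore onto, and comparing numbers
  of blocks becomes comparing a set with its image.\<close>

lemma refines_block_map:
  assumes X: "finite X" and P: "partition_on X P" and Q: "partition_on X Q" and r: "refines P Q"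
  obtains f where "\<And>b. b \<in> P \<Longrightarrow> f b \<in> Q \<and> b \<subseteq> f b" "f ` P = Q"
proof -
  from r obtain f where f: "\<And>b. b \<in> P \<Longrightarrow> f b \<in> Q \<and> b \<subseteq> f b" unfolding refines_def by metis
  have "Q \<subseteq> f ` P"
  proof
    fix c assume c: "c \<in> Q"
    obtain x where x: "x \<in> c" using part_nonempty[OF Q c] by blast
    then obtain b where b: "b \<in> P" "x \<in> b" using part_ex[OF P] part_subset[OF Q c] by blast
    then have "f b = c" using part_unique[OF Q, of "f b" c x] f[OF b(1)] c x by blast
    then show "c \<in> f ` P" using b by blast
  qed
  then have "f ` P = Q" using f by blast
  then show ?thesis using that[OF f] by blast
qed

lemma refines_card_le:
  assumes "finite X" "partition_on X P" "partition_on X Q" "refines P Q"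
  shows "card Q \<le> card P"
  using refines_block_map[OF assms] card_image_le[OF part_finite[OF assms(1,2)]] by metis

lemma refines_card_eq:
  assumes X: "finite X" and P: "partition_on X P" and Q: "partition_on X Q" and r: "refines P Q" and c: "card P = card Q"
  shows "P = Q"
proof -
  obtain f where f: "\<And>b. b \<in> P \<Longrightarrow> f b \<in> Q \<and> b \<subseteq> f b" "f ` P = Q"
    using refines_block_map[OF X P Q r] by blast
  have inj: "inj_on f P" using c f(2) part_finite[OF X P] by (simp add: eq_card_imp_inj_on)
  have "f b = b" if b: "b \<in> P" for b
  proof
    show "b \<subseteq> f b" using f(1)[OF b] by blast
    show "f b \<subseteq> b"
    proof
      fix y assume y: "y \<in> f b"
      then obtain b' where b': "b' \<in> P" "y \<in> b'" using part_ex[OF P] part_subset[OF Q] f(1)[OF b] by blast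
      then have "f b' = f b" using part_unique[OF Q, of "f b'" "f b" y] f(1)[OF b] f(1)[OF b'(1)] y by blast
      then have "b' = b" using inj b b'(1) by (auto dest: inj_onD)
      then show "y \<in> b" using b' by simp
    qed
  qed
  then show ?thesis using f(2) by (metis image_cong image_ident)
qed

text \<open>While \<open>P\<close> has more than \<open>r\<close> blocks, two of them lie in a
  common block of \<open>Q\<close>. Merging these two lowers the number of blocks by exactly one and
  still refines \<open>Q\<close>.\<close>

lemma refines_interpolate:
  assumes X: "finite X" and Q: "partition_on X Q"
  shows "partition_on X P \<Longrightarrow> refines P Q \<Longrightarrow> card Q \<le> r \<Longrightarrow> r \<le> card P \<Longrightarrow>
    \<exists>R. partition_on X R \<and> refines P R \<and> refines R Q \<and> card R = r"
proof (induction "card P - r" arbitrary: P)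
  case 0
  then have "card P = r" by simp
  then show ?case using "0.prems" refines_refl by (intro exI[of _ P]) simp
next
  case (Suc m)
  note P = Suc.prems(1)
  have finP: "finite P" using part_finite[OF X P] .
  obtain f where f: "\<And>b. b \<in> P \<Longrightarrow> f b \<in> Q \<and> b \<subseteq> f b" "f ` P = Q"
    using refines_block_map[OF X P Q Suc.prems(2)] by blast
  have less: "r < card P" using Suc.hyps(2) by simp
  then have "card (f ` P) \<noteq> card P" using f(2) Suc.prems(3) by simp
  then have "\<not> inj_on f P" using card_image by metis
  then obtain b1 b2 where b: "b1 \<in> P" "b2 \<in> P" "b1 \<noteq> b2" "f b1 = f b2" unfolding inj_on_def by blast
  let ?P = "insert (b1 \<union> b2) (P - {b1, b2})"
  have U: "\<Union>P = X" using P unfolding partition_on_def by blast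
  have P': "partition_on X ?P"
  proof (rule partition_onI)
    show "\<Union>?P = X" using U b(1,2) by auto
    show "{} \<notin> ?P" using part_nonempty[OF P] b(1) by auto
    have old_new: False if "q \<in> P - {b1, b2}" "x \<in> q" "x \<in> b1 \<union> b2" for q x
      using part_unique[OF P, of q b1 x] part_unique[OF P, of q b2 x] that b(1,2) by auto
    fix p q assume pq: "p \<in> ?P" "q \<in> ?P" "p \<noteq> q"
    have False if x: "x \<in> p" "x \<in> q" for x
    proof (cases "p = b1 \<union> b2")
      case True
      then show False using old_new[of q x] pq x by simp
    next
      case False
      show False
      proof (cases "q = b1 \<union> b2")
        case True
        then show False using old_new[of p x] False pq x by simp
      next
        case q: False
        then have "p \<in> P" "q \<in> P" using pq False by simp_all
        then show False using part_unique[OF P _ _ x] pq(3) by simp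
      qed
    qed
    then show "disjnt p q" unfolding disjnt_iff by blast
  qed
  have notin: "b1 \<union> b2 \<notin> P - {b1, b2}"
  proof
    assume a: "b1 \<union> b2 \<in> P - {b1, b2}"
    obtain x where "x \<in> b1" using part_nonempty[OF P b(1)] by blast
    then have "b1 \<union> b2 = b1" using part_unique[OF P _ b(1), of "b1 \<union> b2" x] a by blast
    then show False using a by blast
  qed
  have "card (P - {b1, b2}) = card P - 2" using b finP by (subst card_Diff_subset) auto
  moreover have "2 \<le> card P"
    using card_mono[OF finP, of "{b1, b2}"] b by simp
  ultimately have cP': "Suc (card ?P) = card P" using notin finP by simp
  have r1: "refines P ?P" unfolding refines_def
  proof
    fix p assume "p \<in> P"
    show "\<exists>c\<in>?P. p \<subseteq> c" using \<open>p \<in> P\<close> by (cases "p = b1 \<or> p = b2") auto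
  qed
  have r2: "refines ?P Q" unfolding refines_def
  proof
    fix p assume "p \<in> ?P"
    then consider "p = b1 \<union> b2" | "p \<in> P" by blast
    then show "\<exists>c\<in>Q. p \<subseteq> c"
    proof cases
      case 1
      have "f b1 \<in> Q" "p \<subseteq> f b1" using f(1)[OF b(1)] f(1)[OF b(2)] b(4) 1 by auto
      then show ?thesis by blast
    qed (use f in blast)
  qed
  have "\<exists>R. partition_on X R \<and> refines ?P R \<and> refines R Q \<and> card R = r"
  proof (rule Suc.hyps(1)[OF _ P' r2])
    show "m = card ?P - r" "r \<le> card ?P" using Suc.hyps(2) less cP' by linarith+
  qed (rule Suc.prems(3))
  then show ?case using refines_trans[OF r1] by blast
qed

text \<open>Maximality is replaced by the requirement that every rank in \<open>T\<close> occurs, a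
  condition local to the chain. The ground set is arbitrary so that the notion also applies to
  supports.\<close>

definition rchain :: "nat set \<Rightarrow> nat set \<Rightarrow> nat set set set \<Rightarrow> bool" where
  "rchain X T C \<longleftrightarrow> C \<subseteq> {P. partition_on X P \<and> card X - card P \<in> T} \<and>
     (\<forall>P\<in>C. \<forall>Q\<in>C. refines P Q \<or> refines Q P) \<and> (\<forall>t\<in>T. \<exists>P\<in>C. card X - card P = t)"

lemma comparable_refines:
  assumes "finite X" "partition_on X P" "partition_on X Q" "refines P Q \<or> refines Q P" "card Q \<le> card P"
  shows "refines P Q"
proof (cases "refines P Q")
  case False
  then have r: "refines Q P" using assms(4) by blast
  have "card P \<le> card Q" by (rule refines_card_le[OF assms(1,3,2) r])
  then have "card Q = card P" using assms(5) by (rule antisym[rotated])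
  then have "Q = P" by (rule refines_card_eq[OF assms(1,3,2) r])
  then show ?thesis using r by simp
qed

text \<open>With the finest and the coarsest partition adjoined, there are a coarsest member
  \<open>L\<close> with at least \<open>card X - t\<close> blocks and a finest member
  \<open>H\<close> with at most that many. An interpolated \<open>R\<close> between them is
  comparable with everything on either side.\<close>

lemma chain_extend:
  assumes X: "finite X" "X \<noteq> {}" and t: "t < card X"
    and C: "\<And>P. P \<in> C \<Longrightarrow> partition_on X P" "\<And>P Q. P \<in> C \<Longrightarrow> Q \<in> C \<Longrightarrow> refines P Q \<or> refines Q P"
  obtains R where "partition_on X R" "card X - card R = t" "\<And>P. P \<in> C \<Longrightarrow> refines P R \<or> refines R P"
proof -
  let ?b = "(\<lambda>x. {x}) ` X" and ?t = "{X}"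
  define D where "D = insert ?b (insert ?t C)"
  have DP: "partition_on X P" if "P \<in> D" for P
  proof -
    consider "P = ?b" | "P = ?t" | "P \<in> C" using \<open>P \<in> D\<close> unfolding D_def by auto
    then show ?thesis by cases (auto intro: C(1) partition_on_singletons partition_on_space[OF X(2)])
  qed
  have bot: "refines ?b P" if "partition_on X P" for P
    unfolding refines_def using part_ex[OF that] by auto
  have top: "refines P ?t" if "partition_on X P" for P
    unfolding refines_def using part_subset[OF that] by auto
  have Dcomp: "refines P Q \<or> refines Q P" if "P \<in> D" "Q \<in> D" for P Q
  proof -
    have "P = ?b \<or> Q = ?b \<or> P = ?t \<or> Q = ?t \<or> (P \<in> C \<and> Q \<in> C)"
      using that unfolding D_def insert_iff by argo
    then show ?thesis using bot[OF DP[OF that(1)]] bot[OF DP[OF that(2)]]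
      top[OF DP[OF that(1)]] top[OF DP[OF that(2)]] C(2)[of P Q] by metis
  qed
  have finD: "finite D"
    by (rule finite_subset[OF _ finitely_many_partition_on[OF X(1)]]) (use DP in blast)
  let ?k = "card X - t"
  have cb: "card ?b = card X" by (simp add: card_image)
  define lo where "lo = {P\<in>D. ?k \<le> card P}"
  define hi where "hi = {P\<in>D. card P \<le> ?k}"
  have "?b \<in> lo" unfolding lo_def D_def using cb by simp
  moreover have "finite lo" unfolding lo_def using finD by simp
  ultimately obtain L where L: "L \<in> lo" "\<And>P. P \<in> lo \<Longrightarrow> card L \<le> card P"
  proof -
    have "Min (card ` lo) \<in> card ` lo" by (rule Min_in) (use \<open>finite lo\<close> \<open>?b \<in> lo\<close> in auto)
    then obtain L where "L \<in> lo" "card L = Min (card ` lo)" by auto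
    then show ?thesis using that \<open>finite lo\<close> by simp
  qed
  have "?t \<in> hi" unfolding hi_def D_def using t by simp
  moreover have "finite hi" unfolding hi_def using finD by simp
  ultimately obtain H where H: "H \<in> hi" "\<And>P. P \<in> hi \<Longrightarrow> card P \<le> card H"
  proof -
    have "Max (card ` hi) \<in> card ` hi" by (rule Max_in) (use \<open>finite hi\<close> \<open>?t \<in> hi\<close> in auto)
    then obtain H where "H \<in> hi" "card H = Max (card ` hi)" by auto
    then show ?thesis using that \<open>finite hi\<close> by simp
  qed
  have LD: "L \<in> D" "?k \<le> card L" and HD: "H \<in> D" "card H \<le> ?k" using L H unfolding lo_def hi_def by auto
  have LH: "refines L H"
    by (rule comparable_refines[OF X(1) DP[OF LD(1)] DP[OF HD(1)] Dcomp[OF LD(1) HD(1)]]) (use LD HD in simp)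
  obtain R where R: "partition_on X R" "refines L R" "refines R H" "card R = ?k"
    using refines_interpolate[OF X(1) DP[OF HD(1)] DP[OF LD(1)] LH HD(2) LD(2)] by blast
  show ?thesis
  proof (rule that[OF R(1)])
    show "card X - card R = t" using R(4) t by simp
    fix P assume "P \<in> C"
    then have PD: "P \<in> D" by (simp add: D_def)
    show "refines P R \<or> refines R P"
    proof (cases "?k \<le> card P")
      case True
      then have "card L \<le> card P" using L(2) PD by (simp add: lo_def)
      then have "refines P L" using comparable_refines[OF X(1) DP[OF PD] DP[OF LD(1)] Dcomp[OF PD LD(1)]] by blast
      then show ?thesis using refines_trans R(2) by blast
    next
      case False
      then have "card P \<le> card H" using H(2) PD by (simp add: hi_def)
      then have "refines H P" using comparable_refines[OF X(1) DP[OF HD(1)] DP[OF PD] Dcomp[OF HD(1) PD]] by blast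
      then show ?thesis using refines_trans R(3) by blast
    qed
  qed
qed

text \<open>A chain missing a rank of \<open>T\<close> can be extended, so it is not maximal.
  Conversely comparable partitions of equal rank coincide, so a chain meeting every rank of
  \<open>T\<close> has no room for a further member.\<close>

lemma is_maxchain_iff:
  assumes n: "0 < n" and T: "\<And>t. t \<in> T \<Longrightarrow> t < n"
  shows "is_maxchain n T C \<longleftrightarrow> rchain {1..n} T C"
proof -
  let ?X = "{1..n}"
  have sel: "rank_sel n T = {P. partition_on ?X P \<and> card ?X - card P \<in> T}"
    by (simp add: rank_sel_def setpart_def prank_def)
  show ?thesis
  proof
    assume m: "is_maxchain n T C"
    then have sub: "C \<subseteq> {P. partition_on ?X P \<and> card ?X - card P \<in> T}"
      and comp: "\<And>P Q. P \<in> C \<Longrightarrow> Q \<in> C \<Longrightarrow> refines P Q \<or> refines Q P"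
      and mx: "\<And>D. is_chain n T D \<Longrightarrow> C \<subseteq> D \<Longrightarrow> D = C"
      unfolding is_maxchain_def is_chain_def sel by blast+
    have "\<exists>P\<in>C. card ?X - card P = t" if t: "t \<in> T" for t
    proof -
      obtain R where R: "partition_on ?X R" "card ?X - card R = t" "\<And>P. P \<in> C \<Longrightarrow> refines P R \<or> refines R P"
        by (rule chain_extend[of ?X t C]) (use n T[OF t] sub comp in auto)
      have "is_chain n T (insert R C)"
        unfolding is_chain_def sel using sub comp R t refines_refl[of R] by blast
      from mx[OF this] have "R \<in> C" by blast
      then show ?thesis using R(2) by blast
    qed
    then show "rchain ?X T C" unfolding rchain_def using sub comp by blast
  next
    assume r: "rchain ?X T C"
    then have sub: "C \<subseteq> {P. partition_on ?X P \<and> card ?X - card P \<in> T}"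
      and comp: "\<And>P Q. P \<in> C \<Longrightarrow> Q \<in> C \<Longrightarrow> refines P Q \<or> refines Q P"
      and ex: "\<And>t. t \<in> T \<Longrightarrow> \<exists>P\<in>C. card ?X - card P = t"
      unfolding rchain_def by blast+
    have "D = C" if D: "is_chain n T D" "C \<subseteq> D" for D
    proof
      have D1: "D \<subseteq> {P. partition_on ?X P \<and> card ?X - card P \<in> T}"
        and D2: "\<And>P Q. P \<in> D \<Longrightarrow> Q \<in> D \<Longrightarrow> refines P Q \<or> refines Q P"
        using D(1) unfolding is_chain_def sel by blast+
      show "D \<subseteq> C"
      proof
        fix P assume P: "P \<in> D"
        then have PP: "partition_on ?X P" "card ?X - card P \<in> T" using D1 by blast+
        obtain Q where Q: "Q \<in> C" "card ?X - card Q = card ?X - card P" using ex[OF PP(2)] by blast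
        have QP: "partition_on ?X Q" using Q(1) sub by blast
        \<comment> \<open>Ranks are truncated differences; these bounds are what turns equal ranks
          into equal numbers of blocks.\<close>
        have "card P \<le> card ?X" "card Q \<le> card ?X" using part_card_le PP(1) QP by (metis finite_atLeastAtMost)+
        then have c: "card P = card Q" using Q(2) by linarith
        have "P = Q"
        proof (cases "refines P Q")
          case True
          show ?thesis by (rule refines_card_eq[OF finite_atLeastAtMost PP(1) QP True c])
        next
          case False
          then have "refines Q P" using D2[OF P] Q(1) D(2) by blast
          then have "Q = P" using refines_card_eq[OF finite_atLeastAtMost QP PP(1) _ c[symmetric]] by blast
          then show ?thesis ..
        qed
        then show "P \<in> C" using Q(1) by simp
      qed
    qed (rule D(2))
    then show "is_maxchain n T C" unfolding is_maxchain_def is_chain_def sel using sub comp by blast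
  qed
qed

text \<open>No point of \<open>A\<close> is a singleton block in all members, so \<open>A\<close> is
  exactly the support of the chain. The empty chain is full only on the empty set, which yields the
  trivial character for \<open>T = {}\<close>.\<close>

definition full :: "nat set \<Rightarrow> nat set set set \<Rightarrow> bool" where
  "full A C \<longleftrightarrow> (\<forall>x\<in>A. \<exists>P\<in>C. {x} \<notin> P)"

definition supported :: "nat set \<Rightarrow> nat set \<Rightarrow> (nat \<Rightarrow> nat) \<Rightarrow> nat set set set set" where
  "supported T A \<sigma> = {C. rchain A T C \<and> full A C \<and> act_chain \<sigma> C = C}"

lemma rchainD:
  assumes "rchain X T C"
  shows "P \<in> C \<Longrightarrow> partition_on X P" "P \<in> C \<Longrightarrow> card X - card P \<in> T"
    "P \<in> C \<Longrightarrow> Q \<in> C \<Longrightarrow> refines P Q \<or> refines Q P" "t \<in> T \<Longrightarrow> \<exists>P\<in>C. card X - card P = t"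
  using assms unfolding rchain_def by blast+

lemma rchainI:
  assumes "\<And>P. P \<in> C \<Longrightarrow> partition_on X P" "\<And>P. P \<in> C \<Longrightarrow> card X - card P \<in> T"
    "\<And>P Q. P \<in> C \<Longrightarrow> Q \<in> C \<Longrightarrow> refines P Q \<or> refines Q P" "\<And>t. t \<in> T \<Longrightarrow> \<exists>P\<in>C. card X - card P = t"
  shows "rchain X T C"
  unfolding rchain_def using assms by (intro conjI ballI subsetI CollectI) simp_all

section \<open>Transport of structure\<close>

lemma act_part_comp: "act_part f (act_part g P) = act_part (f \<circ> g) P"
  by (simp add: act_part_def image_image image_comp)

lemma act_chain_comp: "act_chain f (act_chain g C) = act_chain (f \<circ> g) C"
  by (simp add: act_chain_def image_image act_part_comp)

lemma act_part_cong:
  assumes "partition_on A P" "\<And>x. x \<in> A \<Longrightarrow> f x = g x"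
  shows "act_part f P = act_part g P"
  unfolding act_part_def
proof (rule image_cong[OF refl])
  fix b assume "b \<in> P"
  then have "b \<subseteq> A" by (rule part_subset[OF assms(1)])
  then show "f ` b = g ` b" using assms(2) by (intro image_cong) auto
qed

lemma act_chain_cong:
  assumes "\<And>P. P \<in> C \<Longrightarrow> partition_on A P" "\<And>x. x \<in> A \<Longrightarrow> f x = g x"
  shows "act_chain f C = act_chain g C"
  unfolding act_chain_def using act_part_cong assms by (intro image_cong refl) metis

lemma act_chain_id: "act_chain id C = C"
  by (simp add: act_chain_def act_part_def)

lemma partition_on_act_part:
  assumes P: "partition_on A P" and f: "bij_betw f A B"
  shows "partition_on B (act_part f P)"
proof -
  have fB: "f ` A = B" and inj: "inj_on f A" using f by (auto simp: bij_betw_def)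
  have "(`) f ` P - {{}} = act_part f P"
    using part_nonempty[OF P] by (auto simp: act_part_def)
  then show ?thesis using partition_on_inj_image[OF P inj] fB by simp
qed

lemma card_act_part:
  assumes P: "partition_on A P" and f: "inj_on f A"
  shows "card (act_part f P) = card P"
  unfolding act_part_def
proof (rule card_image, rule inj_onI)
  fix b c assume bc: "b \<in> P" "c \<in> P" "f ` b = f ` c"
  then show "b = c" using inj_on_image_eq_iff[OF f part_subset[OF P bc(1)] part_subset[OF P bc(2)]] by simp
qed

lemma refines_act_part: "refines P Q \<Longrightarrow> refines (act_part f P) (act_part f Q)"
  unfolding refines_def act_part_def by (auto intro: image_mono) (meson image_mono)

lemma rchain_act_chain:
  assumes A: "finite A" and r: "rchain A T C" and f: "bij_betw f A B"
  shows "rchain B T (act_chain f C)"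
proof -
  note r1 = rchainD(1)[OF r] and r2 = rchainD(2)[OF r] and r3 = rchainD(3)[OF r] and r4 = rchainD(4)[OF r]
  have inj: "inj_on f A" using f by (simp add: bij_betw_def)
  have cAB: "card B = card A" using bij_betw_same_card[OF f] by simp
  have c: "card (act_part f P) = card P" if "P \<in> C" for P
    by (rule card_act_part[OF r1[OF that] inj])
  show ?thesis
  proof (rule rchainI)
    fix P assume "P \<in> act_chain f C"
    then obtain P' where P: "P = act_part f P'" "P' \<in> C" by (auto simp: act_chain_def)
    show "partition_on B P" unfolding P(1) by (rule partition_on_act_part[OF r1[OF P(2)] f])
    show "card B - card P \<in> T" unfolding P(1) cAB c[OF P(2)] by (rule r2[OF P(2)])
    fix Q assume "Q \<in> act_chain f C"
    then obtain Q' where Q: "Q = act_part f Q'" "Q' \<in> C" by (auto simp: act_chain_def)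
    show "refines P Q \<or> refines Q P" unfolding P(1) Q(1) using r3[OF P(2) Q(2)] refines_act_part by metis
  next
    fix t assume "t \<in> T"
    from r4[OF this] obtain P where P: "P \<in> C" "card A - card P = t" by metis
    then show "\<exists>P\<in>act_chain f C. card B - card P = t"
      using c[OF P(1)] cAB by (intro bexI[of _ "act_part f P"]) (simp_all add: act_chain_def)
  qed
qed

lemma singleton_act_part:
  assumes P: "partition_on A P" and f: "inj_on f A" and x: "x \<in> A"
  shows "{f x} \<in> act_part f P \<longleftrightarrow> {x} \<in> P"
proof
  assume "{f x} \<in> act_part f P"
  then obtain b where b: "b \<in> P" "f ` b = f ` {x}" by (auto simp: act_part_def)
  have "b = {x}" using inj_on_image_eq_iff[OF f part_subset[OF P b(1)], of "{x}"] b(2) x by simp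
  then show "{x} \<in> P" using b(1) by simp
next
  assume "{x} \<in> P"
  then have "f ` {x} \<in> act_part f P" unfolding act_part_def by (rule imageI)
  then show "{f x} \<in> act_part f P" by simp
qed

lemma full_act_chain:
  assumes r: "\<And>P. P \<in> C \<Longrightarrow> partition_on A P" and u: "full A C" and f: "bij_betw f A B"
  shows "full B (act_chain f C)"
  unfolding full_def
proof
  fix y assume "y \<in> B"
  then obtain x where x: "x \<in> A" "y = f x" using f by (auto simp: bij_betw_def)
  obtain P where P: "P \<in> C" "{x} \<notin> P" using u x(1) unfolding full_def by metis
  have "{y} \<notin> act_part f P"
    unfolding x(2) using singleton_act_part[OF r[OF P(1)] bij_betw_imp_inj_on[OF f] x(1)] P(2) by simp
  then show "\<exists>P\<in>act_chain f C. {y} \<notin> P" using P(1) by (auto simp: act_chain_def)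
qed

text \<open>The intertwining relation is available only on \<open>A\<close>. That suffices, since
  the members of the chain partition \<open>A\<close> and their images ignore all other
  values.\<close>

lemma supported_transport:
  assumes A: "finite A" and f: "bij_betw f A B" and eq: "\<And>x. x \<in> A \<Longrightarrow> f (\<sigma> x) = \<tau> (f x)"
    and C: "C \<in> supported T A \<sigma>"
  shows "act_chain f C \<in> supported T B \<tau>"
proof -
  have C': "rchain A T C" "full A C" "act_chain \<sigma> C = C" using C unfolding supported_def by simp_all
  have "act_chain \<tau> (act_chain f C) = act_chain (\<tau> \<circ> f) C" by (rule act_chain_comp)
  also have "\<dots> = act_chain (f \<circ> \<sigma>) C"
    by (rule act_chain_cong[OF rchainD(1)[OF C'(1)]]) (simp_all add: eq)
  also have "\<dots> = act_chain f C" using C'(3) by (simp flip: act_chain_comp)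
  finally have "act_chain \<tau> (act_chain f C) = act_chain f C" .
  then show ?thesis
    using rchain_act_chain[OF A C'(1) f] full_act_chain[OF rchainD(1)[OF C'(1)] C'(2) f]
    unfolding supported_def by simp
qed

lemma act_chain_inverse:
  assumes C: "rchain A T C" and f: "bij_betw f A B"
  shows "act_chain (inv_into A f) (act_chain f C) = C"
proof -
  have "act_chain (inv_into A f) (act_chain f C) = act_chain id C"
    unfolding act_chain_comp
    by (rule act_chain_cong[OF rchainD(1)[OF C]]) (simp_all add: bij_betw_inv_into_left[OF f])
  then show ?thesis by (simp add: act_chain_id)
qed

lemma finite_supported: "finite A \<Longrightarrow> finite (supported T A \<sigma>)"
proof -
  assume A: "finite A"
  have "C \<in> Pow {P. partition_on A P}" if "C \<in> supported T A \<sigma>" for C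
  proof -
    have "rchain A T C" using that unfolding supported_def by simp
    then show ?thesis using rchainD(1) by (intro PowI subsetI CollectI) 
  qed
  then have "supported T A \<sigma> \<subseteq> Pow {P. partition_on A P}" by (rule subsetI)
  moreover have "finite (Pow {P. partition_on A P})" using finitely_many_partition_on[OF A] by simp
  ultimately show ?thesis by (rule finite_subset)
qed

text \<open>Relabelling along \<open>\<phi>\<close> and along its inverse gives mutually inverse
  maps between the chains counted on both sides.\<close>

lemma natural_supported: "natural m (\<lambda>A \<sigma>. of_nat (card (supported T A \<sigma>)))"
  unfolding natural_def
proof (intro allI impI, elim conjE)
  fix A B :: "nat set" and \<phi> \<sigma> \<tau> :: "nat \<Rightarrow> nat"
  assume A: "finite A" and s: "bij_betw \<sigma> A A" and \<phi>: "bij_betw \<phi> A B" and eq: "\<forall>x\<in>A. \<phi> (\<sigma> x) = \<tau> (\<phi> x)"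
  have B: "finite B" using A bij_betw_finite[OF \<phi>] by simp
  have \<psi>: "bij_betw (inv_into A \<phi>) B A" by (rule bij_betw_inv_into[OF \<phi>])
  have eq': "inv_into A \<phi> (\<tau> y) = \<sigma> (inv_into A \<phi> y)" if y: "y \<in> B" for y
  proof -
    have x: "inv_into A \<phi> y \<in> A" using bij_betwE[OF \<psi>] y by simp
    have "\<tau> y = \<phi> (\<sigma> (inv_into A \<phi> y))" using eq x bij_betw_inv_into_right[OF \<phi> y] by simp
    moreover have "\<sigma> (inv_into A \<phi> y) \<in> A" using bij_betwE[OF s] x by simp
    ultimately show ?thesis using bij_betw_inv_into_left[OF \<phi>] by simp
  qed
  have forth: "act_chain \<phi> C \<in> supported T B \<tau>" if "C \<in> supported T A \<sigma>" for C
    by (rule supported_transport[OF A \<phi> _ that]) (simp add: eq)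
  have bwd: "act_chain (inv_into A \<phi>) C \<in> supported T A \<sigma>" if "C \<in> supported T B \<tau>" for C
    by (rule supported_transport[OF B \<psi> eq' that])
  have l: "act_chain (inv_into A \<phi>) (act_chain \<phi> C) = C" if "C \<in> supported T A \<sigma>" for C
    using act_chain_inverse[of A T C \<phi> B] that \<phi> by (simp add: supported_def)
  have r: "act_chain \<phi> (act_chain (inv_into A \<phi>) C) = C" if "C \<in> supported T B \<tau>" for C
  proof -
    have C: "rchain B T C" using that by (simp add: supported_def)
    have "act_chain \<phi> (act_chain (inv_into A \<phi>) C) = act_chain id C"
      unfolding act_chain_comp
      by (rule act_chain_cong[OF rchainD(1)[OF C]]) (simp_all add: bij_betw_inv_into_right[OF \<phi>])
    then show ?thesis by (simp add: act_chain_id)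
  qed
  have "bij_betw (act_chain \<phi>) (supported T A \<sigma>) (supported T B \<tau>)"
    by (rule bij_betw_byWitness[where f'="act_chain (inv_into A \<phi>)"]) (simp_all add: l r forth bwd image_subset_iff)
  then show "rat_of_nat (card (supported T A \<sigma>)) = of_nat (card (supported T B \<tau>))"
    by (simp add: bij_betw_same_card)
qed

text \<open>In the coarsest member \<open>Q\<close> a singleton block would be a singleton in every
  finer member, contradicting fullness. So \<open>2 * card Q \<le> card A\<close>, and together with
  \<open>card A - card Q \<le> i\<close> this gives the bound.\<close>

lemma supported_small:
  assumes A: "finite A" and T: "\<And>t. t \<in> T \<Longrightarrow> t \<le> i" and C: "C \<in> supported T A \<sigma>"
  shows "card A \<le> 2 * i"
proof (cases "C = {}")
  case True
  then have "A = {}" using C unfolding supported_def full_def by auto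
  then show ?thesis by simp
next
  case False
  have C': "rchain A T C" "full A C" using C unfolding supported_def by simp_all
  note r1 = rchainD(1)[OF C'(1)]
  define Q where "Q = arg_min card (\<lambda>P. P \<in> C)"
  have Q: "Q \<in> C" "\<And>P. P \<in> C \<Longrightarrow> card Q \<le> card P"
    using arg_min_nat_lemma[of "\<lambda>P. P \<in> C" _ card] False unfolding Q_def by auto
  have big: "2 \<le> card c" if c: "c \<in> Q" for c
  proof (rule ccontr)
    assume "\<not> 2 \<le> card c"
    have fc: "finite c" using part_subset[OF r1[OF Q(1)] c] A by (rule finite_subset)
    have "card c \<noteq> 0" using part_nonempty[OF r1[OF Q(1)] c] fc by simp
    then have "card c = 1" using \<open>\<not> 2 \<le> card c\<close> by simp
    then obtain x where x: "c = {x}" using card_1_singletonE by metis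
    have xA: "x \<in> A" using part_subset[OF r1[OF Q(1)] c] x by simp
    then obtain P where P: "P \<in> C" "{x} \<notin> P" using C'(2) unfolding full_def by metis
    have PQ: "refines P Q"
      by (rule comparable_refines[OF A r1[OF P(1)] r1[OF Q(1)] rchainD(3)[OF C'(1) P(1) Q(1)] Q(2)[OF P(1)]])
    obtain b where b: "b \<in> P" "x \<in> b" using part_ex[OF r1[OF P(1)] xA] by metis
    obtain c' where c': "c' \<in> Q" "b \<subseteq> c'" using PQ b(1) unfolding refines_def by metis
    have "c' = {x}" using part_unique[OF r1[OF Q(1)] c'(1) c, of x] x b(2) c'(2) by auto
    then have "b = {x}" using b(2) c'(2) by auto
    then show False using b(1) P(2) by simp
  qed
  have finQ: "finite Q" by (rule part_finite[OF A r1[OF Q(1)]])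
  have "card A = (\<Sum>c\<in>Q. card c)"
    using product_partition[OF r1[OF Q(1)]] part_subset[OF r1[OF Q(1)]] A finite_subset by metis
  also have "\<dots> \<ge> (\<Sum>c\<in>Q. 2)" by (rule sum_mono) (rule big)
  finally have "2 * card Q \<le> card A" by simp
  moreover have "card A - card Q \<le> i" by (rule T[OF rchainD(2)[OF C'(1) Q(1)]])
  ultimately show ?thesis by linarith
qed

section \<open>Decomposition by support\<close>

definition add_singletons :: "nat set \<Rightarrow> nat set \<Rightarrow> nat set set \<Rightarrow> nat set set" where
  "add_singletons X A P = P \<union> (\<lambda>x. {x}) ` (X - A)"

definition blocks_in :: "nat set \<Rightarrow> nat set set \<Rightarrow> nat set set" where
  "blocks_in A P = {b\<in>P. b \<subseteq> A}"

definition chain_supp :: "nat set \<Rightarrow> nat set set set \<Rightarrow> nat set" where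
  "chain_supp X C = {x\<in>X. \<exists>P\<in>C. {x} \<notin> P}"

lemma singleton_add_singletons:
  assumes "partition_on A P" "x \<in> X"
  shows "{x} \<in> add_singletons X A P \<longleftrightarrow> {x} \<in> P \<or> x \<notin> A"
  using assms(2) by (auto simp: add_singletons_def)

lemma partition_on_add_singletons:
  assumes P: "partition_on A P" and AX: "A \<subseteq> X"
  shows "partition_on X (add_singletons X A P)"
proof (rule partition_onI)
  have U: "\<Union>P = A" using partition_onD1[OF P] by simp
  show "\<Union>(add_singletons X A P) = X" using U AX by (auto simp: add_singletons_def)
  show "{} \<notin> add_singletons X A P" using partition_onD3[OF P] by (auto simp: add_singletons_def)
  fix p q assume pq: "p \<in> add_singletons X A P" "q \<in> add_singletons X A P" "p \<noteq> q"
  have False if x: "x \<in> p" "x \<in> q" for x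
  proof (cases "x \<in> A")
    case True
    then have "p \<in> P" "q \<in> P" using pq x by (auto simp: add_singletons_def)
    then show False using part_unique[OF P _ _ x] pq(3) by simp
  next
    case False
    then have "p = {x}" "q = {x}" using pq x part_subset[OF P] by (auto simp: add_singletons_def)
    then show False using pq(3) by simp
  qed
  then show "disjnt p q" unfolding disjnt_iff by blast
qed

lemma card_add_singletons:
  assumes X: "finite X" and P: "partition_on A P" and AX: "A \<subseteq> X"
  shows "card (add_singletons X A P) = card P + (card X - card A)"
proof -
  have finA: "finite A" using AX X by (rule finite_subset)
  have "P \<inter> (\<lambda>x. {x}) ` (X - A) = {}" using part_subset[OF P] by fastforce
  then have "card (add_singletons X A P) = card P + card ((\<lambda>x. {x}) ` (X - A))"
    unfolding add_singletons_def using X part_finite[OF finA P] by (intro card_Un_disjoint) auto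
  also have "card ((\<lambda>x. {x}) ` (X - A)) = card X - card A"
    using card_Diff_subset[OF finA AX] by (simp add: card_image)
  finally show ?thesis .
qed

text \<open>Points and blocks grow by the same number, so the rank is unchanged. Hence one and the
  same \<open>T\<close> describes the chain on its support and on every larger ground set.\<close>

lemma corank_add_singletons:
  assumes X: "finite X" and P: "partition_on A P" and AX: "A \<subseteq> X"
  shows "card X - card (add_singletons X A P) = card A - card P"
  using card_add_singletons[OF assms] card_mono[OF X AX] by linarith

lemma blocks_in_add_singletons:
  assumes P: "partition_on A P" shows "blocks_in A (add_singletons X A P) = P"
  using part_subset[OF P] by (auto simp: blocks_in_def add_singletons_def)

text \<open>A block containing a point outside \<open>A\<close> is that singleton, so no block
  straddles the boundary of \<open>A\<close>.\<close>

lemma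
  assumes P: "partition_on X P" and AX: "A \<subseteq> X" and s: "\<And>x. x \<in> X \<Longrightarrow> x \<notin> A \<Longrightarrow> {x} \<in> P"
  shows partition_on_blocks_in: "partition_on A (blocks_in A P)"
    and add_singletons_blocks_in: "add_singletons X A (blocks_in A P) = P"
proof -
  have cases: "b = {x}" if b: "b \<in> P" "x \<in> b" "x \<notin> A" for b x
  proof -
    have "x \<in> X" using part_subset[OF P b(1)] b(2) by (rule subsetD)
    then show ?thesis using part_unique[OF P b(1) s[of x] b(2)] b(3) by simp
  qed
  have sub: "b \<subseteq> A" if b: "b \<in> P" "x \<in> b" "x \<in> A" for b x
  proof
    fix y assume y: "y \<in> b"
    show "y \<in> A"
    proof (rule ccontr)
      assume "y \<notin> A"
      then have "b = {y}" using cases[OF b(1) y] by simp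
      then show False using b \<open>y \<notin> A\<close> by simp
    qed
  qed
  show "partition_on A (blocks_in A P)"
  proof (rule partition_onI)
    show "\<Union>(blocks_in A P) = A"
    proof
      show "A \<subseteq> \<Union>(blocks_in A P)"
      proof
        fix x assume x: "x \<in> A"
        then obtain b where b: "b \<in> P" "x \<in> b" using part_ex[OF P] AX by (metis subsetD)
        then show "x \<in> \<Union>(blocks_in A P)" using sub[OF b x] by (auto simp: blocks_in_def)
      qed
    qed (auto simp: blocks_in_def)
    show "{} \<notin> blocks_in A P" using partition_onD3[OF P] by (simp add: blocks_in_def)
    fix p q assume pq: "p \<in> blocks_in A P" "q \<in> blocks_in A P" "p \<noteq> q"
    then have "p \<in> P" "q \<in> P" by (simp_all add: blocks_in_def)
    then show "disjnt p q" unfolding disjnt_iff using part_unique[OF P] pq(3) by metis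
  qed
  show "add_singletons X A (blocks_in A P) = P"
  proof
    show "add_singletons X A (blocks_in A P) \<subseteq> P"
      using s by (auto simp: add_singletons_def blocks_in_def)
    show "P \<subseteq> add_singletons X A (blocks_in A P)"
    proof
      fix b assume b: "b \<in> P"
      show "b \<in> add_singletons X A (blocks_in A P)"
      proof (cases "b \<subseteq> A")
        case True
        then show ?thesis using b by (simp add: add_singletons_def blocks_in_def)
      next
        case False
        then obtain x where x: "x \<in> b" "x \<notin> A" by auto
        have "b = {x}" by (rule cases[OF b x])
        moreover have "x \<in> X" using part_subset[OF P b] x(1) by (rule subsetD)
        ultimately show ?thesis using x by (simp add: add_singletons_def)
      qed
    qed
  qed
qed

lemma refines_add_singletons_iff:
  assumes P: "partition_on A P"
  shows "refines (add_singletons X A P) (add_singletons X A Q) \<longleftrightarrow> refines P Q"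
proof
  assume r: "refines (add_singletons X A P) (add_singletons X A Q)"
  show "refines P Q" unfolding refines_def
  proof
    fix b assume b: "b \<in> P"
    then have "b \<in> add_singletons X A P" by (simp add: add_singletons_def)
    then obtain c where c: "c \<in> add_singletons X A Q" "b \<subseteq> c" using r unfolding refines_def by metis
    have "c \<in> Q"
    proof (rule ccontr)
      assume "c \<notin> Q"
      then obtain y where "c = {y}" "y \<notin> A" using c(1) by (auto simp: add_singletons_def)
      then show False using c(2) part_subset[OF P b] part_nonempty[OF P b] by auto
    qed
    then show "\<exists>c\<in>Q. b \<subseteq> c" using c(2) by auto
  qed
next
  assume r: "refines P Q"
  show "refines (add_singletons X A P) (add_singletons X A Q)" unfolding refines_def
  proof
    fix b assume "b \<in> add_singletons X A P"
    then consider "b \<in> P" | "b \<in> (\<lambda>x. {x}) ` (X - A)" unfolding add_singletons_def by auto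
    then show "\<exists>c\<in>add_singletons X A Q. b \<subseteq> c"
    proof cases
      case 1
      then obtain c where "c \<in> Q" "b \<subseteq> c" using r unfolding refines_def by metis
      then show ?thesis unfolding add_singletons_def by (intro bexI[of _ c]) simp_all
    next
      case 2
      then show ?thesis unfolding add_singletons_def by (intro bexI[of _ b]) simp_all
    qed
  qed
qed

lemma act_add_singletons:
  assumes s: "\<sigma> permutes X" and A: "\<sigma> ` A = A"
  shows "act_part \<sigma> (add_singletons X A P) = add_singletons X A (act_part \<sigma> P)"
proof -
  have "\<sigma> ` (X - A) = \<sigma> ` X - \<sigma> ` A" by (rule image_set_diff[OF permutes_inj[OF s]])
  then have XA: "\<sigma> ` (X - A) = X - A" by (simp only: A permutes_image[OF s])
  have "(`) \<sigma> ` (\<lambda>x. {x}) ` (X - A) = (\<lambda>x. {x}) ` \<sigma> ` (X - A)"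
    by (simp only: image_image image_insert image_empty)
  then have "(`) \<sigma> ` (\<lambda>x. {x}) ` (X - A) = (\<lambda>x. {x}) ` (X - A)" by (simp only: XA)
  then show ?thesis by (simp only: act_part_def add_singletons_def image_Un)
qed

lemma act_chain_add_singletons:
  assumes s: "\<sigma> permutes X" and A: "\<sigma> ` A = A"
  shows "act_chain \<sigma> (add_singletons X A ` C) = add_singletons X A ` act_chain \<sigma> C"
  unfolding act_chain_def image_image using act_add_singletons[OF assms] by simp

lemma rchain_add_singletons_iff:
  assumes X: "finite X" and AX: "A \<subseteq> X" and C: "\<And>P. P \<in> C \<Longrightarrow> partition_on A P"
  shows "rchain X T (add_singletons X A ` C) \<longleftrightarrow> rchain A T C"
proof
  assume r: "rchain X T (add_singletons X A ` C)"
  show "rchain A T C"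
  proof (rule rchainI)
    fix P assume P: "P \<in> C"
    show "partition_on A P" by (rule C[OF P])
    show "card A - card P \<in> T"
      using rchainD(2)[OF r imageI[OF P]] corank_add_singletons[OF X C[OF P] AX] by simp
    fix Q assume Q: "Q \<in> C"
    show "refines P Q \<or> refines Q P"
      using rchainD(3)[OF r imageI[OF P] imageI[OF Q]] refines_add_singletons_iff[OF C[OF P]]
        refines_add_singletons_iff[OF C[OF Q]] by metis
  next
    fix t assume "t \<in> T"
    from rchainD(4)[OF r this] obtain P where P: "P \<in> C" "card X - card (add_singletons X A P) = t"
      by auto
    then show "\<exists>P\<in>C. card A - card P = t" using corank_add_singletons[OF X C[OF P(1)] AX] by metis
  qed
next
  assume r: "rchain A T C"
  show "rchain X T (add_singletons X A ` C)"
  proof (rule rchainI)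
    fix P' assume "P' \<in> add_singletons X A ` C"
    then obtain P where P: "P \<in> C" "P' = add_singletons X A P" by auto
    show "partition_on X P'" unfolding P(2) by (rule partition_on_add_singletons[OF C[OF P(1)] AX])
    show "card X - card P' \<in> T"
      unfolding P(2) corank_add_singletons[OF X C[OF P(1)] AX] by (rule rchainD(2)[OF r P(1)])
    fix Q' assume "Q' \<in> add_singletons X A ` C"
    then obtain Q where Q: "Q \<in> C" "Q' = add_singletons X A Q" by auto
    show "refines P' Q' \<or> refines Q' P'"
      unfolding P(2) Q(2) refines_add_singletons_iff[OF C[OF P(1)]] refines_add_singletons_iff[OF C[OF Q(1)]]
      by (rule rchainD(3)[OF r P(1) Q(1)])
  next
    fix t assume "t \<in> T"
    from rchainD(4)[OF r this] obtain P where P: "P \<in> C" "card A - card P = t" by metis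
    then show "\<exists>P\<in>add_singletons X A ` C. card X - card P = t"
      using corank_add_singletons[OF X C[OF P(1)] AX] by (intro bexI[of _ "add_singletons X A P"]) simp_all
  qed
qed

lemma chain_supp_add_singletons:
  assumes AX: "A \<subseteq> X" and C: "\<And>P. P \<in> C \<Longrightarrow> partition_on A P" and u: "full A C"
  shows "chain_supp X (add_singletons X A ` C) = A"
proof
  show "chain_supp X (add_singletons X A ` C) \<subseteq> A"
  proof
    fix x assume "x \<in> chain_supp X (add_singletons X A ` C)"
    then obtain P where "x \<in> X" "{x} \<notin> add_singletons X A P" by (auto simp: chain_supp_def)
    then show "x \<in> A" by (auto simp: add_singletons_def)
  qed
  show "A \<subseteq> chain_supp X (add_singletons X A ` C)"
  proof
    fix x assume x: "x \<in> A"
    then obtain P where P: "P \<in> C" "{x} \<notin> P" using u unfolding full_def by metis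
    have xX: "x \<in> X" using AX x by (rule subsetD)
    have "{x} \<notin> add_singletons X A P"
      using singleton_add_singletons[OF C[OF P(1)] xX] P(2) x by simp
    then show "x \<in> chain_supp X (add_singletons X A ` C)"
      unfolding chain_supp_def using xX P(1) by auto
  qed
qed

lemma chain_supp_blocks_in:
  assumes D: "\<And>P. P \<in> D \<Longrightarrow> partition_on X P"
  defines "A \<equiv> chain_supp X D"
  shows "\<And>P. P \<in> D \<Longrightarrow> partition_on A (blocks_in A P)"
    and "add_singletons X A ` blocks_in A ` D = D"
    and "full A (blocks_in A ` D)"
proof -
  have AX: "A \<subseteq> X" unfolding A_def chain_supp_def by auto
  have s: "{x} \<in> P" if "P \<in> D" "x \<in> X" "x \<notin> A" for x P
    using that unfolding A_def chain_supp_def by auto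
  show "partition_on A (blocks_in A P)" if "P \<in> D" for P
    by (rule partition_on_blocks_in[OF D[OF that] AX s[OF that]])
  have "add_singletons X A (blocks_in A P) = P" if "P \<in> D" for P
    by (rule add_singletons_blocks_in[OF D[OF that] AX s[OF that]])
  then show "add_singletons X A ` blocks_in A ` D = D" by (simp add: image_image)
  show "full A (blocks_in A ` D)" unfolding full_def
  proof
    fix x assume "x \<in> A"
    then obtain P where "P \<in> D" "{x} \<notin> P" unfolding A_def chain_supp_def by auto
    then show "\<exists>P\<in>blocks_in A ` D. {x} \<notin> P"
      by (intro bexI[of _ "blocks_in A P"]) (simp_all add: blocks_in_def)
  qed
qed

text \<open>A member in which \<open>x\<close> is not a singleton is carried to a member of the same
  chain in which \<open>\<sigma> x\<close> is not. The inclusion becomes an equality by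
  counting.\<close>

lemma image_chain_supp:
  assumes X: "finite X" and s: "\<sigma> permutes X" and D: "\<And>P. P \<in> D \<Longrightarrow> partition_on X P"
    and fixed: "act_chain \<sigma> D = D"
  shows "\<sigma> ` chain_supp X D = chain_supp X D"
proof (rule card_subset_eq)
  show "finite (chain_supp X D)" using X by (simp add: chain_supp_def)
  show "card (\<sigma> ` chain_supp X D) = card (chain_supp X D)"
    by (rule card_image, rule inj_on_subset[OF permutes_inj[OF s]]) simp
  show "\<sigma> ` chain_supp X D \<subseteq> chain_supp X D"
  proof (rule image_subsetI)
    fix x assume "x \<in> chain_supp X D"
    then obtain P where P: "x \<in> X" "P \<in> D" "{x} \<notin> P" by (auto simp: chain_supp_def)
    have "{\<sigma> x} \<notin> act_part \<sigma> P"
      using singleton_act_part[OF D[OF P(2)] inj_on_subset[OF permutes_inj[OF s]] P(1)] P(3) by simp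
    moreover have "act_part \<sigma> P \<in> D" using fixed P(2) unfolding act_chain_def by auto
    moreover have "\<sigma> x \<in> X" using permutes_in_image[OF s] P(1) by simp
    ultimately show "\<sigma> x \<in> chain_supp X D" unfolding chain_supp_def by auto
  qed
qed

text \<open>A fixed chain corresponds to the pair of its support, which is stable under
  \<open>\<sigma>\<close>, and its restriction to that support; adding singletons is the
  inverse.\<close>

lemma card_fixed_rchains:
  assumes X: "finite X" and s: "\<sigma> permutes X"
  shows "card {D. rchain X T D \<and> act_chain \<sigma> D = D} =
    (\<Sum>A | A \<subseteq> X \<and> \<sigma> ` A = A. card (supported T A \<sigma>))"
proof -
  let ?S = "{A. A \<subseteq> X \<and> \<sigma> ` A = A}"
  let ?Y = "{D. rchain X T D \<and> act_chain \<sigma> D = D}"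
  define F where "F p = add_singletons X (fst p) ` snd p" for p :: "nat set \<times> nat set set set"
  define G where "G D = (chain_supp X D, blocks_in (chain_supp X D) ` D)" for D
  define Z where "Z = (SIGMA A:?S. supported T A \<sigma>)"
  have Z: "A \<subseteq> X" "\<sigma> ` A = A" "rchain A T C" "full A C" "act_chain \<sigma> C = C" if "(A, C) \<in> Z" for A C
    using that unfolding Z_def supported_def by auto
  have h1: "\<forall>p\<in>Z. G (F p) = p"
  proof
    fix p assume p: "p \<in> Z"
    obtain A C where AC: "p = (A, C)" by (cases p)
    note z = Z[OF p[unfolded AC]]
    have "chain_supp X (F p) = A"
      unfolding F_def AC using chain_supp_add_singletons[OF z(1) rchainD(1)[OF z(3)] z(4)] by simp
    moreover have "blocks_in A ` F p = C"
      unfolding F_def AC using blocks_in_add_singletons[OF rchainD(1)[OF z(3)]] by (simp add: image_image)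
    ultimately show "G (F p) = p" by (simp add: G_def AC)
  qed
  have Y: "rchain X T D" "act_chain \<sigma> D = D" if "D \<in> ?Y" for D using that by simp_all
  have h2: "\<forall>D\<in>?Y. F (G D) = D"
  proof
    fix D assume "D \<in> ?Y"
    from chain_supp_blocks_in(2)[OF rchainD(1)[OF Y(1)[OF this]]]
    show "F (G D) = D" by (simp add: F_def G_def)
  qed
  have h3: "F ` Z \<subseteq> ?Y"
  proof (rule image_subsetI)
    fix p assume p: "p \<in> Z"
    obtain A C where AC: "p = (A, C)" by (cases p)
    note z = Z[OF p[unfolded AC]]
    have "rchain X T (F p)"
      unfolding F_def AC using rchain_add_singletons_iff[OF X z(1) rchainD(1)[OF z(3)]] z(3) by simp
    moreover have "act_chain \<sigma> (F p) = F p"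
      unfolding F_def AC using act_chain_add_singletons[OF s z(2), of C] z(5) by simp
    ultimately show "F p \<in> ?Y" by simp
  qed
  have h4: "G ` ?Y \<subseteq> Z"
  proof (rule image_subsetI)
    fix D assume "D \<in> ?Y"
    note y = Y[OF this]
    let ?A = "chain_supp X D"
    let ?C = "blocks_in ?A ` D"
    have Dp: "partition_on X P" if "P \<in> D" for P by (rule rchainD(1)[OF y(1) that])
    have b1: "partition_on ?A (blocks_in ?A P)" if "P \<in> D" for P
      by (rule chain_supp_blocks_in(1)) (simp_all add: Dp that)
    have b2: "add_singletons X ?A ` ?C = D" by (rule chain_supp_blocks_in(2)) (rule Dp)
    have b3: "full ?A ?C" by (rule chain_supp_blocks_in(3)) (rule Dp)
    have AX: "?A \<subseteq> X" by (auto simp: chain_supp_def)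
    have sA: "\<sigma> ` ?A = ?A" by (rule image_chain_supp[OF X s rchainD(1)[OF y(1)] y(2)])
    have C: "partition_on ?A P" if "P \<in> ?C" for P using that b1 by auto
    have "rchain ?A T ?C"
    proof -
      have "rchain X T (add_singletons X ?A ` ?C) \<longleftrightarrow> rchain ?A T ?C"
        by (rule rchain_add_singletons_iff[OF X AX]) (rule C)
      then show ?thesis using y(1) by (simp only: b2)
    qed
    moreover have "act_chain \<sigma> ?C = ?C"
    proof -
      \<comment> \<open>Invariance of the restricted chain is obtained by cancellation: adding
        singletons to its image under \<open>\<sigma>\<close> gives back \<open>D\<close>, and
        \<open>blocks_in\<close> undoes the adding of singletons.\<close>
      have e: "add_singletons X ?A ` act_chain \<sigma> ?C = D"
        using act_chain_add_singletons[OF s sA, of ?C] y(2) by (simp only: b2)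
      have ap: "partition_on ?A P" if "P \<in> act_chain \<sigma> ?C" for P
      proof -
        obtain Q where Q: "Q \<in> ?C" "P = act_part \<sigma> Q"
          using \<open>P \<in> act_chain \<sigma> ?C\<close> unfolding act_chain_def by (rule imageE)
        have "bij_betw \<sigma> ?A ?A" using sA inj_on_subset[OF permutes_inj[OF s]] by (simp add: bij_betw_def)
        then show ?thesis unfolding Q(2) by (rule partition_on_act_part[OF C[OF Q(1)]])
      qed
      have "?C = blocks_in ?A ` add_singletons X ?A ` act_chain \<sigma> ?C" by (simp only: e)
      also have "\<dots> = (\<lambda>P. P) ` act_chain \<sigma> ?C"
        unfolding image_image by (rule image_cong[OF refl]) (rule blocks_in_add_singletons[OF ap])
      finally show ?thesis by simp
    qed
    ultimately show "G D \<in> Z" using AX sA b3 unfolding Z_def G_def supported_def by simp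
  qed
  have "bij_betw F Z ?Y" by (rule bij_betw_byWitness[OF h1 h2 h3 h4])
  then have "card ?Y = card Z" by (rule bij_betw_same_card[symmetric])
  also have "\<dots> = (\<Sum>A\<in>?S. card (supported T A \<sigma>))"
    unfolding Z_def
  proof (rule card_SigmaI)
    show "finite ?S" using X by simp
    show "\<forall>A\<in>?S. finite (supported T A \<sigma>)" using X finite_supported finite_subset by (metis mem_Collect_eq)
  qed
  finally show ?thesis .
qed

section \<open>Stability of the rank-selected characters\<close>

lemma alpha_eq_sum_Ind:
  assumes n: "0 < n" and T: "\<And>t. t \<in> T \<Longrightarrow> t < n" "\<And>t. t \<in> T \<Longrightarrow> t \<le> i" and s: "\<sigma> permutes {1..n}"
  shows "of_int (alpha n T \<sigma>) = (\<Sum>m\<le>2 * i. Ind m (\<lambda>A \<sigma>. of_nat (card (supported T A \<sigma>))) n \<sigma>)"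
proof -
  let ?S = "{A. A \<subseteq> {1..n} \<and> \<sigma> ` A = A}"
  let ?f = "\<lambda>A. card (supported T A \<sigma>)"
  have fin: "finite ?S" by simp
  have "card {C. is_maxchain n T C \<and> act_chain \<sigma> C = C} = (\<Sum>A\<in>?S. ?f A)"
  proof -
    have "is_maxchain n T C \<longleftrightarrow> rchain {1..n} T C" for C by (rule is_maxchain_iff[OF n]) (rule T(1))
    then show ?thesis by (simp only: card_fixed_rchains[OF finite_atLeastAtMost s])
  qed
  also have "\<dots> = (\<Sum>A\<in>{A\<in>?S. card A \<le> 2 * i}. ?f A)"
  proof (rule sum.mono_neutral_right[OF fin])
    show "\<forall>A\<in>?S - {A\<in>?S. card A \<le> 2 * i}. ?f A = 0"
    proof
      fix A assume A: "A \<in> ?S - {A\<in>?S. card A \<le> 2 * i}"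
      then have "finite A" "\<not> card A \<le> 2 * i" using finite_subset[of A "{1..n}"] by auto
      then have "supported T A \<sigma> = {}" using supported_small[of A T i _ \<sigma>] T(2) by auto
      then show "?f A = 0" by simp
    qed
  qed blast
  also have "\<dots> = (\<Sum>m\<le>2 * i. \<Sum>A\<in>{A\<in>{A\<in>?S. card A \<le> 2 * i}. card A = m}. ?f A)"
    by (rule sum.group[symmetric]) (use fin in simp_all, auto)
  also have "\<dots> = (\<Sum>m\<le>2 * i. \<Sum>A | A \<subseteq> {1..n} \<and> card A = m \<and> \<sigma> ` A = A. ?f A)"
    by (intro sum.cong refl) auto
  finally have "alpha n T \<sigma> = int (\<Sum>m\<le>2 * i. \<Sum>A | A \<subseteq> {1..n} \<and> card A = m \<and> \<sigma> ` A = A. ?f A)"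
    by (simp only: alpha_def)
  then show ?thesis by (simp add: Ind_def)
qed

text \<open>Supports have size \<open>m \<le> 2 * i\<close> and \<open>stable_Ind\<close> asks for
  \<open>2 * m \<le> n0\<close>, whence \<open>4 * i\<close>. Only an upper bound on
  \<open>T\<close> is assumed, so that all subsets of \<open>S\<close> are covered with a common
  threshold.\<close>

lemma stable_alpha:
  assumes i: "0 < i" and T: "\<And>t. t \<in> T \<Longrightarrow> t \<le> i"
  shows "stable (4 * i) (\<lambda>n \<sigma>. of_int (alpha n T \<sigma>))"
proof -
  have "stable (4 * i) (\<lambda>n \<sigma>. \<Sum>m\<in>{..2 * i}. 1 * Ind m (\<lambda>A \<sigma>. of_nat (card (supported T A \<sigma>))) n \<sigma>)"
    by (rule stable_lincomb, rule stable_Ind[OF natural_supported]) (use i in auto)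
  then show ?thesis
  proof (rule stable_cong)
    fix n \<sigma> assume n: "4 * i \<le> n" "\<sigma> permutes {1..n}"
    have "t < n" if "t \<in> T" for t using T[OF that] n(1) i by linarith
    then show "rat_of_int (alpha n T \<sigma>) = (\<Sum>m\<in>{..2 * i}. 1 * Ind m (\<lambda>A \<sigma>. of_nat (card (supported T A \<sigma>))) n \<sigma>)"
      using alpha_eq_sum_Ind[of n T i \<sigma>] T n i by simp
  qed
qed

theorem mainTheorem18:
  fixes S :: "nat set" and i :: nat
  assumes "finite S" and "S \<noteq> {}" and "0 \<notin> S" and "i = Max S"
  shows "stabilizes_beyond (\<lambda>n. alpha n S) (4 * i) \<and> stabilizes_beyond (\<lambda>n. beta n S) (4 * i)"
proof
  have "i \<in> S" using assms by simp
  then have i: "0 < i" using assms(3) by (cases i) auto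
  have S: "t \<le> i" if "t \<in> S" for t using that assms by simp
  show "stabilizes_beyond (\<lambda>n. alpha n S) (4 * i)"
    by (rule stable_imp_stabilizes_beyond[OF stable_alpha[OF i S]]) (use i in auto)
  have "stable (4 * i) (\<lambda>n \<sigma>. \<Sum>T\<in>Pow S. (-1) ^ card (S - T) * of_int (alpha n T \<sigma>))"
    by (rule stable_lincomb, rule stable_alpha[OF i]) (use S in auto)
  then have "stable (4 * i) (\<lambda>n \<sigma>. of_int (beta n S \<sigma>))"
    by (rule stable_cong) (simp add: beta_def)
  then show "stabilizes_beyond (\<lambda>n. beta n S) (4 * i)"
    by (rule stable_imp_stabilizes_beyond) (use i in simp)
qed

end
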